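(* Let $n\ge3$ and let $F:M^n\to\mathbb{A}^{n+1}$ be a strictly locally convex proper affine sphere having a pointwise $SO(n-1)$ symmetry whose function $r$ (see context) vanishes nowhere. Then, locally and in suitable local coordinates $(t,\vec u)$, with $t$ in an open interval and $\vec u$ in an open subset of $\mathbb{R}^{n-1}$, $F$ is affine congruent to one of the following: 1. $F(t,\vec u)=(\gamma_1(t)\phi(\vec u),\gamma_2(t))$, where $\phi$ is the immersion of an $\epsilon$-quadric in $\mathbb{R}^n$ with $\epsilon\neq0$, and $\gamma=(\gamma_1,\gamma_2)$ is a centro-affine curve satisfying $$c\left(\dot\gamma_2\gamma_1-\dot\gamma_1\gamma_2\right)^{n+2}\gamma_1^{n-1}=\dot\gamma_2^{n-1}\left(\ddot\gamma_1\dot\gamma_2-\ddot\gamma_2\dot\gamma_1\right)$$ for some constant $c\in\mathbb{R}\setminus\{0\}$. 2. $F(t,\vec u)=\left(\gamma_1(t)\vec u,\ \gamma_1(t)\frac{\|\vec u\|^2}{2}+\gamma_2(t),\ \gamma_1(t)\right)$, where $\gamma=(\gamma_1,\gamma_2)$ is a centro-affine curve satisfying $$c\left(\dot\gamma_1\gamma_2-\dot\gamma_2\gamma_1\right)^{n+2}\gamma_1^{n-1}=\dot\gamma_1^{n-1}\left(\ddot\gamma_2\dot\gamma_1-\ddot\gamma_1\dot\gamma_2\right)$$ for some constant $c\in\mathbb{R}\setminus\{0\}$.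
   Context: $\mathbb{A}^{n+1}$ is $\mathbb{R}^{n+1}$ with its flat connection $D$ and the determinant as volume form. For an immersed hypersurface with transversal vector field $\xi$ write $D_XY=\nabla_XY+h(X,Y)\xi$, $D_X\xi=-SX+\tau(X)\xi$, and $\omega(X_1,\dots,X_n)=\det(X_1,\dots,X_n,\xi)$. If $h$ is non-degenerate, the affine normal is the transversal field $\xi$, unique up to sign, with $\nabla\omega=0$ (equivalently $\tau=0$) and $\omega(X_1,\dots,X_n)^2=|\det(h(X_i,X_j))|$ for tangent frames. The hypersurface is strictly locally convex when $h$ is definite, and the sign of $\xi$ is then chosen so that $h$ is positive definite. With this $\xi$, $h$ is the affine metric, $S$ the shape operator, $\nabla$ the Blaschke connection, $\hat\nabla$ the Levi-Civita connection of $h$, and $K(X,Y)=\nabla_XY-\hat\nabla_XY$ the difference tensor. An affine sphere is a hypersurface with $S=\lambda\,\mathrm{Id}$; it is proper when $S\neq0$, i.e. $\lambda$ is a non-zero constant (the affine normals meet in a common centre). Pointwise $SO(n-1)$ symmetry: at every $p\in M$ there is an $h$-unit vector $X_1\in T_pM$ such that every linear $g:T_pM\to T_pM$ with $gX_1=X_1$ which restricts to an element of $SO(\langle X_1\rangle^\perp)$ satisfies $S(gX)=gS(X)$ and $K(gX,gY)=gK(X,Y)$ for all $X,Y\in T_pM$. The function $r$: in an $h$-orthonormal frame $X_1,\dots,X_n$ with $X_1$ the axis of symmetry, $K(X_1,X_1)=(n-1)rX_1$, $K(X_1,X_i)=-rX_i$, $K(X_i,X_j)=-r\delta_{ij}X_1$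 for $i,j\ge2$. It is a standing assumption that $r$ vanishes nowhere, with $X_1$ chosen so that $r>0$; then $X_1$ and $r$ are smooth. For $\epsilon=\pm1$, an $\epsilon$-quadric in $\mathbb{R}^n$ is a convex quadratic hypersurface of affine mean curvature $\epsilon$, centred at the origin: up to an equi-affine linear transformation it is an open part of the unit sphere ($\epsilon=1$), or of one sheet of $x_1^2+\dots+x_{n-1}^2-x_n^2=-1$ ($\epsilon=-1$). A planar curve $\gamma$ is centro-affine if its position vector is everywhere transversal to its tangent, i.e. $\gamma_1\dot\gamma_2-\gamma_2\dot\gamma_1\neq0$. Affine congruent means equal up to an affine transformation of $\mathbb{A}^{n+1}$. Dots denote derivatives with respect to $t$. *)

theory Defs
  imports "HOL-Analysis.Analysis"
begin

text \<open>
  Conventions.  \<open>n\<close>-dimensional coordinates live in \<open>real^'n\<close> and the ambient affine space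
  of dimension \<open>n + 1\<close> is \<open>real^'n option\<close>, where \<open>None\<close> is the index of the last coordinate.
  Manifolds are described by local parametrizations, i.e. by the inverses of charts, so that
  \<open>F \<circ> \<psi>\<close> is the coordinate expression of a map \<open>F\<close> on the manifold.
\<close>

definition vsnoc :: "real^'n \<Rightarrow> real \<Rightarrow> real^('n::finite) option" where
  "vsnoc x a = (\<chi> i. case i of None \<Rightarrow> a | Some j \<Rightarrow> x $ j)"

section \<open>Smooth maps and manifolds\<close>

text \<open>\<open>C_diff k f V\<close> is the usual notion of class \<open>C\<^sup>k\<close> for open \<open>V\<close> and finite-dimensional domains.\<close>

primrec C_diff ::
  "nat \<Rightarrow> ('a::euclidean_space \<Rightarrow> 'b::real_normed_vector) \<Rightarrow> 'a set \<Rightarrow> bool" where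
  "C_diff 0 f V \<longleftrightarrow> continuous_on V f"
| "C_diff (Suc k) f V \<longleftrightarrow> (\<forall>x\<in>V. f differentiable (at x)) \<and>
     (\<forall>v. C_diff k (\<lambda>x. frechet_derivative f (at x) v) V)"

definition smooth_on :: "'a set \<Rightarrow> ('a::euclidean_space \<Rightarrow> 'b::real_normed_vector) \<Rightarrow> bool" where
  "smooth_on V f \<longleftrightarrow> (\<forall>k. C_diff k f V)"

definition immersion_on :: "'a set \<Rightarrow> ('a::euclidean_space \<Rightarrow> 'b::real_normed_vector) \<Rightarrow> bool" where
  "immersion_on V f \<longleftrightarrow> smooth_on V f \<and> (\<forall>x\<in>V. inj (frechet_derivative f (at x)))"

text \<open>A local parametrization smoothly compatible with all members of \<open>A\<close>; its coordinate
  space \<open>'e\<close> may be another Euclidean space than the one used by \<open>A\<close>.\<close>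

definition local_parametrization ::
  "'m topology \<Rightarrow> ('a::euclidean_space set \<times> ('a \<Rightarrow> 'm)) set \<Rightarrow>
   'e::euclidean_space set \<Rightarrow> ('e \<Rightarrow> 'm) \<Rightarrow> bool" where
  "local_parametrization M A V \<psi> \<longleftrightarrow>
     open V \<and> openin M (\<psi> ` V) \<and>
     homeomorphic_map (top_of_set V) (subtopology M (\<psi> ` V)) \<psi> \<and>
     (\<forall>(V', \<psi>')\<in>A.
        smooth_on (V \<inter> \<psi> -` (\<psi>' ` V')) (inv_into V' \<psi>' \<circ> \<psi>) \<and>
        smooth_on (V' \<inter> \<psi>' -` (\<psi> ` V)) (inv_into V \<psi> \<circ> \<psi>'))"

definition smooth_manifold ::
  "'m topology \<Rightarrow> ('a::euclidean_space set \<times> ('a \<Rightarrow> 'm)) set \<Rightarrow> bool" where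
  "smooth_manifold M A \<longleftrightarrow>
     Hausdorff_space M \<and> second_countable M \<and>
     topspace M = (\<Union>(V, \<psi>)\<in>A. \<psi> ` V) \<and>
     (\<forall>(V, \<psi>)\<in>A. local_parametrization M A V \<psi>)"

section \<open>The induced structure of a hypersurface in coordinates\<close>

text \<open>
  In this section \<open>f\<close> is the coordinate expression of an immersed hypersurface and \<open>\<xi>\<close> that of a
  transversal field.  Tangent vectors are represented by their coordinate vectors in \<open>real^'n\<close>,
  and tensors are evaluated on constant coordinate vector fields.  \<open>tan_part\<close> and
  \<open>trans_part\<close> are the components \<open>v\<close> and \<open>a\<close> of \<open>w = df(v) + a \<xi>\<close>.
\<close>

definition tan_part ::
  "(real^'n \<Rightarrow> real^'n option) \<Rightarrow> (real^'n \<Rightarrow> real^'n option) \<Rightarrow> real^'n \<Rightarrow>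
   real^'n option \<Rightarrow> real^('n::finite)" where
  "tan_part f \<xi> x w = (THE v. \<exists>a. w = frechet_derivative f (at x) v + a *\<^sub>R \<xi> x)"

definition trans_part ::
  "(real^'n \<Rightarrow> real^'n option) \<Rightarrow> (real^'n \<Rightarrow> real^'n option) \<Rightarrow> real^'n \<Rightarrow>
   real^('n::finite) option \<Rightarrow> real" where
  "trans_part f \<xi> x w = (THE a. \<exists>v. w = frechet_derivative f (at x) v + a *\<^sub>R \<xi> x)"

text \<open>\<open>D\<^sub>u (df(v))\<close> at \<open>x\<close>, for constant \<open>v\<close>.\<close>

definition flat_deriv ::
  "(real^'n \<Rightarrow> real^'n option) \<Rightarrow> real^'n \<Rightarrow> real^'n \<Rightarrow> real^'n \<Rightarrow> real^('n::finite) option" where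
  "flat_deriv f x u v = frechet_derivative (\<lambda>y. frechet_derivative f (at y) v) (at x) u"

definition conn ::
  "(real^'n \<Rightarrow> real^'n option) \<Rightarrow> (real^'n \<Rightarrow> real^'n option) \<Rightarrow> real^'n \<Rightarrow>
   real^'n \<Rightarrow> real^'n \<Rightarrow> real^('n::finite)" where
  "conn f \<xi> x u v = tan_part f \<xi> x (flat_deriv f x u v)"

definition aff_form ::
  "(real^'n \<Rightarrow> real^'n option) \<Rightarrow> (real^'n \<Rightarrow> real^'n option) \<Rightarrow> real^'n \<Rightarrow>
   real^'n \<Rightarrow> real^('n::finite) \<Rightarrow> real" where
  "aff_form f \<xi> x u v = trans_part f \<xi> x (flat_deriv f x u v)"

definition shape_op ::
  "(real^'n \<Rightarrow> real^'n option) \<Rightarrow> (real^'n \<Rightarrow> real^'n option) \<Rightarrow> real^'n \<Rightarrow>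
   real^'n \<Rightarrow> real^('n::finite)" where
  "shape_op f \<xi> x u = - tan_part f \<xi> x (frechet_derivative \<xi> (at x) u)"

definition vol_form ::
  "(real^'n \<Rightarrow> real^'n option) \<Rightarrow> (real^'n \<Rightarrow> real^'n option) \<Rightarrow> real^'n \<Rightarrow>
   ('n::finite \<Rightarrow> real^'n) \<Rightarrow> real" where
  "vol_form f \<xi> x X =
     det (\<chi> j. case j of None \<Rightarrow> \<xi> x | Some i \<Rightarrow> frechet_derivative f (at x) (X i))"

text \<open>\<open>(\<nabla>\<^sub>u \<omega>)(X\<^sub>1, \<dots>, X\<^sub>n)\<close> for constant fields \<open>u\<close> and \<open>X\<^sub>i\<close>.\<close>

definition cov_deriv_vol ::
  "(real^'n \<Rightarrow> real^'n option) \<Rightarrow> (real^'n \<Rightarrow> real^'n option) \<Rightarrow> real^'n \<Rightarrow>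
   real^'n \<Rightarrow> ('n::finite \<Rightarrow> real^'n) \<Rightarrow> real" where
  "cov_deriv_vol f \<xi> x u X =
     frechet_derivative (\<lambda>y. vol_form f \<xi> y X) (at x) u
     - (\<Sum>i\<in>UNIV. vol_form f \<xi> x (X(i := conn f \<xi> x u (X i))))"

definition tangent_frame :: "('n::finite \<Rightarrow> real^'n) \<Rightarrow> bool" where
  "tangent_frame X \<longleftrightarrow> inj X \<and> independent (range X)"

definition affine_normal_on ::
  "(real^'n) set \<Rightarrow> (real^'n \<Rightarrow> real^'n option) \<Rightarrow> (real^'n \<Rightarrow> real^('n::finite) option) \<Rightarrow> bool" where
  "affine_normal_on V f \<xi> \<longleftrightarrow>
     smooth_on V \<xi> \<and>
     (\<forall>x\<in>V. \<xi> x \<notin> range (frechet_derivative f (at x)) \<and>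
        (\<forall>u. (\<forall>v. aff_form f \<xi> x u v = 0) \<longrightarrow> u = 0) \<and>
        (\<forall>u X. cov_deriv_vol f \<xi> x u X = 0) \<and>
        (\<forall>X. tangent_frame X \<longrightarrow>
           (vol_form f \<xi> x X)\<^sup>2 = \<bar>det (\<chi> i j. aff_form f \<xi> x (X i) (X j))\<bar>))"

text \<open>Since constant fields commute, a torsion-free connection is one that is symmetric on them.\<close>

definition levi_civita ::
  "(real^'n \<Rightarrow> real^'n \<Rightarrow> real^'n \<Rightarrow> real) \<Rightarrow> real^'n \<Rightarrow> real^'n \<Rightarrow> real^'n \<Rightarrow> real^('n::finite)" where
  "levi_civita g x = (THE \<Gamma>. bilinear \<Gamma> \<and> (\<forall>u v. \<Gamma> u v = \<Gamma> v u) \<and>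
     (\<forall>u v w. frechet_derivative (\<lambda>y. g y v w) (at x) u = g x (\<Gamma> u v) w + g x v (\<Gamma> u w)))"

definition diff_tensor ::
  "(real^'n \<Rightarrow> real^'n option) \<Rightarrow> (real^'n \<Rightarrow> real^'n option) \<Rightarrow> real^'n \<Rightarrow>
   real^'n \<Rightarrow> real^'n \<Rightarrow> real^('n::finite)" where
  "diff_tensor f \<xi> x u v = conn f \<xi> x u v - levi_civita (aff_form f \<xi>) x u v"

section \<open>Pointwise symmetry\<close>

text \<open>
  The linear maps fixing \<open>X\<^sub>1\<close> and restricting to an element of \<open>SO(\<langle>X\<^sub>1\<rangle>\<^sup>\<bottom>)\<close>, with respect to the
  scalar product \<open>b\<close>.  As \<open>g\<close> fixes \<open>X\<^sub>1\<close> and preserves \<open>\<langle>X\<^sub>1\<rangle>\<^sup>\<bottom>\<close>, the determinant of the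
  restriction of \<open>g\<close> is that of \<open>g\<close>.
\<close>

definition axis_rotation ::
  "(real^'n \<Rightarrow> real^'n \<Rightarrow> real) \<Rightarrow> real^'n \<Rightarrow> (real^'n \<Rightarrow> real^('n::finite)) \<Rightarrow> bool" where
  "axis_rotation b X1 g \<longleftrightarrow>
     linear g \<and> g X1 = X1 \<and>
     (\<forall>v. b X1 v = 0 \<longrightarrow> b X1 (g v) = 0) \<and>
     (\<forall>v w. b X1 v = 0 \<longrightarrow> b X1 w = 0 \<longrightarrow> b (g v) (g w) = b v w) \<and>
     det (matrix g) = 1"

definition symmetry_axis ::
  "(real^'n \<Rightarrow> real^'n option) \<Rightarrow> (real^'n \<Rightarrow> real^'n option) \<Rightarrow> real^'n \<Rightarrow> real^('n::finite) \<Rightarrow> bool" where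
  "symmetry_axis f \<xi> x X1 \<longleftrightarrow>
     aff_form f \<xi> x X1 X1 = 1 \<and>
     (\<forall>g. axis_rotation (aff_form f \<xi> x) X1 g \<longrightarrow>
        (\<forall>v. shape_op f \<xi> x (g v) = g (shape_op f \<xi> x v)) \<and>
        (\<forall>v w. diff_tensor f \<xi> x (g v) (g w) = g (diff_tensor f \<xi> x v w)))"

definition orthonormal_frame ::
  "(real^'n \<Rightarrow> real^'n \<Rightarrow> real) \<Rightarrow> ('n::finite \<Rightarrow> real^'n) \<Rightarrow> bool" where
  "orthonormal_frame b X \<longleftrightarrow> (\<forall>i j. b (X i) (X j) = (if i = j then 1 else 0))"

text \<open>\<open>r\<close> is the value at \<open>x\<close> of the function \<open>r\<close> belonging to the axis \<open>X1\<close>; the index \<open>a\<close>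
  plays the role of the first index of the frame.\<close>

definition symmetry_coeff ::
  "(real^'n \<Rightarrow> real^'n option) \<Rightarrow> (real^'n \<Rightarrow> real^'n option) \<Rightarrow> real^'n \<Rightarrow>
   real^('n::finite) \<Rightarrow> real \<Rightarrow> bool" where
  "symmetry_coeff f \<xi> x X1 r \<longleftrightarrow>
     (\<forall>X a. orthonormal_frame (aff_form f \<xi> x) X \<longrightarrow> X a = X1 \<longrightarrow>
        diff_tensor f \<xi> x X1 X1 = (real (CARD('n) - 1) * r) *\<^sub>R X1 \<and>
        (\<forall>i. i \<noteq> a \<longrightarrow> diff_tensor f \<xi> x X1 (X i) = (- r) *\<^sub>R X i) \<and>
        (\<forall>i j. i \<noteq> a \<longrightarrow> j \<noteq> a \<longrightarrow>
           diff_tensor f \<xi> x (X i) (X j) = (if i = j then (- r) *\<^sub>R X1 else 0)))"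

section \<open>Hypersurfaces parametrized by a manifold\<close>

definition immersed_hypersurface ::
  "((real^'n) set \<times> (real^'n \<Rightarrow> 'm)) set \<Rightarrow> ('m \<Rightarrow> real^('n::finite) option) \<Rightarrow> bool" where
  "immersed_hypersurface A F \<longleftrightarrow> (\<forall>(V, \<psi>)\<in>A. immersion_on V (F \<circ> \<psi>))"

definition affine_normal ::
  "((real^'n) set \<times> (real^'n \<Rightarrow> 'm)) set \<Rightarrow> ('m \<Rightarrow> real^'n option) \<Rightarrow>
   ('m \<Rightarrow> real^('n::finite) option) \<Rightarrow> bool" where
  "affine_normal A F \<xi> \<longleftrightarrow> (\<forall>(V, \<psi>)\<in>A. affine_normal_on V (F \<circ> \<psi>) (\<xi> \<circ> \<psi>))"

text \<open>Definiteness of the affine metric, together with the choice of the sign of \<open>\<xi>\<close>.\<close>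

definition strictly_locally_convex ::
  "((real^'n) set \<times> (real^'n \<Rightarrow> 'm)) set \<Rightarrow> ('m \<Rightarrow> real^'n option) \<Rightarrow>
   ('m \<Rightarrow> real^('n::finite) option) \<Rightarrow> bool" where
  "strictly_locally_convex A F \<xi> \<longleftrightarrow>
     (\<forall>(V, \<psi>)\<in>A. \<forall>x\<in>V. \<forall>v. v \<noteq> 0 \<longrightarrow> aff_form (F \<circ> \<psi>) (\<xi> \<circ> \<psi>) x v v > 0)"

definition proper_affine_sphere ::
  "((real^'n) set \<times> (real^'n \<Rightarrow> 'm)) set \<Rightarrow> ('m \<Rightarrow> real^'n option) \<Rightarrow>
   ('m \<Rightarrow> real^('n::finite) option) \<Rightarrow> bool" where
  "proper_affine_sphere A F \<xi> \<longleftrightarrow>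
     (\<exists>l. l \<noteq> 0 \<and> (\<forall>(V, \<psi>)\<in>A. \<forall>x\<in>V. \<forall>v. shape_op (F \<circ> \<psi>) (\<xi> \<circ> \<psi>) x v = l *\<^sub>R v))"

definition pointwise_SO_symmetry ::
  "((real^'n) set \<times> (real^'n \<Rightarrow> 'm)) set \<Rightarrow> ('m \<Rightarrow> real^'n option) \<Rightarrow>
   ('m \<Rightarrow> real^('n::finite) option) \<Rightarrow> bool" where
  "pointwise_SO_symmetry A F \<xi> \<longleftrightarrow>
     (\<forall>(V, \<psi>)\<in>A. \<forall>x\<in>V. \<exists>X1. symmetry_axis (F \<circ> \<psi>) (\<xi> \<circ> \<psi>) x X1)"

text \<open>
  Under the symmetry assumption \<open>r\<close> exists for every axis, and \<open>r \<noteq> 0\<close> does not depend on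
  the axis: \<open>r = 0\<close> means that the difference tensor vanishes at the point.
\<close>

definition symmetry_coeff_nonvanishing ::
  "((real^'n) set \<times> (real^'n \<Rightarrow> 'm)) set \<Rightarrow> ('m \<Rightarrow> real^'n option) \<Rightarrow>
   ('m \<Rightarrow> real^('n::finite) option) \<Rightarrow> bool" where
  "symmetry_coeff_nonvanishing A F \<xi> \<longleftrightarrow>
     (\<forall>(V, \<psi>)\<in>A. \<forall>x\<in>V. \<forall>X1 r.
        symmetry_axis (F \<circ> \<psi>) (\<xi> \<circ> \<psi>) x X1 \<longrightarrow>
        symmetry_coeff (F \<circ> \<psi>) (\<xi> \<circ> \<psi>) x X1 r \<longrightarrow> r \<noteq> 0)"

section \<open>Quadrics, curves and the two model families\<close>

text \<open>The choice of the sheet is immaterial: an equi-affine linear map exchanges the sheets.\<close>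

definition model_quadric :: "real \<Rightarrow> (real^('k::finite) option) set" where
  "model_quadric \<epsilon> =
     (if \<epsilon> = 1 then {x. norm x = 1}
      else {x. (\<Sum>i\<in>UNIV. (x $ Some i)\<^sup>2) - (x $ None)\<^sup>2 = -1 \<and> x $ None > 0})"

definition quadric_immersion ::
  "real \<Rightarrow> (real^'k) set \<Rightarrow> (real^'k \<Rightarrow> real^('k::finite) option) \<Rightarrow> bool" where
  "quadric_immersion \<epsilon> W \<phi> \<longleftrightarrow>
     immersion_on W \<phi> \<and>
     (\<exists>T :: real^'k option^'k option. det T = 1 \<and>
        openin (top_of_set ((\<lambda>x. T *v x) ` model_quadric \<epsilon>)) (\<phi> ` W))"

definition centro_affine_curve :: "real set \<Rightarrow> (real \<Rightarrow> real) \<Rightarrow> (real \<Rightarrow> real) \<Rightarrow> bool" where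
  "centro_affine_curve I \<gamma>1 \<gamma>2 \<longleftrightarrow>
     smooth_on I \<gamma>1 \<and> smooth_on I \<gamma>2 \<and>
     (\<forall>t\<in>I. \<gamma>1 t * deriv \<gamma>2 t - \<gamma>2 t * deriv \<gamma>1 t \<noteq> 0)"

definition affine_transformation :: "(real^'d \<Rightarrow> real^('d::finite)) \<Rightarrow> bool" where
  "affine_transformation \<Phi> \<longleftrightarrow> (\<exists>B b. invertible B \<and> \<Phi> = (\<lambda>y. B *v y + b))"

end

theory Submission
  imports Defs
begin

text \<open>
  Let \<open>f\<close> be the position vector from the centre, so that the affine normal is \<open>-\<lambda>f\<close>.  The symmetry
  and apolarity give the cubic form of \<open>K\<close> the shape \<open>(n+2) r \<theta>\<^sup>3 - r Sym(\<theta> h)\<close> with \<open>\<theta> = h(X\<^sub>1, -)\<close>.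
  It is a Codazzi tensor, which forces \<open>dr\<close>, \<open>\<nabla>X\<^sub>1\<close> and all further invariants to be determined by \<open>r\<close>
  and one more function \<open>\<alpha>\<close>, both constant along the leaves of \<open>ker \<theta>\<close>.  Then suitable linear and
  quadratic forms on the ambient space, written in the moving frame given by \<open>f\<close> and its tangent
  vectors, are recurrent, i.e. their derivatives are multiples of themselves, and therefore they are
  constant up to scalar functions.  So there are a fixed linear form \<open>e\<close> and a fixed quadratic form
  \<open>Q\<close> for which \<open>e(f)\<close> and \<open>Q(f)\<close> are constant on the leaves, which are therefore sections of
  level sets of \<open>Q\<close> by parallel hyperplanes.  The value \<open>e(f)\<close> serves as the parameter \<open>t\<close>.  The function
  \<open>k = \<lambda> + \<alpha>\<^sup>2 - r\<^sup>2\<close> either vanishes identically or nowhere; the leaves are centred quadrics if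
  \<open>k \<noteq> 0\<close> and paraboloids if \<open>k = 0\<close>.  In both cases the quotient of the two sides of the differential
  equation for \<open>\<gamma>\<close> has derivative zero, hence is the constant \<open>c\<close>.
\<close>

section \<open>Calculus of smooth maps\<close>

text \<open>The axis is known only point by point and up to sign, so a smooth choice of it must
  precede every differentiation. Distributions are not integrated. A recurrent form at
  \<open>x\<close> is a scalar multiple of the form at a base point \<open>x0\<close>; as its value
  on \<open>f x\<close> is known, the fixed form at \<open>x0\<close> takes a known value on
  \<open>f x\<close>. Hence the leaves are level sets of an explicit function, and the inverse
  function theorem gives coordinates in which each invariant depends on \<open>t\<close> alone. The
  case distinction comes from the forms themselves: if \<open>kk = 0\<close>, then
  \<open>es = (al + r) et\<close> and \<open>Q = et^2\<close>, so these two no longer determine the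
  leaves, and the quadratic form \<open>R1\<close> replaces what is lost. The constant in the
  equation for the curve is forced to be the ratio of the two sides. Written through
  \<open>kk\<close>, \<open>q\<close>, \<open>s\<close>, or through \<open>al\<close>,
  \<open>r\<close>, \<open>m\<close>, the logarithmic derivatives of its factors cancel; behind this
  is the factor \<open>n + 1\<close> in \<open>dr = - (n + 1) r al th\<close>, which comes from the
  Codazzi equation.\<close>

abbreviation fder ::
  "('a::real_normed_vector \<Rightarrow> 'b::real_normed_vector) \<Rightarrow> 'a \<Rightarrow> 'a \<Rightarrow> 'b" where
  "fder f x \<equiv> frechet_derivative f (at x)"

lemma has_derivative_fder: "f differentiable (at x) \<Longrightarrow> (f has_derivative fder f x) (at x)"
  by (simp add: frechet_derivative_works)

lemma fder_eq: "(f has_derivative f') (at x) \<Longrightarrow> fder f x = f'"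
  using frechet_derivative_at by metis

text \<open>The definition picks a derivative from the set of all derivatives, and \<open>f\<close>
  and \<open>g\<close> have the same set; so the equality holds even where neither is
  differentiable.\<close>

lemma fder_cong:
  assumes "open V" "x \<in> V" "\<And>y. y \<in> V \<Longrightarrow> f y = g y"
  shows "fder f x = fder g x"
proof -
  have "(f has_derivative f') (at x) = (g has_derivative f') (at x)" for f'
    using has_derivative_transform_within_open[of f f' x UNIV V g]
      has_derivative_transform_within_open[of g f' x UNIV V f] assms by auto
  then show ?thesis
    by (simp add: frechet_derivative_def)
qed

section \<open>Closure of the class C^k under the usual operations\<close>

lemma C_diff_Suc_D: "C_diff (Suc k) f V \<Longrightarrow> C_diff k f V"
proof (induction k arbitrary: f)
  case 0
  then show ?case
    by (auto intro!: continuous_at_imp_continuous_on differentiable_imp_continuous_within)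
qed simp

lemma C_diff_imp_continuous_on: "C_diff k f V \<Longrightarrow> continuous_on V f"
  by (induction k) (auto dest: C_diff_Suc_D simp del: C_diff.simps(2))

lemma C_diff_subset: "C_diff k f V \<Longrightarrow> W \<subseteq> V \<Longrightarrow> C_diff k f W"
  by (induction k arbitrary: f) (auto intro: continuous_on_subset)

lemma C_diff_cong:
  assumes "open V" "\<And>x. x \<in> V \<Longrightarrow> f x = g x" "C_diff k f V"
  shows "C_diff k g V"
  using assms(2,3)
proof (induction k arbitrary: f g)
  case 0
  then show ?case by (simp cong: continuous_on_cong)
next
  case (Suc k)
  have "g differentiable (at x)" if "x \<in> V" for x
    using Suc.prems that has_derivative_transform_within_open[of f _ x UNIV V g] assms(1)
    by (simp add: differentiable_def) metis
  moreover have "C_diff k (\<lambda>x. fder g x v) V" for v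
    using Suc.IH[of "\<lambda>x. fder f x v" "\<lambda>x. fder g x v"] Suc.prems fder_cong[OF assms(1), of _ f g]
    by auto
  ultimately show ?case by simp
qed

text \<open>The inductions on the order of differentiability below go through this rule: an explicit
  formula for the derivative suffices, since \<open>fder\<close> agrees with it on the open
  set.\<close>

lemma C_diff_SucI:
  assumes "open V" "\<And>x. x \<in> V \<Longrightarrow> (f has_derivative f' x) (at x)"
    "\<And>v. C_diff k (\<lambda>x. f' x v) V"
  shows "C_diff (Suc k) f V"
proof -
  have "C_diff k (\<lambda>x. fder f x v) V" for v
    by (rule C_diff_cong[OF assms(1) _ assms(3)[of v]]) (simp add: fder_eq[OF assms(2)])
  then show ?thesis
    using assms(2) by (auto simp: differentiable_def)
qed

lemma C_diff_const [simp]: "C_diff k (\<lambda>x. c) V"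
  by (induction k arbitrary: c) auto

lemma C_diff_bounded_linear:
  assumes "open V" "bounded_linear L" "C_diff k f V"
  shows "C_diff k (\<lambda>x. L (f x)) V"
  using assms(3)
proof (induction k arbitrary: f)
  case 0
  then show ?case using assms(2) by (auto intro: bounded_linear.continuous_on)
next
  case (Suc k)
  show ?case
  proof (rule C_diff_SucI[OF assms(1)])
    fix x assume "x \<in> V"
    then show "((\<lambda>x. L (f x)) has_derivative (\<lambda>v. L (fder f x v))) (at x)"
      using Suc.prems by (intro bounded_linear.has_derivative[OF assms(2)] has_derivative_fder) auto
  qed (use Suc in auto)
qed

lemma C_diff_add:
  assumes "open V" "C_diff k f V" "C_diff k g V"
  shows "C_diff k (\<lambda>x. f x + g x) V"
  using assms(2,3)
proof (induction k arbitrary: f g)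
  case 0
  then show ?case by (auto intro: continuous_intros)
next
  case (Suc k)
  show ?case
  proof (rule C_diff_SucI[OF assms(1)])
    fix x assume "x \<in> V"
    then show "((\<lambda>x. f x + g x) has_derivative (\<lambda>v. fder f x v + fder g x v)) (at x)"
      using Suc.prems by (intro has_derivative_add has_derivative_fder) auto
  qed (use Suc in auto)
qed

lemma C_diff_bilinear:
  assumes "open V" "bounded_bilinear p" "C_diff k f V" "C_diff k g V"
  shows "C_diff k (\<lambda>x. p (f x) (g x)) V"
  using assms(3,4)
proof (induction k arbitrary: f g)
  case 0
  then show ?case using assms(2) by (auto intro: bounded_bilinear.continuous_on)
next
  case (Suc k)
  show ?case
  proof (rule C_diff_SucI[OF assms(1)])
    fix x assume "x \<in> V"
    then show "((\<lambda>x. p (f x) (g x)) has_derivative (\<lambda>v. p (f x) (fder g x v) + p (fder f x v) (g x))) (at x)"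
      using Suc.prems by (intro bounded_bilinear.FDERIV[OF assms(2)] has_derivative_fder) auto
  next
    fix v
    show "C_diff k (\<lambda>x. p (f x) (fder g x v) + p (fder f x v) (g x)) V"
      using Suc.prems C_diff_Suc_D[OF Suc.prems(1)] C_diff_Suc_D[OF Suc.prems(2)]
      by (intro C_diff_add[OF assms(1)] Suc.IH) auto
  qed
qed

lemma C_diff_sum:
  assumes "open V" "\<And>i. i \<in> S \<Longrightarrow> C_diff k (f i) V"
  shows "C_diff k (\<lambda>x. \<Sum>i\<in>S. f i x) V"
  using assms(2)
  by (induction S rule: infinite_finite_induct) (auto intro: C_diff_add[OF assms(1)])

lemma C_diff_prod:
  fixes f :: "'i \<Rightarrow> 'a::euclidean_space \<Rightarrow> real"
  assumes "open V" "\<And>i. i \<in> S \<Longrightarrow> C_diff k (f i) V"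
  shows "C_diff k (\<lambda>x. \<Prod>i\<in>S. f i x) V"
  using assms(2)
  by (induction S rule: infinite_finite_induct)
     (auto intro: C_diff_bilinear[OF assms(1) bounded_bilinear_mult])

lemma C_diff_comp:
  fixes f :: "'a::euclidean_space \<Rightarrow> 'b::euclidean_space"
  assumes "open V" "open W" "f ` V \<subseteq> W" "C_diff k f V" "C_diff k g W"
  shows "C_diff k (\<lambda>x. g (f x)) V"
  using assms(4,5)
proof (induction k arbitrary: g)
  case 0
  then show ?case using assms(3) continuous_on_compose2 by (metis C_diff.simps(1))
next
  case (Suc k)
  have dg: "(g has_derivative fder g (f x)) (at (f x))" if "x \<in> V" for x
    using Suc.prems that assms(3) by (intro has_derivative_fder) auto
  have df: "(f has_derivative fder f x) (at x)" if "x \<in> V" for x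
    using Suc.prems that by (intro has_derivative_fder) auto
  \<comment> \<open>\<open>C_diff\<close> controls the derivative of \<open>g\<close> only in
    constant directions, while \<open>fder f x v\<close> moves with \<open>x\<close>; expanding it
    in the basis separates the two.\<close>
  have expand: "fder g (f x) (fder f x v) = (\<Sum>b\<in>Basis. (fder f x v \<bullet> b) *\<^sub>R fder g (f x) b)"
    if "x \<in> V" for x v
  proof -
    interpret linear "fder g (f x)"
      using dg[OF that] has_derivative_linear by blast
    show ?thesis
      by (subst euclidean_representation[symmetric, of "fder f x v"]) (simp add: sum scale)
  qed
  show ?case
  proof (rule C_diff_SucI[OF assms(1)])
    fix x assume "x \<in> V"
    then show "((\<lambda>x. g (f x)) has_derivative (\<lambda>v. fder g (f x) (fder f x v))) (at x)"
      using diff_chain_at[OF df dg] by (simp add: o_def)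
  next
    fix v
    have "C_diff k (\<lambda>x. \<Sum>b\<in>Basis. (fder f x v \<bullet> b) *\<^sub>R fder g (f x) b) V"
    proof (intro C_diff_sum[OF assms(1)] C_diff_bilinear[OF assms(1) bounded_bilinear_scaleR])
      fix b :: 'b assume "b \<in> Basis"
      show "C_diff k (\<lambda>x. fder f x v \<bullet> b) V"
        using Suc.prems by (intro C_diff_bounded_linear[OF assms(1) bounded_linear_inner_left]) auto
      show "C_diff k (\<lambda>x. fder g (f x) b) V"
        using Suc.prems C_diff_Suc_D[OF Suc.prems(1)] by (intro Suc.IH) auto
    qed
    then show "C_diff k (\<lambda>x. fder g (f x) (fder f x v)) V"
      by (rule C_diff_cong[OF assms(1), rotated]) (simp add: expand)
  qed
qed

lemma C_diff_inverse:
  fixes f :: "'a::euclidean_space \<Rightarrow> real"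
  assumes "open V" "\<And>x. x \<in> V \<Longrightarrow> f x \<noteq> 0" "C_diff k f V"
  shows "C_diff k (\<lambda>x. inverse (f x)) V"
  using assms(3)
proof (induction k)
  case 0
  then show ?case using assms(2) by (auto intro: continuous_intros)
next
  case (Suc k)
  show ?case
  proof (rule C_diff_SucI[OF assms(1)])
    fix x assume "x \<in> V"
    then have "(f has_derivative fder f x) (at x)"
      using Suc.prems by (auto intro!: has_derivative_fder)
    from Deriv.has_derivative_inverse[OF assms(2)[OF \<open>x \<in> V\<close>] this]
    show "((\<lambda>x. inverse (f x)) has_derivative
        (\<lambda>v. (-1) * (inverse (f x) * fder f x v * inverse (f x)))) (at x)"
      by simp
  next
    fix v
    show "C_diff k (\<lambda>x. (-1) * (inverse (f x) * fder f x v * inverse (f x))) V"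
      using Suc.prems C_diff_Suc_D[OF Suc.prems(1)] Suc.IH
      by (intro C_diff_bilinear[OF assms(1) bounded_bilinear_mult]) auto
  qed
qed

lemma C_diff_sqrt:
  fixes f :: "'a::euclidean_space \<Rightarrow> real"
  assumes "open V" "\<And>x. x \<in> V \<Longrightarrow> f x > 0" "C_diff k f V"
  shows "C_diff k (\<lambda>x. sqrt (f x)) V"
  using assms(3)
proof (induction k)
  case 0
  then show ?case by (auto intro: continuous_intros)
next
  case (Suc k)
  show ?case
  proof (rule C_diff_SucI[OF assms(1)])
    fix x assume "x \<in> V"
    then have "(f has_derivative fder f x) (at x)"
      using Suc.prems by (auto intro!: has_derivative_fder)
    from has_derivative_real_sqrt[OF assms(2)[OF \<open>x \<in> V\<close>] this]
    show "((\<lambda>x. sqrt (f x)) has_derivative (\<lambda>v. (1/2) * inverse (sqrt (f x)) * fder f x v)) (at x)"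
      by (simp add: field_simps)
  next
    fix v
    have "C_diff k (\<lambda>x. inverse (sqrt (f x))) V"
      using Suc.prems C_diff_Suc_D[OF Suc.prems(1)] Suc.IH assms(2)
      by (intro C_diff_inverse[OF assms(1)]) fastforce+
    then show "C_diff k (\<lambda>x. (1/2) * inverse (sqrt (f x)) * fder f x v) V"
      using Suc.prems
      by (intro C_diff_bilinear[OF assms(1) bounded_bilinear_mult]) auto
  qed
qed

lemma C_diff_ident: "C_diff k (\<lambda>x. x) V"
  by (cases k) (auto intro: continuous_intros)

lemma C_diff_componentwise:
  fixes f :: "'a::euclidean_space \<Rightarrow> 'b::euclidean_space"
  assumes "open V" "\<And>b. b \<in> Basis \<Longrightarrow> C_diff k (\<lambda>x. f x \<bullet> b) V"
  shows "C_diff k f V"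
proof -
  have "C_diff k (\<lambda>x. \<Sum>b\<in>Basis. (f x \<bullet> b) *\<^sub>R b) V"
    using assms(2)
    by (intro C_diff_sum[OF assms(1)] C_diff_bilinear[OF assms(1) bounded_bilinear_scaleR]) auto
  then show ?thesis
    by (simp add: euclidean_representation)
qed

lemma C_diff_vec:
  fixes f :: "'a::euclidean_space \<Rightarrow> real^'n"
  assumes "open V" "\<And>i. C_diff k (\<lambda>x. f x $ i) V"
  shows "C_diff k f V"
  by (rule C_diff_componentwise[OF assms(1)]) (auto simp: Basis_vec_def inner_axis assms(2))

lemma C_diff_vec_nth: "open V \<Longrightarrow> C_diff k f V \<Longrightarrow> C_diff k (\<lambda>x. f x $ i) V"
  by (rule C_diff_bounded_linear[OF _ bounded_linear_vec_nth])

lemma C_diff_det: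
  fixes A :: "'a::euclidean_space \<Rightarrow> real^'n^'n"
  assumes "open V" "\<And>i j. C_diff k (\<lambda>x. A x $ i $ j) V"
  shows "C_diff k (\<lambda>x. det (A x)) V"
  unfolding det_def
  using assms
  by (intro C_diff_sum C_diff_bilinear[OF assms(1) bounded_bilinear_mult] C_diff_prod) auto

text \<open>By Cramer's rule \<open>z\<close> is a quotient of determinants, so a solution that is
  only given pointwise inherits the smoothness of the coefficients.\<close>

lemma C_diff_linear_system:
  fixes A :: "'a::euclidean_space \<Rightarrow> real^'n^'n"
  assumes V: "open V" and A: "\<And>i j. C_diff k (\<lambda>x. A x $ i $ j) V" and b: "C_diff k b V"
    and det: "\<And>x. x \<in> V \<Longrightarrow> det (A x) \<noteq> 0" and z: "\<And>x. x \<in> V \<Longrightarrow> A x *v z x = b x"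
  shows "C_diff k z V"
proof (rule C_diff_vec[OF V])
  fix l
  have "C_diff k (\<lambda>x. det (\<chi> i j. if j = l then b x $ i else A x $ i $ j) * inverse (det (A x))) V"
  proof (intro C_diff_bilinear[OF V bounded_bilinear_mult] C_diff_inverse[OF V] C_diff_det[OF V] A det)
    fix i j
    show "C_diff k (\<lambda>x. (\<chi> i j. if j = l then b x $ i else A x $ i $ j) $ i $ j) V"
      using A C_diff_vec_nth[OF V b] by (cases "j = l") auto
  qed auto
  then show "C_diff k (\<lambda>x. z x $ l) V"
  proof (rule C_diff_cong[OF V, rotated])
    fix x assume "x \<in> V"
    then have "z x = (\<chi> l. det (\<chi> i j. if j = l then b x $ i else A x $ i $ j) / det (A x))"
      using cramer[OF det] z by blast
    then show "det (\<chi> i j. if j = l then b x $ i else A x $ i $ j) * inverse (det (A x)) = z x $ l"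
      by (simp add: divide_inverse)
  qed
qed

lemma smooth_onD: "smooth_on V f \<Longrightarrow> C_diff k f V"
  by (simp add: smooth_on_def)

lemma smooth_on_differentiable: "smooth_on V f \<Longrightarrow> x \<in> V \<Longrightarrow> f differentiable (at x)"
  using smooth_onD[of V f 1] by simp

lemma smooth_on_has_derivative:
  "smooth_on V f \<Longrightarrow> x \<in> V \<Longrightarrow> (f has_derivative fder f x) (at x)"
  by (intro has_derivative_fder smooth_on_differentiable)

lemma smooth_on_linear_fder: "smooth_on V f \<Longrightarrow> x \<in> V \<Longrightarrow> linear (fder f x)"
  by (intro linear_frechet_derivative smooth_on_differentiable)

lemma smooth_on_continuous_on: "smooth_on V f \<Longrightarrow> continuous_on V f"
  using C_diff_imp_continuous_on smooth_onD by blast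

lemma smooth_on_fder: "smooth_on V f \<Longrightarrow> smooth_on V (\<lambda>x. fder f x v)"
  unfolding smooth_on_def using C_diff.simps(2) by blast

lemma smooth_on_subset: "smooth_on V f \<Longrightarrow> W \<subseteq> V \<Longrightarrow> smooth_on W f"
  unfolding smooth_on_def using C_diff_subset by blast

lemma smooth_on_cong:
  "open V \<Longrightarrow> (\<And>x. x \<in> V \<Longrightarrow> f x = g x) \<Longrightarrow> smooth_on V f \<Longrightarrow> smooth_on V g"
  unfolding smooth_on_def using C_diff_cong by blast

lemma smooth_on_const: "smooth_on V (\<lambda>x. c)"
  by (simp add: smooth_on_def)

lemma smooth_on_ident: "smooth_on V (\<lambda>x. x)"
  by (simp add: smooth_on_def C_diff_ident)

lemma smooth_on_bounded_linear:
  "open V \<Longrightarrow> bounded_linear L \<Longrightarrow> smooth_on V f \<Longrightarrow> smooth_on V (\<lambda>x. L (f x))"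
  unfolding smooth_on_def using C_diff_bounded_linear by blast

lemma smooth_on_linear:
  fixes L :: "'a::euclidean_space \<Rightarrow> 'b::real_normed_vector"
  shows "open V \<Longrightarrow> linear L \<Longrightarrow> smooth_on V L"
  using smooth_on_bounded_linear[OF _ _ smooth_on_ident] linear_conv_bounded_linear by blast

lemma smooth_on_add:
  "open V \<Longrightarrow> smooth_on V f \<Longrightarrow> smooth_on V g \<Longrightarrow> smooth_on V (\<lambda>x. f x + g x)"
  unfolding smooth_on_def using C_diff_add by blast

lemma smooth_on_minus: "open V \<Longrightarrow> smooth_on V f \<Longrightarrow> smooth_on V (\<lambda>x. - f x)"
  using smooth_on_bounded_linear[OF _ bounded_linear_minus[OF bounded_linear_ident]] by blast

lemma smooth_on_diff:
  "open V \<Longrightarrow> smooth_on V f \<Longrightarrow> smooth_on V g \<Longrightarrow> smooth_on V (\<lambda>x. f x - g x)"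
  using smooth_on_add[of V f "\<lambda>x. - g x"] smooth_on_minus by auto

lemma smooth_on_scaleR:
  "open V \<Longrightarrow> smooth_on V f \<Longrightarrow> smooth_on V g \<Longrightarrow> smooth_on V (\<lambda>x. f x *\<^sub>R g x)"
  unfolding smooth_on_def using C_diff_bilinear[OF _ bounded_bilinear_scaleR] by blast

lemma smooth_on_mult:
  fixes f g :: "'a::euclidean_space \<Rightarrow> real"
  shows "open V \<Longrightarrow> smooth_on V f \<Longrightarrow> smooth_on V g \<Longrightarrow> smooth_on V (\<lambda>x. f x * g x)"
  unfolding smooth_on_def using C_diff_bilinear[OF _ bounded_bilinear_mult] by blast

lemma smooth_on_inner:
  "open V \<Longrightarrow> smooth_on V f \<Longrightarrow> smooth_on V g \<Longrightarrow> smooth_on V (\<lambda>x. f x \<bullet> g x)"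
  unfolding smooth_on_def using C_diff_bilinear[OF _ bounded_bilinear_inner] by blast

lemma smooth_on_power:
  fixes f :: "'a::euclidean_space \<Rightarrow> real"
  assumes "open V" "smooth_on V f"
  shows "smooth_on V (\<lambda>x. f x ^ m)"
  by (induction m) (auto intro: smooth_on_const smooth_on_mult assms)

lemma smooth_on_divide:
  fixes f g :: "'a::euclidean_space \<Rightarrow> real"
  assumes "open V" "smooth_on V f" "smooth_on V g" "\<And>x. x \<in> V \<Longrightarrow> g x \<noteq> 0"
  shows "smooth_on V (\<lambda>x. f x / g x)"
  unfolding divide_inverse
  using assms C_diff_inverse[OF assms(1), of g]
  by (intro smooth_on_mult) (auto simp: smooth_on_def)

lemma smooth_on_sqrt:
  fixes f :: "'a::euclidean_space \<Rightarrow> real"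
  shows "open V \<Longrightarrow> smooth_on V f \<Longrightarrow> (\<And>x. x \<in> V \<Longrightarrow> f x > 0) \<Longrightarrow> smooth_on V (\<lambda>x. sqrt (f x))"
  unfolding smooth_on_def using C_diff_sqrt by blast

lemma smooth_on_sum:
  "open V \<Longrightarrow> (\<And>i. i \<in> S \<Longrightarrow> smooth_on V (f i)) \<Longrightarrow> smooth_on V (\<lambda>x. \<Sum>i\<in>S. f i x)"
  unfolding smooth_on_def using C_diff_sum[of V S] by blast

lemma smooth_on_comp:
  fixes f :: "'a::euclidean_space \<Rightarrow> 'b::euclidean_space"
  shows "open V \<Longrightarrow> open W \<Longrightarrow> f ` V \<subseteq> W \<Longrightarrow> smooth_on V f \<Longrightarrow> smooth_on W g \<Longrightarrow>
    smooth_on V (\<lambda>x. g (f x))"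
  unfolding smooth_on_def using C_diff_comp by blast

lemma smooth_on_vec:
  fixes f :: "'a::euclidean_space \<Rightarrow> real^'n"
  shows "open V \<Longrightarrow> (\<And>i. smooth_on V (\<lambda>x. f x $ i)) \<Longrightarrow> smooth_on V f"
  unfolding smooth_on_def using C_diff_vec by blast

lemma smooth_on_vec_nth: "open V \<Longrightarrow> smooth_on V f \<Longrightarrow> smooth_on V (\<lambda>x. f x $ i)"
  unfolding smooth_on_def using C_diff_vec_nth by blast

lemma smooth_on_linear_system:
  fixes A :: "'a::euclidean_space \<Rightarrow> real^'n^'n"
  assumes "open V" "\<And>i j. smooth_on V (\<lambda>x. A x $ i $ j)" "smooth_on V b"
    "\<And>x. x \<in> V \<Longrightarrow> det (A x) \<noteq> 0" "\<And>x. x \<in> V \<Longrightarrow> A x *v z x = b x"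
  shows "smooth_on V z"
  using assms C_diff_linear_system[of V _ A b z] unfolding smooth_on_def by blast

text \<open>A field of linear maps \<open>B\<close> is differentiated through its values on constant vectors.\<close>

lemma linear_field_expand:
  fixes v :: "'a::euclidean_space"
  assumes "linear L"
  shows "L v = (\<Sum>b\<in>Basis. (v \<bullet> b) *\<^sub>R L b)"
proof -
  interpret linear L by fact
  show ?thesis
    by (subst euclidean_representation[symmetric, of v]) (simp add: sum scale)
qed

lemma smooth_on_linear_field:
  fixes g :: "'c::euclidean_space \<Rightarrow> 'a::euclidean_space"
  assumes V: "open V" and lin: "\<And>x. x \<in> V \<Longrightarrow> linear (B x)"
    and B: "\<And>v. smooth_on V (\<lambda>x. B x v)" and g: "smooth_on V g"
  shows "smooth_on V (\<lambda>x. B x (g x))"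
proof (rule smooth_on_cong[OF V])
  show "smooth_on V (\<lambda>x. \<Sum>b\<in>Basis. (g x \<bullet> b) *\<^sub>R B x b)"
    using assms by (intro smooth_on_sum smooth_on_scaleR smooth_on_inner smooth_on_const) auto
qed (simp add: linear_field_expand[OF lin, symmetric])

lemma linear_fder_field:
  assumes V: "open V" "x \<in> V" and lin: "\<And>x. x \<in> V \<Longrightarrow> linear (B x)"
    and B: "\<And>v. smooth_on V (\<lambda>x. B x v)"
  shows "linear (\<lambda>v. fder (\<lambda>y. B y v) x w)"
proof (rule linearI)
  have dB: "((\<lambda>y. B y v) has_derivative fder (\<lambda>y. B y v) x) (at x)" for v
    using smooth_on_has_derivative[OF B V(2)] .
  fix v v' and c :: real
  have "fder (\<lambda>y. B y (v + v')) x = fder (\<lambda>y. B y v + B y v') x"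
    by (rule fder_cong[OF V]) (simp add: linear_add[OF lin])
  also have "\<dots> = (\<lambda>w. fder (\<lambda>y. B y v) x w + fder (\<lambda>y. B y v') x w)"
    by (intro fder_eq has_derivative_add dB)
  finally show "fder (\<lambda>y. B y (v + v')) x w = fder (\<lambda>y. B y v) x w + fder (\<lambda>y. B y v') x w"
    by simp
  have "fder (\<lambda>y. B y (c *\<^sub>R v)) x = fder (\<lambda>y. c *\<^sub>R B y v) x"
    by (rule fder_cong[OF V]) (simp add: linear_cmul[OF lin])
  also have "\<dots> = (\<lambda>w. c *\<^sub>R fder (\<lambda>y. B y v) x w)"
    by (intro fder_eq has_derivative_scaleR_right dB)
  finally show "fder (\<lambda>y. B y (c *\<^sub>R v)) x w = c *\<^sub>R fder (\<lambda>y. B y v) x w"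
    by simp
qed

text \<open>Product rule for an evaluation. The first summand differentiates \<open>B\<close> with
  its argument frozen, so that identities proved for constant fields, such as the structure
  equations, apply to moving ones.\<close>

lemma has_derivative_linear_field:
  fixes g :: "'c::euclidean_space \<Rightarrow> 'a::euclidean_space"
  assumes V: "open V" "x \<in> V" and lin: "\<And>x. x \<in> V \<Longrightarrow> linear (B x)"
    and B: "\<And>v. smooth_on V (\<lambda>x. B x v)" and g: "(g has_derivative g') (at x)"
  shows "((\<lambda>y. B y (g y)) has_derivative (\<lambda>w. fder (\<lambda>y. B y (g x)) x w + B x (g' w))) (at x)"
proof -
  have dB: "((\<lambda>y. B y v) has_derivative fder (\<lambda>y. B y v) x) (at x)" for v
    using smooth_on_has_derivative[OF B V(2)] .
  have "((\<lambda>y. \<Sum>b\<in>Basis. (g y \<bullet> b) *\<^sub>R B y b) has_derivative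
      (\<lambda>w. \<Sum>b\<in>Basis. (g x \<bullet> b) *\<^sub>R fder (\<lambda>y. B y b) x w + (g' w \<bullet> b) *\<^sub>R B x b)) (at x)"
    by (intro has_derivative_sum has_derivative_scaleR dB has_derivative_inner_left g)
  moreover have "(\<Sum>b\<in>Basis. (g x \<bullet> b) *\<^sub>R fder (\<lambda>y. B y b) x w + (g' w \<bullet> b) *\<^sub>R B x b)
      = fder (\<lambda>y. B y (g x)) x w + B x (g' w)" for w
    using linear_field_expand[OF lin[OF V(2)], of "g' w"]
      linear_field_expand[OF linear_fder_field[OF V lin B], of "g x" w]
    by (simp add: sum.distrib)
  ultimately have "((\<lambda>y. \<Sum>b\<in>Basis. (g y \<bullet> b) *\<^sub>R B y b) has_derivative
      (\<lambda>w. fder (\<lambda>y. B y (g x)) x w + B x (g' w))) (at x)"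
    by simp
  then show ?thesis
    by (rule has_derivative_transform_within_open[OF _ V])
       (simp add: linear_field_expand[OF lin, symmetric])
qed

section \<open>Symmetry of second derivatives\<close>

lemma second_difference_mean_value:
  fixes g :: "'a::euclidean_space \<Rightarrow> real"
  assumes g: "smooth_on V g" and e: "e > 0"
    and mem: "\<And>s t. 0 \<le> s \<Longrightarrow> s \<le> e \<Longrightarrow> 0 \<le> t \<Longrightarrow> t \<le> e \<Longrightarrow> x + s *\<^sub>R u + t *\<^sub>R v \<in> V"
  shows "\<exists>s t. 0 < s \<and> s < e \<and> 0 < t \<and> t < e \<and>
    g (x + e *\<^sub>R u + e *\<^sub>R v) - g (x + e *\<^sub>R u) - g (x + e *\<^sub>R v) + g x =
      e * e * fder (\<lambda>y. fder g y u) (x + s *\<^sub>R u + t *\<^sub>R v) v"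
proof -
  have lin: "fder h y (c *\<^sub>R w) = c * fder h y w"
    if "smooth_on V h" "y \<in> V" for h :: "'a \<Rightarrow> real" and y c w
    using linear_cmul[OF smooth_on_linear_fder[OF that]] by simp
  have dir: "((\<lambda>s. h (b + s *\<^sub>R w)) has_real_derivative fder h (b + s *\<^sub>R w) w) (at s)"
    if "smooth_on V h" "b + s *\<^sub>R w \<in> V" for h :: "'a \<Rightarrow> real" and b w s
  proof -
    have "((\<lambda>s. b + s *\<^sub>R w) has_derivative (\<lambda>c. c *\<^sub>R w)) (at s)"
      by (auto intro!: derivative_eq_intros)
    from diff_chain_at[OF this smooth_on_has_derivative[OF that]]
    show ?thesis
      by (simp add: o_def has_field_derivative_def lin[OF that] mult_commute_abs)
  qed
  \<comment> \<open>The mean value theorem in direction \<open>u\<close> is applied to the increment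
    in direction \<open>v\<close>; a second application, in direction \<open>v\<close>, then
    produces the mixed derivative.\<close>
  have "\<exists>s>0. s < e \<and>
      (g (x + e *\<^sub>R u + e *\<^sub>R v) - g (x + e *\<^sub>R u)) - (g (x + 0 *\<^sub>R u + e *\<^sub>R v) - g (x + 0 *\<^sub>R u)) =
      (e - 0) * (fder g (x + s *\<^sub>R u + e *\<^sub>R v) u - fder g (x + s *\<^sub>R u) u)"
  proof (rule MVT2[OF e])
    fix s assume s: "0 \<le> s" "s \<le> e"
    have "((\<lambda>s. g ((x + e *\<^sub>R v) + s *\<^sub>R u) - g (x + s *\<^sub>R u)) has_real_derivative
       fder g ((x + e *\<^sub>R v) + s *\<^sub>R u) u - fder g (x + s *\<^sub>R u) u) (at s)"
      using mem[OF s, of e] mem[OF s, of 0] e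
      by (intro DERIV_diff dir g) (auto simp: algebra_simps)
    then show "((\<lambda>s. g (x + s *\<^sub>R u + e *\<^sub>R v) - g (x + s *\<^sub>R u)) has_real_derivative
       fder g (x + s *\<^sub>R u + e *\<^sub>R v) u - fder g (x + s *\<^sub>R u) u) (at s)"
      by (simp add: algebra_simps)
  qed
  then obtain s where s: "0 < s" "s < e" and 1:
      "g (x + e *\<^sub>R u + e *\<^sub>R v) - g (x + e *\<^sub>R u) - g (x + e *\<^sub>R v) + g x =
       e * (fder g (x + s *\<^sub>R u + e *\<^sub>R v) u - fder g (x + s *\<^sub>R u) u)"
    by auto
  have "\<exists>t>0. t < e \<and> fder g (x + s *\<^sub>R u + e *\<^sub>R v) u - fder g (x + s *\<^sub>R u + 0 *\<^sub>R v) u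
      = (e - 0) * fder (\<lambda>y. fder g y u) (x + s *\<^sub>R u + t *\<^sub>R v) v"
    using mem s e by (intro MVT2[OF e] dir[of "\<lambda>y. fder g y u"] smooth_on_fder g) auto
  with 1 s show ?thesis
    by (auto simp: mult.assoc)
qed

text \<open>The second difference is symmetric in \<open>u\<close> and \<open>v\<close>, so each
  mixed derivative takes its value divided by \<open>e * e\<close> at some point close to
  \<open>x\<close>. If they differed at \<open>x\<close>, continuity would keep these values
  apart.\<close>

lemma fder_fder_commute_real:
  fixes g :: "'a::euclidean_space \<Rightarrow> real"
  assumes V: "open V" "x \<in> V" and g: "smooth_on V g"
  shows "fder (\<lambda>y. fder g y u) x v = fder (\<lambda>y. fder g y v) x u"
proof (rule ccontr)
  define A where "A = (\<lambda>y. fder (\<lambda>y. fder g y u) y v)"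
  define B where "B = (\<lambda>y. fder (\<lambda>y. fder g y v) y u)"
  assume "\<not> ?thesis"
  then have d: "\<bar>A x - B x\<bar> / 2 > 0" by (simp add: A_def B_def)
  have "continuous_on V A" "continuous_on V B"
    unfolding A_def B_def by (intro smooth_on_continuous_on smooth_on_fder g)+
  then have "isCont A x" "isCont B x"
    using V continuous_on_eq_continuous_at by blast+
  then obtain d1 d2 where d1: "d1 > 0" "\<And>y. dist y x < d1 \<Longrightarrow> dist (A y) (A x) < \<bar>A x - B x\<bar> / 2"
    and d2: "d2 > 0" "\<And>y. dist y x < d2 \<Longrightarrow> dist (B y) (B x) < \<bar>A x - B x\<bar> / 2"
    using d unfolding continuous_at_eps_delta by metis
  obtain d3 where d3: "d3 > 0" "ball x d3 \<subseteq> V"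
    using V openE by blast
  define \<delta> where "\<delta> = min d1 (min d2 d3)"
  \<comment> \<open>Small enough that the whole parallelogram at \<open>x\<close> with sides
    \<open>e\<close> times \<open>u\<close> and \<open>v\<close> stays within distance
    \<open>\<delta>\<close>; the added 1 covers \<open>u = v = 0\<close>.\<close>
  define e where "e = \<delta> / (2 * (norm u + norm v + 1))"
  have pos: "\<delta> > 0" "norm u + norm v + 1 > 0"
    using d1 d2 d3 by (auto simp: \<delta>_def add_nonneg_pos)
  then have e: "e > 0" by (simp add: e_def)
  have near: "dist (x + s *\<^sub>R u + t *\<^sub>R v) x < \<delta>" if "0 \<le> s" "s \<le> e" "0 \<le> t" "t \<le> e" for s t
  proof -
    have "dist (x + s *\<^sub>R u + t *\<^sub>R v) x \<le> s * norm u + t * norm v"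
      using that norm_triangle_ineq[of "s *\<^sub>R u" "t *\<^sub>R v"] by (simp add: dist_norm algebra_simps)
    also have "\<dots> \<le> e * norm u + e * norm v"
      using that by (intro add_mono mult_right_mono) auto
    also have "\<dots> < e * (2 * (norm u + norm v + 1))"
      using e by (simp add: algebra_simps add_pos_nonneg add_nonneg_pos)
    also have "\<dots> = \<delta>" using pos by (simp add: e_def)
    finally show ?thesis .
  qed
  have mem: "x + s *\<^sub>R u + t *\<^sub>R v \<in> V" if "0 \<le> s" "s \<le> e" "0 \<le> t" "t \<le> e" for s t
    using near[OF that] d3 by (auto simp: \<delta>_def dist_commute)
  obtain s t where st: "0 < s" "s < e" "0 < t" "t < e" and 1:
    "g (x + e *\<^sub>R u + e *\<^sub>R v) - g (x + e *\<^sub>R u) - g (x + e *\<^sub>R v) + g x =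
      e * e * A (x + s *\<^sub>R u + t *\<^sub>R v)"
    unfolding A_def using second_difference_mean_value[OF g e mem] by blast
  have mem': "x + s *\<^sub>R v + t *\<^sub>R u \<in> V" if "0 \<le> s" "s \<le> e" "0 \<le> t" "t \<le> e" for s t
    using mem[OF that(3,4,1,2)] by (simp add: algebra_simps)
  obtain s' t' where st': "0 < s'" "s' < e" "0 < t'" "t' < e" and 2:
    "g (x + e *\<^sub>R v + e *\<^sub>R u) - g (x + e *\<^sub>R v) - g (x + e *\<^sub>R u) + g x =
      e * e * B (x + s' *\<^sub>R v + t' *\<^sub>R u)"
    unfolding B_def using second_difference_mean_value[OF g e mem'] by blast
  have "A (x + s *\<^sub>R u + t *\<^sub>R v) = B (x + t' *\<^sub>R u + s' *\<^sub>R v)"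
    using 1 2 e by (simp add: algebra_simps)
  moreover have "dist (A (x + s *\<^sub>R u + t *\<^sub>R v)) (A x) < \<bar>A x - B x\<bar> / 2"
    using d1(2) near[of s t] st by (simp add: \<delta>_def)
  moreover have "dist (B (x + t' *\<^sub>R u + s' *\<^sub>R v)) (B x) < \<bar>A x - B x\<bar> / 2"
    using d2(2) near[of t' s'] st' by (simp add: \<delta>_def)
  ultimately show False
    by (simp add: dist_real_def field_simps abs_if split: if_splits)
qed

lemma fder_fder_commute:
  fixes g :: "'a::euclidean_space \<Rightarrow> 'b::euclidean_space"
  assumes V: "open V" "x \<in> V" and g: "smooth_on V g"
  shows "fder (\<lambda>y. fder g y u) x v = fder (\<lambda>y. fder g y v) x u"
proof (rule euclidean_eqI)
  fix b :: 'b
  have gb: "smooth_on V (\<lambda>y. g y \<bullet> b)"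
    using smooth_on_bounded_linear[OF V(1) bounded_linear_inner_left g] .
  have 1: "fder h y u \<bullet> b = fder (\<lambda>y. h y \<bullet> b) y u" if "smooth_on V h" "y \<in> V" for h :: "'a \<Rightarrow> 'b" and y u
    by (subst fder_eq[OF has_derivative_inner_left[OF smooth_on_has_derivative[OF that]]]) simp
  have 2: "fder (\<lambda>y. fder g y u) x v \<bullet> b = fder (\<lambda>y. fder (\<lambda>y. g y \<bullet> b) y u) x v" for u v
    unfolding 1[OF smooth_on_fder[OF g] V(2)]
    by (subst fder_cong[OF V, of _ "\<lambda>y. fder (\<lambda>y. g y \<bullet> b) y u"]) (auto simp: 1[OF g])
  show "fder (\<lambda>y. fder g y u) x v \<bullet> b = fder (\<lambda>y. fder g y v) x u \<bullet> b"
    unfolding 2 by (rule fder_fder_commute_real[OF V gb])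
qed

text \<open>The Leibniz expansion is differentiated term by term; collecting the terms in which row
  \<open>i\<close> was differentiated gives the determinant with this row replaced.\<close>

lemma has_derivative_det:
  fixes A :: "'a::real_normed_vector \<Rightarrow> real^'n^'n"
  assumes "\<And>i j. ((\<lambda>y. A y $ i $ j) has_derivative A' i j) (at x)"
  shows "((\<lambda>y. det (A y)) has_derivative
    (\<lambda>w. \<Sum>i\<in>UNIV. det (\<chi> l. if l = i then (\<chi> j. A' i j w) else A x $ l))) (at x)"
proof -
  have prod: "(\<Prod>l\<in>UNIV. (if l = i then a else b l)) = a * (\<Prod>l\<in>UNIV-{i}. b l)"
    for i :: 'n and a :: real and b
  proof -
    have "(\<Prod>l\<in>UNIV. (if l = i then a else b l)) = a * (\<Prod>l\<in>UNIV-{i}. (if l = i then a else b l))"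
      by (subst prod.remove[of UNIV i]) auto
    also have "(\<Prod>l\<in>UNIV-{i}. (if l = i then a else b l)) = (\<Prod>l\<in>UNIV-{i}. b l)"
      by (rule prod.cong) auto
    finally show ?thesis .
  qed
  have *: "((\<lambda>y. \<Sum>p\<in>{p. p permutes (UNIV::'n set)}. of_int (sign p) * (\<Prod>i\<in>UNIV. A y $ i $ p i)) has_derivative
     (\<lambda>w. \<Sum>p\<in>{p. p permutes (UNIV::'n set)}.
        of_int (sign p) * (\<Sum>i\<in>UNIV. A' i (p i) w * (\<Prod>j\<in>UNIV-{i}. A x $ j $ p j)))) (at x)"
    by (intro has_derivative_sum has_derivative_mult_right has_derivative_prod assms)
  have "(\<Sum>i\<in>UNIV. det (\<chi> l. if l = i then (\<chi> j. A' i j w) else A x $ l)) =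
     (\<Sum>p\<in>{p. p permutes (UNIV::'n set)}.
        of_int (sign p) * (\<Sum>i\<in>UNIV. A' i (p i) w * (\<Prod>j\<in>UNIV-{i}. A x $ j $ p j)))" for w
    unfolding det_def sum_distrib_left
    apply (subst sum.swap)
    apply (intro sum.cong refl arg_cong2[where f="(*)"])
    apply (subst prod[symmetric])
    apply (rule prod.cong)
     apply (auto)
    done
  with * show ?thesis
    unfolding det_def by (simp add: det_def)
qed

text \<open>The inverse function theorem gives only a differentiable \<open>g\<close>. Its
  derivative solves a linear system with matrix \<open>fder T (g y)\<close>, so if \<open>g\<close>
  is of class \<open>C_diff k\<close>, Cramer's rule gives the same class for the derivative, and
  \<open>g\<close> is of class \<open>C_diff (Suc k)\<close>.\<close>

lemma smooth_local_inverse: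
  fixes T :: "real^'n \<Rightarrow> real^'n"
  assumes V: "open V" "x0 \<in> V" and T: "smooth_on V T" and inj: "inj (fder T x0)"
  obtains U W g where "open U" "x0 \<in> U" "U \<subseteq> V" "open W" "homeomorphism U W T g" "smooth_on W g"
proof -
  define f' where "f' x = Blinfun (fder T x)" for x
  have bl: "bounded_linear (fder T x)" if "x \<in> V" for x
    using smooth_on_linear_fder[OF T that] linear_conv_bounded_linear by blast
  have f': "blinfun_apply (f' x) = fder T x" if "x \<in> V" for x
    unfolding f'_def by (rule bounded_linear_Blinfun_apply[OF bl[OF that]])
  have cont: "continuous_on V f'"
  proof (rule continuous_on_blinfun_componentwise)
    fix i :: "real^'n"
    have "continuous_on V (\<lambda>x. fder T x i)"
      by (intro smooth_on_continuous_on smooth_on_fder T)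
    then show "continuous_on V (\<lambda>x. blinfun_apply (f' x) i)"
      by (rule continuous_on_eq) (simp add: f')
  qed
  obtain L where L: "linear L" "L \<circ> fder T x0 = id"
    using linear_injective_left_inverse[OF smooth_on_linear_fder[OF T V(2)] inj] by blast
  have invf: "Blinfun L o\<^sub>L f' x0 = id_blinfun"
    by (rule blinfun_eqI)
       (use L pointfree_idE[OF L(2)] in \<open>simp add: f'[OF V(2)] bounded_linear_Blinfun_apply linear_conv_bounded_linear\<close>)
  obtain U W g g' where U: "open U" "U \<subseteq> V" "x0 \<in> U" "open W" and hom: "homeomorphism U W T g"
    and g: "\<And>y. y \<in> W \<Longrightarrow> (g has_derivative g' y) (at y)"
    and g': "\<And>y. y \<in> W \<Longrightarrow> g' y = inv (blinfun_apply (f' (g y)))"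
    and bij: "\<And>y. y \<in> W \<Longrightarrow> bij (blinfun_apply (f' (g y)))"
    using inverse_function_theorem[OF V(1) _ cont V(2) invf, of T] smooth_on_has_derivative[OF T] f'
    by metis
  have gW: "g y \<in> V" if "y \<in> W" for y
    using hom U(2) that unfolding homeomorphism_def by blast
  have "C_diff k g W" for k
  proof (induction k)
    case 0
    then show ?case using hom by (simp add: homeomorphism_def)
  next
    case (Suc k)
    show ?case
    proof (rule C_diff_SucI[OF U(4) g])
      fix v
      show "C_diff k (\<lambda>y. g' y v) W"
      proof (rule C_diff_linear_system[OF U(4), where A = "\<lambda>y. matrix (fder T (g y))" and b = "\<lambda>y. v"])
        fix i j
        have "C_diff k (\<lambda>y. fder T (g y) (axis j 1)) W"
          using gW by (intro C_diff_comp[OF U(4) V(1) _ Suc] smooth_onD smooth_on_fder T) auto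
        then show "C_diff k (\<lambda>y. matrix (fder T (g y)) $ i $ j) W"
          unfolding matrix_def by (simp add: C_diff_vec_nth[OF U(4)])
      next
        fix y assume y: "y \<in> W"
        have lin: "linear (fder T (g y))" using smooth_on_linear_fder[OF T gW[OF y]] .
        have b: "bij (fder T (g y))" using bij[OF y] f'[OF gW[OF y]] by simp
        then show "det (matrix (fder T (g y))) \<noteq> 0"
          using det_nz_iff_inj[OF lin] bij_is_inj by blast
        show "matrix (fder T (g y)) *v g' y v = v"
          using b g'[OF y] f'[OF gW[OF y]] matrix_works[OF lin[folded linear_matrix_vector_mul_eq]] by (simp add: bij_is_surj surj_f_inv_f)
      qed auto
    qed
  qed
  then show ?thesis
    using U hom by (intro that) (auto simp: smooth_on_def)
qed

section \<open>Affine spheres with a rotationally symmetric cubic form\<close>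

text \<open>If \<open>X\<close> is a unit vector, the value is (n-1) r on (X, X, X) and - r on (X,
  Y, Y) for a unit vector Y orthogonal to \<open>X\<close>; up to order, all other combinations from
  an orthonormal frame through \<open>X\<close> give zero. The constant \<open>n + 2\<close> makes
  the form trace-free in dimension \<open>n\<close>.\<close>

definition axis_cubic ::
  "real \<Rightarrow> real \<Rightarrow> ('a \<Rightarrow> 'a \<Rightarrow> real) \<Rightarrow> 'a \<Rightarrow> 'a \<Rightarrow> 'a \<Rightarrow> 'a \<Rightarrow> real" where
  "axis_cubic n r b X u v w =
     (n + 2) * r * b X u * b X v * b X w - r * (b X u * b v w + b X v * b u w + b X w * b u v)"

text \<open>\<open>f\<close> is the position vector with respect to the centre, \<open>h\<close> the affine metric, \<open>G\<close> the
  Christoffel form of the Blaschke connection and \<open>l\<close> the mean curvature, so that the affine normal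
  is \<open>- l f\<close>; \<open>X\<close> is the axis, and \<open>U\<close>, \<open>a\<close> are the components of a constant ambient vector.\<close>

locale axial_affine_sphere =
  fixes V :: "(real^'n) set" and f :: "real^'n \<Rightarrow> 'b::euclidean_space"
    and G :: "real^'n \<Rightarrow> real^'n \<Rightarrow> real^'n \<Rightarrow> real^'n"
    and h :: "real^'n \<Rightarrow> real^'n \<Rightarrow> real^'n \<Rightarrow> real"
    and U :: "real^'n \<Rightarrow> 'b \<Rightarrow> real^'n" and a :: "real^'n \<Rightarrow> 'b \<Rightarrow> real"
    and X :: "real^'n \<Rightarrow> real^'n" and r :: "real^'n \<Rightarrow> real" and l n :: real
  assumes V: "open V" "convex V"
    and n: "n = CARD('n)" "n \<ge> 3"
    and smooth: "smooth_on V f" "\<And>u v. smooth_on V (\<lambda>x. h x u v)" "\<And>u v. smooth_on V (\<lambda>x. G x u v)"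
      "smooth_on V X" "smooth_on V r" "\<And>y. smooth_on V (\<lambda>x. U x y)" "\<And>y. smooth_on V (\<lambda>x. a x y)"
    and h: "\<And>x u. x \<in> V \<Longrightarrow> linear (h x u)" "\<And>x u v. x \<in> V \<Longrightarrow> h x u v = h x v u"
      "\<And>x v. x \<in> V \<Longrightarrow> v \<noteq> 0 \<Longrightarrow> h x v v > 0"
    and G: "\<And>x u. x \<in> V \<Longrightarrow> linear (G x u)" "\<And>x u v. x \<in> V \<Longrightarrow> G x u v = G x v u"
    and gauss: "\<And>x u v. x \<in> V \<Longrightarrow>
      fder (\<lambda>y. fder f y v) x u = fder f x (G x u v) - (l * h x u v) *\<^sub>R f x"
    and indep: "\<And>x v a. x \<in> V \<Longrightarrow> fder f x v + a *\<^sub>R f x = 0 \<Longrightarrow> v = 0 \<and> a = 0"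
    and split: "\<And>x y. x \<in> V \<Longrightarrow> y = fder f x (U x y) + a x y *\<^sub>R f x"
    and dh: "\<And>x u v w. x \<in> V \<Longrightarrow> fder (\<lambda>y. h y u v) x w =
      h x (G x w u) v + h x u (G x w v) - 2 * axis_cubic n (r x) (h x) (X x) w u v"
    and unit: "\<And>x. x \<in> V \<Longrightarrow> h x (X x) (X x) = 1"
    and r_nz: "\<And>x. x \<in> V \<Longrightarrow> r x \<noteq> 0" and l_nz: "l \<noteq> 0"
begin

text \<open>\<open>A w\<close> is \<open>\<nabla>\<^sub>w X\<close> and \<open>b\<close> is \<open>\<nabla> th\<close>.\<close>

definition th where "th x u = h x (X x) u"
definition C where "C x u v w = axis_cubic n (r x) (h x) (X x) u v w"
definition A where "A x w = fder X x w + G x w (X x)"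
definition b where "b x w u = h x (A x w) u - 2 * C x w (X x) u"
definition dr where "dr x w = fder r x w"

lemma C_eq: "C x u v w = (n + 2) * r x * th x u * th x v * th x w
    - r x * (th x u * h x v w + th x v * h x u w + th x w * h x u v)"
  by (simp add: C_def axis_cubic_def th_def)

context
  fixes x assumes x: "x \<in> V"
begin

lemma h_add: "h x u (v + w) = h x u v + h x u w" "h x (v + w) u = h x v u + h x w u"
  and h_scale: "h x u (c *\<^sub>R v) = c * h x u v" "h x (c *\<^sub>R v) u = c * h x v u"
  and h_diff: "h x u (v - w) = h x u v - h x u w" "h x (v - w) u = h x v u - h x w u"
  and h_minus: "h x u (- v) = - h x u v" "h x (- v) u = - h x v u"
  and h_zero: "h x u 0 = 0" "h x 0 u = 0"
  using linear_add[OF h(1)[OF x]] linear_cmul[OF h(1)[OF x]] linear_diff[OF h(1)[OF x]]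
    linear_neg[OF h(1)[OF x]] linear_0[OF h(1)[OF x]]
  by (simp_all add: h(2)[OF x, of _ u])

lemmas h_lin = h_add h_scale h_diff h_minus h_zero

lemma th_lin: "th x (v + w) = th x v + th x w" "th x (c *\<^sub>R v) = c * th x v"
    "th x (v - w) = th x v - th x w" "th x (- v) = - th x v" "th x 0 = 0"
  by (simp_all add: th_def h_lin)

lemma th_X: "th x (X x) = 1"
  using unit[OF x] by (simp add: th_def)

lemma h_X: "h x (X x) u = th x u" "h x u (X x) = th x u"
  using h(2)[OF x] by (simp_all add: th_def)

lemma linear_th: "linear (th x)"
  using h(1)[OF x] by (simp add: th_def[abs_def])

lemma h_nondeg: "(\<And>w. h x u w = h x v w) \<Longrightarrow> u = v"
  using h(3)[OF x, of "u - v"] by (force simp: h_lin)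

lemma linear_h1: "linear (\<lambda>a. h x a u)"
  by (rule linearI) (simp_all add: h_lin)

lemma linear_Df: "linear (fder f x)"
  by (rule smooth_on_linear_fder[OF smooth(1) x])

lemma Df_lin: "fder f x (v + w) = fder f x v + fder f x w" "fder f x (c *\<^sub>R v) = c *\<^sub>R fder f x v"
    "fder f x (v - w) = fder f x v - fder f x w" "fder f x (- v) = - fder f x v" "fder f x 0 = 0"
  using linear_add[OF linear_Df] linear_cmul[OF linear_Df] linear_diff[OF linear_Df]
    linear_neg[OF linear_Df] linear_0[OF linear_Df] by auto

lemma Df_inj: "fder f x u = fder f x v \<Longrightarrow> u = v"
  using indep[OF x, of "u - v" 0] linear_diff[OF linear_Df] by simp

lemma frame_unique: "fder f x u + c *\<^sub>R f x = fder f x v + d *\<^sub>R f x \<Longrightarrow> u = v \<and> c = d"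
  using indep[OF x, of "u - v" "c - d"] linear_diff[OF linear_Df] by (simp add: algebra_simps)

lemma G_lin: "G x u (v + w) = G x u v + G x u w" "G x (v + w) u = G x v u + G x w u"
    "G x u (c *\<^sub>R v) = c *\<^sub>R G x u v" "G x (c *\<^sub>R v) u = c *\<^sub>R G x v u"
  using linear_add[OF G(1)[OF x]] linear_cmul[OF G(1)[OF x]]
  by (simp_all add: G(2)[OF x, of _ u])

end

lemma smooth_th: "smooth_on V (\<lambda>x. th x u)"
  unfolding th_def
  by (rule smooth_on_linear_field[OF V(1) linear_h1 smooth(2) smooth(4)])

lemma dh': "x \<in> V \<Longrightarrow> ((\<lambda>y. h y u v) has_derivative
    (\<lambda>w. h x (G x w u) v + h x u (G x w v) - 2 * C x w u v)) (at x)"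
  by (rule has_derivative_eq_rhs[OF smooth_on_has_derivative[OF smooth(2)]])
     (simp_all add: dh C_def fun_eq_iff)

lemma dth: 
  assumes x: "x \<in> V"
  shows "((\<lambda>y. th y u) has_derivative (\<lambda>w. b x w u + th x (G x w u))) (at x)"
proof -
  have "((\<lambda>y. h y (X y) u) has_derivative
      (\<lambda>w. fder (\<lambda>y. h y (X x) u) x w + h x (fder X x w) u)) (at x)"
    by (rule has_derivative_linear_field[OF V(1) x linear_h1 smooth(2)])
       (use smooth_on_has_derivative[OF smooth(4) x] in auto)
  moreover have "fder (\<lambda>y. h y (X x) u) x w + h x (fder X x w) u = b x w u + th x (G x w u)" for w
    by (simp add: dh[OF x] b_def A_def h_lin[OF x] th_def C_def)
  ultimately show ?thesis by (simp add: th_def)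
qed

lemma dr: "x \<in> V \<Longrightarrow> (r has_derivative dr x) (at x)"
  using smooth_on_has_derivative[OF smooth(5)] by (simp add: dr_def[abs_def])

text \<open>\<open>T x u\<close> is the covariant derivative of \<open>C\<close> with respect to the Blaschke connection.\<close>

definition T where
  "T x u w v z = (n + 2) * dr x u * th x w * th x v * th x z
     + (n + 2) * r x * (b x u w * th x v * th x z + b x u v * th x w * th x z + b x u z * th x w * th x v)
     - dr x u * (th x w * h x v z + th x v * h x w z + th x z * h x w v)
     - r x * (b x u w * h x v z + b x u v * h x w z + b x u z * h x w v)
     + 2 * r x * (th x w * C x u v z + th x v * C x u w z + th x z * C x u w v)"

lemma dC:
  assumes x: "x \<in> V"
  shows "((\<lambda>y. C y w v z) has_derivative
    (\<lambda>u. T x u w v z + C x (G x u w) v z + C x w (G x u v) z + C x w v (G x u z))) (at x)"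
  unfolding C_eq
  apply (rule derivative_eq_intros dr[OF x] dth[OF x] dh'[OF x] refl)+
  apply (rule ext)
  apply (simp add: T_def C_eq h_lin[OF x] th_lin[OF x] algebra_simps)
  done

text \<open>The tangential part of the equality of the second derivatives of
  \<open>fder f y v\<close>. The terms with \<open>l\<close> arise because the transversal field is
  a multiple of \<open>f\<close> itself, whose derivative is tangential.\<close>

lemma gauss_equation:
  assumes x: "x \<in> V"
  shows "fder (\<lambda>y. G y w v) x u + G x u (G x w v) - (l * h x w v) *\<^sub>R u =
         fder (\<lambda>y. G y u v) x w + G x w (G x u v) - (l * h x u v) *\<^sub>R w"
proof -
  have *: "fder (\<lambda>y. fder (\<lambda>y. fder f y v) y w) x u =
    fder f x (fder (\<lambda>y. G y w v) x u + G x u (G x w v) - (l * h x w v) *\<^sub>R u)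
    + (- l * (h x u (G x w v) + fder (\<lambda>y. h y w v) x u)) *\<^sub>R f x" for u w
  proof -
    have "((\<lambda>y. fder f y (G y w v)) has_derivative
      (\<lambda>u. fder (\<lambda>y. fder f y (G x w v)) x u + fder f x (fder (\<lambda>y. G y w v) x u))) (at x)"
      by (rule has_derivative_linear_field[OF V(1) x linear_Df])
         (auto intro: smooth_on_fder smooth smooth_on_has_derivative x)
    moreover have "((\<lambda>y. (l * h y w v) *\<^sub>R f y) has_derivative
       (\<lambda>u. (l * h x w v) *\<^sub>R fder f x u + (l * fder (\<lambda>y. h y w v) x u) *\<^sub>R f x)) (at x)"
      by (intro has_derivative_scaleR has_derivative_mult_right smooth_on_has_derivative[OF _ x] smooth)
    ultimately have "((\<lambda>y. fder f y (G y w v) - (l * h y w v) *\<^sub>R f y) has_derivative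
       (\<lambda>u. fder (\<lambda>y. fder f y (G x w v)) x u + fder f x (fder (\<lambda>y. G y w v) x u) -
         ((l * h x w v) *\<^sub>R fder f x u + (l * fder (\<lambda>y. h y w v) x u) *\<^sub>R f x))) (at x)"
      by (rule has_derivative_diff)
    note fder_eq[OF this]
    moreover have "fder (\<lambda>y. fder (\<lambda>y. fder f y v) y w) x =
        fder (\<lambda>y. fder f y (G y w v) - (l * h y w v) *\<^sub>R f y) x"
      by (rule fder_cong[OF V(1) x]) (rule gauss)
    ultimately show ?thesis
      by (simp add: gauss[OF x] Df_lin[OF x] algebra_simps)
  qed
  show ?thesis
    using fder_fder_commute[OF V(1) x smooth_on_fder[OF smooth(1)], of v w u]
    unfolding * using frame_unique[OF x] by blast
qed

text \<open>This is the Ricci identity for \<open>h\<close>: \<open>\<nabla>h = - 2 C\<close>, and by the Gauss equation the curvature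
  operators of \<open>\<nabla>\<close> are skew with respect to \<open>h\<close>, because the shape operator is \<open>l Id\<close>.\<close>

lemma codazzi:
  assumes x: "x \<in> V"
  shows "T x u w v z = T x w u v z"
proof -
  have *: "fder (\<lambda>y. fder (\<lambda>y. h y v z) y w) x u =
      h x (fder (\<lambda>y. G y w v) x u + G x u (G x w v)) z + h x (fder (\<lambda>y. G y w z) x u + G x u (G x w z)) v
      + h x (G x w v) (G x u z) + h x (G x u v) (G x w z)
      - 2 * C x u (G x w v) z - 2 * C x u v (G x w z)
      - 2 * (T x u w v z + C x (G x u w) v z + C x w (G x u v) z + C x w v (G x u z))" for u w
  proof -
    have 1: "((\<lambda>y. h y (G y w v) z) has_derivative
      (\<lambda>u. fder (\<lambda>y. h y (G x w v) z) x u + h x (fder (\<lambda>y. G y w v) x u) z)) (at x)"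
      by (rule has_derivative_linear_field[OF V(1) x linear_h1])
         (auto intro: smooth smooth_on_has_derivative x)
    have 2: "((\<lambda>y. h y v (G y w z)) has_derivative
      (\<lambda>u. fder (\<lambda>y. h y v (G x w z)) x u + h x v (fder (\<lambda>y. G y w z) x u))) (at x)"
      by (rule has_derivative_linear_field[OF V(1) x h(1)])
         (auto intro: smooth smooth_on_has_derivative x)
    note fder_eq[OF has_derivative_diff[OF has_derivative_add[OF 1 2] has_derivative_mult_right[OF dC[OF x], of 2 w v z]]]
    moreover have "fder (\<lambda>y. fder (\<lambda>y. h y v z) y w) x =
        fder (\<lambda>y. h y (G y w v) z + h y v (G y w z) - 2 * C y w v z) x"
      by (rule fder_cong[OF V(1) x]) (simp add: dh C_def)
    ultimately show ?thesis
      using dh[OF x] by (simp add: C_def[symmetric] h_lin[OF x] h(2)[OF x, of v])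
  qed
  \<comment> \<open>The curvature of the Blaschke connection paired with \<open>z\<close>. The terms
    with \<open>l\<close> change sign when \<open>v\<close> and \<open>z\<close> are exchanged, so
    they cancel in the sum of both pairings.\<close>
  have F: "h x (fder (\<lambda>y. G y w v) x u + G x u (G x w v)) z =
      h x (fder (\<lambda>y. G y u v) x w + G x w (G x u v)) z + l * h x w v * h x u z - l * h x u v * h x w z" for v z
    using arg_cong[OF gauss_equation[OF x, of w v u], of "\<lambda>a. h x a z"]
    by (simp add: h_lin[OF x] algebra_simps)
  have "h x (fder (\<lambda>y. G y w z) x u + G x u (G x w z)) v =
      h x (fder (\<lambda>y. G y u z) x w + G x w (G x u z)) v + l * h x u v * h x w z - l * h x w v * h x u z"
    unfolding F[of z v] by simp
  with F[of v z] fder_fder_commute[OF V(1) x smooth(2), of v z w u]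
  show ?thesis
    unfolding * G(2)[OF x, of w u] by (simp add: right_diff_distrib distrib_left)
qed

end

section \<open>Consequences of the Codazzi equation for \<open>r\<close> and the axis\<close>

lemma linear_not_inj_pair:
  fixes L :: "'a::euclidean_space \<Rightarrow> 'b::euclidean_space"
  assumes "linear L" "DIM('b) < DIM('a)"
  obtains z where "z \<noteq> 0" "L z = 0"
proof -
  have "\<not> inj L"
  proof
    assume "inj L"
    then have "dim (range L) = DIM('a)"
      using dim_image_eq[OF assms(1), of UNIV] by (simp add: inj_on_subset)
    then show False
      using dim_subset_UNIV[of "range L"] assms(2) by simp
  qed
  then show ?thesis
    using that linear_injective_0[OF assms(1)] by blast
qed

context axial_affine_sphere
begin

lemma n_pos: "n + 1 \<noteq> 0" "n - 1 \<noteq> 0" "n > 0"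
  using n(2) by auto

text \<open>The dimension count rests on \<open>n \<ge> 3\<close>. A direction orthogonal to the
  axis and to one further vector is what separates the unknowns in the integrability
  conditions.\<close>

lemma ex_orthogonal:
  assumes x: "x \<in> V"
  obtains z where "z \<noteq> 0" "h x u z = 0" "h x v z = 0"
proof -
  have "linear (\<lambda>z. (h x u z, h x v z))"
    by (rule linearI) (simp_all add: h_lin[OF x])
  moreover have "DIM(real \<times> real) < DIM(real^'n)"
    using n by simp
  ultimately obtain z where "z \<noteq> 0" "(h x u z, h x v z) = 0"
    by (rule linear_not_inj_pair)
  then show ?thesis
    using that by (simp add: prod_eq_iff)
qed

text \<open>\<open>al\<close> is the principal curvature of the leaves of \<open>ker th\<close> for the Levi-Civita connection:
  the covariant derivative of \<open>X\<close> along \<open>w\<close> is \<open>al (w - th(w) X)\<close>.\<close>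

definition al where "al x = - dr x (X x) / ((n + 1) * r x)"
text \<open>The counterpart of \<open>al\<close> for the Blaschke connection: on the leaf directions
  the difference tensor with \<open>X\<close> multiplies by \<open>- r\<close>, so there the
  derivative of \<open>X\<close> is \<open>be\<close> times the identity.\<close>

definition be where "be x = al x - r x"

context
  fixes x assumes x: "x \<in> V"
begin

lemma linear_DX: "linear (fder X x)"
  by (rule smooth_on_linear_fder[OF smooth(4) x])

lemma linear_dr: "linear (dr x)"
  using smooth_on_linear_fder[OF smooth(5) x] by (simp add: dr_def[abs_def])

lemma A_lin: "A x (v + w) = A x v + A x w" "A x (c *\<^sub>R v) = c *\<^sub>R A x v"
  using linear_add[OF linear_DX] linear_cmul[OF linear_DX] by (simp_all add: A_def G_lin[OF x] algebra_simps)

lemma C_lin: "C x (v + w) u z = C x v u z + C x w u z" "C x (c *\<^sub>R v) u z = c * C x v u z"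
   "C x u (v + w) z = C x u v z + C x u w z" "C x u (c *\<^sub>R v) z = c * C x u v z"
   "C x u z (v + w) = C x u z v + C x u z w" "C x u z (c *\<^sub>R v) = c * C x u z v"
  by (simp_all add: C_eq h_lin[OF x] th_lin[OF x] algebra_simps)

lemma b_lin: "b x (v + w) u = b x v u + b x w u" "b x (c *\<^sub>R v) u = c * b x v u"
   "b x u (v + w) = b x u v + b x u w" "b x u (c *\<^sub>R v) = c * b x u v"
  by (simp_all add: b_def A_lin C_lin h_lin[OF x] algebra_simps)

lemma C_axis: "C x w (X x) u = n * r x * th x w * th x u - r x * h x w u"
  by (simp add: C_eq th_X[OF x] h_X[OF x] algebra_simps)

text \<open>Differentiating \<open>th x (X x) = 1\<close> gives
  \<open>b x w (X x) + th x (A x w) = 0\<close>. By the definition of \<open>b\<close>,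
  \<open>th x (A x w)\<close> is \<open>b x w (X x) + 2 * C x w (X x) (X x)\<close>, so the unknown
  is minus the value of the cubic form.\<close>

lemma b_axis: "b x w (X x) = - (n - 1) * r x * th x w"
proof -
  have "((\<lambda>y. th y (X y)) has_derivative (\<lambda>w. fder (\<lambda>y. th y (X x)) x w + th x (fder X x w))) (at x)"
    by (rule has_derivative_linear_field[OF V(1) x linear_th smooth_th])
       (use smooth_on_has_derivative[OF smooth(4) x] in auto)
  from fder_eq[OF this] have "fder (\<lambda>y. th y (X y)) x w = fder (\<lambda>y. th y (X x)) x w + th x (fder X x w)"
    by (rule fun_cong)
  moreover have "fder (\<lambda>y. th y (X y)) x = fder (\<lambda>y. 1) x"
    by (rule fder_cong[OF V(1) x]) (rule th_X)
  ultimately have "fder (\<lambda>y. th y (X x)) x w + th x (fder X x w) = 0"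
    by simp
  then have "b x w (X x) + th x (A x w) = 0"
    by (simp add: fder_eq[OF dth[OF x]] A_def th_lin[OF x])
  moreover have "C x w (X x) (X x) = (n - 1) * r x * th x w"
    by (simp add: C_axis th_X[OF x] h_X[OF x] algebra_simps)
  ultimately show ?thesis
    by (simp add: b_def h_X[OF x] algebra_simps)
qed

text \<open>For \<open>j\<close> orthogonal to both the axis and \<open>i\<close>, the Codazzi
  equation with arguments \<open>i\<close>, \<open>j\<close>, \<open>j\<close>, \<open>X x\<close>
  reduces to \<open>dr x i * h x j j = 0\<close>.\<close>

lemma dr_perp:
  assumes i: "th x i = 0"
  shows "dr x i = 0"
proof -
  obtain j where j: "j \<noteq> 0" "h x (X x) j = 0" "h x i j = 0"
    by (rule ex_orthogonal[OF x])
  have "dr x i * h x j j = 0"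
    using codazzi[OF x, of i j j "X x"] i j h(2)[OF x, of j i]
    by (simp add: T_def C_eq b_axis th_def[symmetric] h_X[OF x] th_X[OF x])
  then show ?thesis
    using h(3)[OF x j(1)] by simp
qed

lemma dr_eq: "dr x w = - (n + 1) * r x * al x * th x w"
proof -
  have "dr x (w - th x w *\<^sub>R X x) = 0"
    by (rule dr_perp) (simp add: th_lin[OF x] th_X[OF x])
  then have "dr x w = th x w * dr x (X x)"
    by (simp add: linear_diff[OF linear_dr] linear_cmul[OF linear_dr])
  moreover have "(n + 1) * r x * al x = - dr x (X x)"
    using n_pos r_nz[OF x] by (simp add: al_def)
  ultimately show ?thesis
    by (metis minus_minus minus_mult_left mult.commute)
qed

lemma b_axis_perp:
  assumes i: "th x i = 0"
  shows "b x (X x) i = 0"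
proof -
  have "T x (X x) i (X x) (X x) = (n + 2) * r x * b x (X x) i - r x * b x (X x) i"
    by (simp add: T_def C_eq b_axis h_X[OF x] th_X[OF x] i)
  also have "\<dots> = (n + 1) * r x * b x (X x) i"
    by (simp add: algebra_simps)
  finally have "(n + 1) * r x * b x (X x) i = T x i (X x) (X x) (X x)"
    using codazzi[OF x] by simp
  also have "\<dots> = 0"
    by (simp add: T_def C_eq b_axis h_X[OF x] th_X[OF x] i dr_perp[OF i])
  finally show ?thesis
    using r_nz[OF x] n_pos by simp
qed

text \<open>In the Codazzi equation for \<open>X x\<close>, \<open>i\<close>, \<open>j\<close>,
  \<open>X x\<close> the unknown \<open>b x i j\<close> has the coefficient
  \<open>(n + 1) * r x\<close>; the normalization of \<open>al\<close> is chosen so that this factor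
  cancels against \<open>dr x (X x)\<close>.\<close>

lemma b_perp:
  assumes i: "th x i = 0" and j: "th x j = 0"
  shows "b x i j = (al x + r x) * h x i j"
proof -
  have "(n + 1) * r x * b x i j = (n + 1) * r x * ((al x + r x) * h x i j)"
    using codazzi[OF x, of "X x" i j "X x"] i j dr_perp[OF i] dr_eq[of "X x"] b_axis_perp[OF i] b_axis_perp[OF j]
      b_axis[of "X x"]
    by (simp add: T_def C_eq b_axis h_X[OF x] th_X[OF x] algebra_simps)
  then show ?thesis
    using n_pos r_nz[OF x] by simp
qed

lemma b_eq: "b x w u = (al x + r x) * h x w u - (al x + n * r x) * th x w * th x u"
proof -
  let ?i = "w + (- th x w) *\<^sub>R X x" and ?j = "u + (- th x u) *\<^sub>R X x"
  have i: "th x ?i = 0" and j: "th x ?j = 0"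
    by (simp_all only: th_lin[OF x] th_X[OF x])
  have "b x ?i ?j = (al x + r x) * h x ?i ?j"
    by (rule b_perp[OF i j])
  moreover have "b x (X x) u = - (n - 1) * r x * th x u"
    using b_axis_perp[OF j] by (simp only: b_lin b_axis th_X[OF x]) simp
  ultimately show ?thesis
    by (simp only: b_lin h_lin[OF x] b_axis h_X[OF x] th_lin[OF x] th_X[OF x]) (simp add: algebra_simps)
qed

text \<open>Raising the index of \<open>b\<close>: adding twice the cubic form turns the coefficient
  \<open>al + r\<close> into \<open>al - r\<close>, which is \<open>be\<close>.\<close>

lemma A_eq: "A x w = be x *\<^sub>R w + ((n * r x - al x) * th x w) *\<^sub>R X x"
proof (rule h_nondeg[OF x])
  fix u
  have "h x (A x w) u = b x w u + 2 * C x w (X x) u"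
    by (simp add: b_def)
  then show "h x (A x w) u = h x (be x *\<^sub>R w + ((n * r x - al x) * th x w) *\<^sub>R X x) u"
    by (simp add: b_eq C_axis h_lin[OF x] h_X[OF x] be_def algebra_simps)
qed

end

lemma smooth_al: "smooth_on V al"
proof -
  have "smooth_on V (\<lambda>x. fder r x (X x))"
    by (rule smooth_on_linear_field[OF V(1) smooth_on_linear_fder[OF smooth(5)]])
       (auto intro: smooth_on_fder smooth)
  then have "smooth_on V (\<lambda>x. (- fder r x (X x)) / ((n + 1) * r x))"
    using r_nz n_pos
    by (intro smooth_on_divide smooth_on_minus smooth_on_mult smooth_on_const smooth V) auto
  then show ?thesis
    unfolding al_def[abs_def] dr_def by simp
qed

lemma smooth_be: "smooth_on V be"
  unfolding be_def[abs_def] by (intro smooth_on_diff smooth_al smooth V)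

lemma dth_eq:
  assumes x: "x \<in> V"
  shows "((\<lambda>y. th y u) has_derivative (\<lambda>w. (al x + r x) * h x w u
     - (al x + n * r x) * th x w * th x u + th x (G x w u))) (at x)"
  using dth[OF x, of u] by (simp add: b_eq[OF x])

lemma dr_has_derivative:
  "x \<in> V \<Longrightarrow> (r has_derivative (\<lambda>w. - (n + 1) * r x * al x * th x w)) (at x)"
  by (rule has_derivative_eq_rhs[OF dr]) (simp_all add: dr_eq fun_eq_iff)

lemma dE:
  assumes x: "x \<in> V"
  shows "((\<lambda>y. fder f y (X y)) has_derivative (\<lambda>w. be x *\<^sub>R fder f x w
     + th x w *\<^sub>R ((n * r x - al x) *\<^sub>R fder f x (X x) - l *\<^sub>R f x))) (at x)"
proof -
  have "((\<lambda>y. fder f y (X y)) has_derivative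
     (\<lambda>w. fder (\<lambda>y. fder f y (X x)) x w + fder f x (fder X x w))) (at x)"
    by (rule has_derivative_linear_field[OF V(1) x linear_Df])
       (auto intro: smooth_on_fder smooth smooth_on_has_derivative x)
  moreover have "fder (\<lambda>y. fder f y (X x)) x w + fder f x (fder X x w) =
      fder f x (A x w) - (l * th x w) *\<^sub>R f x" for w
    by (simp add: gauss[OF x] A_def Df_lin[OF x] h_X[OF x])
  ultimately show ?thesis
    by (elim has_derivative_eq_rhs) (simp add: fun_eq_iff A_eq[OF x] Df_lin[OF x] scaleR_diff_right mult.commute)
qed

text \<open>The integrability condition \<open>D\<^sub>u D\<^sub>w E = D\<^sub>w D\<^sub>u E\<close> for the vector \<open>E = df(X)\<close>, differentiated with
  the help of the preceding lemma.\<close>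

lemma dbe:
  assumes x: "x \<in> V"
  shows "(be has_derivative (\<lambda>w. ((n * r x - al x) * be x - l) * th x w)) (at x)"
proof -
  define E where "E = (\<lambda>y. fder f y (X y))"
  define m where "m = (\<lambda>y. n * r y - al y)"
  have E: "smooth_on V E"
    unfolding E_def
    by (rule smooth_on_linear_field[OF V(1) linear_Df]) (auto intro: smooth_on_fder smooth)
  have m: "smooth_on V m"
    unfolding m_def by (intro smooth_on_diff smooth_on_mult smooth_on_const smooth smooth_al V)
  have dE': "fder E y w = be y *\<^sub>R fder f y w + th y w *\<^sub>R (m y *\<^sub>R E y - l *\<^sub>R f y)" if "y \<in> V" for y w
    using fder_eq[OF dE[OF that]] by (simp add: E_def m_def)
  define p where "p = m x * be x - l"
  \<comment> \<open>The second summand is symmetric in \<open>u\<close> and \<open>w\<close>, so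
    commuting the derivatives constrains only the first, which is tangential.\<close>
  have *: "fder (\<lambda>y. fder E y w) x u =
     fder f x (fder be x u *\<^sub>R w + th x w *\<^sub>R (fder m x u *\<^sub>R X x + p *\<^sub>R u))
     + (be x *\<^sub>R fder f x (G x u w) + (b x u w + th x (G x u w)) *\<^sub>R (m x *\<^sub>R E x - l *\<^sub>R f x)
     - (be x * l * h x u w) *\<^sub>R f x + (th x w * th x u * m x) *\<^sub>R (m x *\<^sub>R E x - l *\<^sub>R f x))" for u w
  proof -
    have "((\<lambda>y. be y *\<^sub>R fder f y w + th y w *\<^sub>R (m y *\<^sub>R E y - l *\<^sub>R f y)) has_derivative
      (\<lambda>u. (be x *\<^sub>R fder (\<lambda>y. fder f y w) x u + fder be x u *\<^sub>R fder f x w) +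
         (th x w *\<^sub>R ((m x *\<^sub>R fder E x u + fder m x u *\<^sub>R E x) - l *\<^sub>R fder f x u) +
          (b x u w + th x (G x u w)) *\<^sub>R (m x *\<^sub>R E x - l *\<^sub>R f x)))) (at x)"
      by (intro has_derivative_add has_derivative_diff has_derivative_scaleR has_derivative_scaleR_right
          smooth_on_has_derivative[OF _ x] smooth_be smooth_on_fder smooth m E dth x)
    note fder_eq[OF this]
    moreover have "fder (\<lambda>y. fder E y w) x =
        fder (\<lambda>y. be y *\<^sub>R fder f y w + th y w *\<^sub>R (m y *\<^sub>R E y - l *\<^sub>R f y)) x"
      by (rule fder_cong[OF V(1) x]) (rule dE')
    ultimately show ?thesis
      by (simp add: dE'[OF x] gauss[OF x] Df_lin[OF x] p_def algebra_simps E_def[THEN fun_cong])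
  qed
  have sym: "fder be x u *\<^sub>R w + th x w *\<^sub>R (fder m x u *\<^sub>R X x + p *\<^sub>R u) =
      fder be x w *\<^sub>R u + th x u *\<^sub>R (fder m x w *\<^sub>R X x + p *\<^sub>R w)" for u w
  proof (rule Df_inj[OF x])
    have "b x u w = b x w u"
      using h(2)[OF x, of u w] by (simp add: b_eq[OF x])
    then show "fder f x (fder be x u *\<^sub>R w + th x w *\<^sub>R (fder m x u *\<^sub>R X x + p *\<^sub>R u)) =
      fder f x (fder be x w *\<^sub>R u + th x u *\<^sub>R (fder m x w *\<^sub>R X x + p *\<^sub>R w))"
      using fder_fder_commute[OF V(1) x E, of w u] h(2)[OF x, of u w] G(2)[OF x, of u w]
      unfolding * by (simp add: mult.commute)
  qed
  have lin: "linear (fder be x)"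
    by (rule smooth_on_linear_fder[OF smooth_be x])
  have perp: "fder be x u = 0" if u: "th x u = 0" for u
  proof -
    obtain w where w: "w \<noteq> 0" "h x (X x) w = 0" "h x u w = 0"
      by (rule ex_orthogonal[OF x])
    have "fder be x u * h x w w = 0"
      using arg_cong[OF sym[of u w], of "\<lambda>v. h x v w"] u w by (simp add: h_lin[OF x] th_def[symmetric])
    then show ?thesis using h(3)[OF x w(1)] by simp
  qed
  have axis: "fder be x (X x) = p"
  proof -
    obtain u where u: "u \<noteq> 0" "h x (X x) u = 0" "h x (X x) u = 0"
      by (rule ex_orthogonal[OF x])
    have "p * h x u u = fder be x (X x) * h x u u"
      using arg_cong[OF sym[of u "X x"], of "\<lambda>v. h x v u"] u
      by (simp add: h_lin[OF x] th_def[symmetric] th_X[OF x])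
    then show ?thesis using h(3)[OF x u(1)] by simp
  qed
  have "fder be x w = p * th x w" for w
  proof -
    have "fder be x (w - th x w *\<^sub>R X x) = 0"
      by (rule perp) (simp add: th_lin[OF x] th_X[OF x])
    then show ?thesis
      by (simp add: linear_diff[OF lin] linear_cmul[OF lin] axis)
  qed
  then have "fder be x = (\<lambda>w. ((n * r x - al x) * be x - l) * th x w)"
    by (simp add: p_def m_def fun_eq_iff)
  then show ?thesis
    using smooth_on_has_derivative[OF smooth_be x] by simp
qed

lemma dal:
  assumes x: "x \<in> V"
  shows "(al has_derivative (\<lambda>w. - (n * (r x)\<^sup>2 + (al x)\<^sup>2 + l) * th x w)) (at x)"
proof -
  have "al = (\<lambda>x. be x + r x)"
    by (simp add: be_def fun_eq_iff)
  then show ?thesis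
    using has_derivative_add[OF dbe[OF x] dr_has_derivative[OF x]]
    by (simp add: be_def power2_eq_square algebra_simps)
qed

text \<open>The vector \<open>y\<close> is constant, so the derivative of its decomposition in the
  moving frame vanishes; the tangential and the transversal part of this give the two
  equations.\<close>

lemma dU:
  assumes x: "x \<in> V"
  shows "((\<lambda>x. U x y) has_derivative (\<lambda>w. - G x w (U x y) - a x y *\<^sub>R w)) (at x)"
    and "((\<lambda>x. a x y) has_derivative (\<lambda>w. l * h x w (U x y))) (at x)"
proof -
  let ?dU = "fder (\<lambda>x. U x y) x" and ?da = "fder (\<lambda>x. a x y) x"
  have U: "((\<lambda>x. U x y) has_derivative ?dU) (at x)" and a: "((\<lambda>x. a x y) has_derivative ?da) (at x)"
    by (auto intro: smooth_on_has_derivative x smooth)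
  have 1: "((\<lambda>x. fder f x (U x y)) has_derivative
      (\<lambda>w. fder (\<lambda>z. fder f z (U x y)) x w + fder f x (?dU w))) (at x)"
    by (rule has_derivative_linear_field[OF V(1) x linear_Df])
       (auto intro: smooth_on_fder smooth U)
  have 2: "((\<lambda>x. a x y *\<^sub>R f x) has_derivative (\<lambda>w. a x y *\<^sub>R fder f x w + ?da w *\<^sub>R f x)) (at x)"
    by (intro has_derivative_scaleR a smooth_on_has_derivative[OF _ x] smooth)
  have "fder (\<lambda>x. fder f x (U x y) + a x y *\<^sub>R f x) x = fder (\<lambda>x. y) x"
    by (rule fder_cong[OF V(1) x]) (rule split[symmetric])
  then have "fder f x (G x w (U x y) + ?dU w + a x y *\<^sub>R w) + (?da w - l * h x w (U x y)) *\<^sub>R f x = 0" for w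
    using fun_cong[OF fder_eq[OF has_derivative_add[OF 1 2]], of w]
    by (simp add: gauss[OF x] Df_lin[OF x] algebra_simps)
  from indep[OF x this]
  have "G x w (U x y) + ?dU w + a x y *\<^sub>R w = 0" "?da w = l * h x w (U x y)" for w
    by auto
  then have "?dU = (\<lambda>w. - G x w (U x y) - a x y *\<^sub>R w)" "?da = (\<lambda>w. l * h x w (U x y))"
    by (auto simp: fun_eq_iff eq_neg_iff_add_eq_0 algebra_simps)
  then show "((\<lambda>x. U x y) has_derivative (\<lambda>w. - G x w (U x y) - a x y *\<^sub>R w)) (at x)"
    "((\<lambda>x. a x y) has_derivative (\<lambda>w. l * h x w (U x y))) (at x)"
    using U a by simp_all
qed

lemma dthU:
  assumes x: "x \<in> V"
  shows "((\<lambda>x. th x (U x y)) has_derivative (\<lambda>w. (al x + r x) * h x w (U x y)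
     - (al x + n * r x) * th x w * th x (U x y) - a x y * th x w)) (at x)"
proof -
  have "((\<lambda>x. th x (U x y)) has_derivative (\<lambda>w. fder (\<lambda>z. th z (U x y)) x w
      + th x (- G x w (U x y) - a x y *\<^sub>R w))) (at x)"
    by (rule has_derivative_linear_field[OF V(1) x linear_th smooth_th dU(1)[OF x]])
  then show ?thesis
    by (rule has_derivative_eq_rhs) (simp add: fun_eq_iff fder_eq[OF dth_eq[OF x]] th_lin[OF x])
qed

lemma dhUU:
  assumes x: "x \<in> V"
  shows "((\<lambda>x. h x (U x y) (U x y)) has_derivative (\<lambda>w. - 2 * C x w (U x y) (U x y)
     - 2 * a x y * h x w (U x y))) (at x)"
proof -
  have 1: "((\<lambda>x. h x (U x y) v) has_derivative (\<lambda>w. fder (\<lambda>z. h z (U x y) v) x w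
      + h x (- G x w (U x y) - a x y *\<^sub>R w) v)) (at x)" for v
    by (rule has_derivative_linear_field[OF V(1) x linear_h1 smooth(2) dU(1)[OF x]])
  have "((\<lambda>x. h x (U x y) (U x y)) has_derivative (\<lambda>w. fder (\<lambda>z. h z (U z y) (U x y)) x w
      + h x (U x y) (- G x w (U x y) - a x y *\<^sub>R w))) (at x)"
    by (rule has_derivative_linear_field[OF V(1) x h(1) _ dU(1)[OF x]])
       (auto intro: smooth_on_linear_field[OF V(1) linear_h1] smooth)
  then show ?thesis
    by (rule has_derivative_eq_rhs)
      (simp add: fun_eq_iff fder_eq[OF 1] fder_eq[OF dh'[OF x]] h_lin[OF x] h(2)[OF x, of "U x y"])
qed

end

text \<open>The factor \<open>\<rho>\<close> does not depend on \<open>y\<close>, so the quotient of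
  the values at \<open>y\<close> and \<open>y1\<close> has derivative zero. This turns forms moving
  with \<open>x\<close> into scalar multiples of one fixed form on the ambient space.\<close>

lemma recurrent_proportional:
  fixes \<phi> :: "'a::euclidean_space \<Rightarrow> 'b \<Rightarrow> real"
  assumes W: "open W" "convex W" "x0 \<in> W" "x \<in> W"
    and d: "\<And>x y. x \<in> W \<Longrightarrow> ((\<lambda>x. \<phi> x y) has_derivative (\<lambda>w. \<rho> x w * \<phi> x y)) (at x)"
    and nz: "\<And>x. x \<in> W \<Longrightarrow> \<phi> x y1 \<noteq> 0"
  shows "\<phi> x y = \<phi> x y1 / \<phi> x0 y1 * \<phi> x0 y"
proof -
  have "\<phi> x y / \<phi> x y1 = \<phi> x0 y / \<phi> x0 y1"
  proof (rule has_derivative_zero_unique[OF W(2) _ W(4,3)])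
    fix z assume z: "z \<in> W"
    have "((\<lambda>x. \<phi> x y / \<phi> x y1) has_derivative
       (\<lambda>w. (\<rho> z w * \<phi> z y * \<phi> z y1 - \<phi> z y * (\<rho> z w * \<phi> z y1)) / (\<phi> z y1 * \<phi> z y1))) (at z)"
      by (rule has_derivative_divide'[OF d[OF z] d[OF z] nz[OF z]])
    then show "((\<lambda>x. \<phi> x y / \<phi> x y1) has_derivative (\<lambda>w. 0)) (at z within W)"
      by (simp add: has_derivative_at_withinI)
  qed
  then show ?thesis
    using nz[OF W(3)] nz[OF W(4)] by (simp add: field_simps)
qed

lemma ball_pos:
  fixes g :: "'a::euclidean_space \<Rightarrow> real"
  assumes "open V" "x0 \<in> V" "continuous_on V g" "g x0 > 0"
  obtains e where "e > 0" "ball x0 e \<subseteq> V" "\<And>x. x \<in> ball x0 e \<Longrightarrow> g x > 0"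
proof -
  have "open (g -` {0<..} \<inter> V)"
    using continuous_on_open_vimage[OF assms(1)] assms(3) open_greaterThan[of 0] by blast
  then obtain e where "e > 0" "ball x0 e \<subseteq> g -` {0<..} \<inter> V"
    using openE[of "g -` {0<..} \<inter> V" x0] assms(2,4) by auto
  then show ?thesis using that[of e] by blast
qed

section \<open>Recurrent forms and the functions constant along the leaves\<close>

context axial_affine_sphere
begin

text \<open>The following linear and quadratic forms in the constant ambient vector \<open>y = df(U) + a f\<close> are
  recurrent: \<open>es\<close> and \<open>Q\<close> always, \<open>et\<close> if \<open>kk\<close> vanishes, and \<open>R1\<close> then up to multiples of \<open>et\<^sup>2\<close>.
  Their coefficients solve the equations \<open>D es \<propto> es\<close>, etc., in the frame \<open>f\<close>, \<open>df\<close>.\<close>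

definition kk where "kk x = l + (al x)\<^sup>2 - (r x)\<^sup>2"
definition es where "es x y = - l * th x (U x y) + a x y * (al x + r x)"
definition Q where "Q x y = kk x * (h x (U x y) (U x y) - (th x (U x y))\<^sup>2) + (be x * th x (U x y) + a x y)\<^sup>2"
definition et where "et x y = be x * th x (U x y) + a x y"
definition R1 where "R1 x y = h x (U x y) (U x y) - (th x (U x y))\<^sup>2 + 2 * th x (U x y) * et x y / (al x + r x)"

lemma components_f:
  assumes x: "x \<in> V" shows "U x (f x) = 0" "a x (f x) = 1"
  using frame_unique[OF x, of "U x (f x)" "a x (f x)" 0 1] split[OF x, of "f x"]
  by (simp_all add: Df_lin[OF x])

lemma components_Df:
  assumes x: "x \<in> V" shows "U x (fder f x v) = v" "a x (fder f x v) = 0"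
  using frame_unique[OF x, of "U x (fder f x v)" "a x (fder f x v)" v 0] split[OF x, of "fder f x v"]
  by simp_all

lemma smooth_thU: "smooth_on V (\<lambda>x. th x (U x y))"
  by (rule smooth_on_linear_field[OF V(1) linear_th smooth_th smooth(6)])

lemma smooth_hUU: "smooth_on V (\<lambda>x. h x (U x y) (U x y))"
  by (rule smooth_on_linear_field[OF V(1) h(1) smooth_on_linear_field[OF V(1) linear_h1 smooth(2,6)] smooth(6)])

lemma smooth_kk: "smooth_on V kk"
  unfolding kk_def[abs_def]
  by (intro smooth_on_add smooth_on_diff smooth_on_power smooth_on_const smooth_al smooth V)

lemma smooth_es: "smooth_on V (\<lambda>x. es x y)"
  unfolding es_def
  by (intro smooth_on_add smooth_on_mult smooth_on_const smooth_thU smooth_al smooth V)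

lemma smooth_et: "smooth_on V (\<lambda>x. et x y)"
  unfolding et_def
  by (intro smooth_on_add smooth_on_mult smooth_thU smooth_be smooth V)

lemma smooth_Q: "smooth_on V (\<lambda>x. Q x y)"
  unfolding Q_def
  by (intro smooth_on_add smooth_on_diff smooth_on_power smooth_on_mult smooth_thU smooth_be smooth_kk smooth_hUU smooth V)

lemma dkk:
  assumes x: "x \<in> V"
  shows "(kk has_derivative (\<lambda>w. - 2 * al x * kk x * th x w)) (at x)"
  unfolding kk_def[abs_def]
  by (rule derivative_eq_intros dr_has_derivative[OF x] dal[OF x] refl)+
     (simp add: fun_eq_iff kk_def power2_eq_square algebra_simps)

lemma des:
  assumes x: "x \<in> V"
  shows "((\<lambda>x. es x y) has_derivative (\<lambda>w. (- (n * r x + al x) * th x w) * es x y)) (at x)"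
  unfolding es_def
  by (rule derivative_eq_intros dr_has_derivative[OF x] dal[OF x] dthU[OF x] dU(2)[OF x] refl)+
     (simp add: fun_eq_iff power2_eq_square algebra_simps)

lemma dQ:
  assumes x: "x \<in> V"
  shows "((\<lambda>x. Q x y) has_derivative (\<lambda>w. (- 2 * be x * th x w) * Q x y)) (at x)"
  unfolding Q_def
  apply (rule derivative_eq_intros dkk[OF x] dbe[OF x] dthU[OF x] dU(2)[OF x] dhUU[OF x] refl)+
  apply (rule ext)
  apply (simp add: C_eq kk_def be_def)
  apply algebra
  done

text \<open>\<open>kk\<^bsup>n+1\<^esup> / r\<^sup>2\<close> is constant.\<close>

lemma kk_zero_iff:
  assumes "x0 \<in> V" "x \<in> V"
  shows "kk x = 0 \<longleftrightarrow> kk x0 = 0"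
proof -
  define N where "N = CARD('n)"
  have "kk x ^ Suc N / (r x)\<^sup>2 = kk x0 ^ Suc N / (r x0)\<^sup>2"
  proof (rule has_derivative_zero_unique[OF V(2) _ assms(2,1)])
    fix z assume z: "z \<in> V"
    have "((\<lambda>x. kk x ^ Suc N / (r x)\<^sup>2) has_derivative
      (\<lambda>w. ((n + 1) * (- 2 * al z * kk z * th z w) * kk z ^ N * (r z)\<^sup>2
         - kk z ^ Suc N * (2 * (- (n + 1) * r z * al z * th z w) * r z)) / ((r z)\<^sup>2 * (r z)\<^sup>2))) (at z)"
      by (rule derivative_eq_intros dkk[OF z] dr_has_derivative[OF z] refl)+
         (use r_nz[OF z] n in \<open>auto simp: N_def algebra_simps\<close>)
    also have "(\<lambda>w. ((n + 1) * (- 2 * al z * kk z * th z w) * kk z ^ N * (r z)\<^sup>2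
         - kk z ^ Suc N * (2 * (- (n + 1) * r z * al z * th z w) * r z)) / ((r z)\<^sup>2 * (r z)\<^sup>2)) = (\<lambda>w. 0)"
      by (simp add: fun_eq_iff power2_eq_square algebra_simps)
    finally show "((\<lambda>x. kk x ^ Suc N / (r x)\<^sup>2) has_derivative (\<lambda>w. 0)) (at z within V)"
      by (rule has_derivative_at_withinI)
  qed
  then show ?thesis
    using r_nz[OF assms(1)] r_nz[OF assms(2)] by (auto simp: field_simps)
qed

text \<open>\<open>s\<close> and \<open>q\<close> are normalized reciprocals of \<open>es\<close>
  and of the root of \<open>Q\<close> on fixed vectors; proportionality carries the values
  \<open>es x (f x) = al x + r x\<close> and \<open>Q x (f x) = 1\<close> over to the forms at
  \<open>x0\<close>. The vector \<open>y1\<close> is taken along the axis because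
  \<open>es x0 (f x0)\<close> may vanish, while \<open>es x0 y1 = - l\<close> cannot.\<close>

lemma leaf_functions_elliptic:
  assumes x0: "x0 \<in> V"
  obtains e s q where "e > 0" "ball x0 e \<subseteq> V" "smooth_on (ball x0 e) s" "smooth_on (ball x0 e) q"
    "\<And>x. x \<in> ball x0 e \<Longrightarrow> s x > 0" "\<And>x. x \<in> ball x0 e \<Longrightarrow> q x > 0"
    "\<And>x. x \<in> ball x0 e \<Longrightarrow> (s has_derivative (\<lambda>w. (n * r x + al x) * s x * th x w)) (at x)"
    "\<And>x. x \<in> ball x0 e \<Longrightarrow> (q has_derivative (\<lambda>w. be x * q x * th x w)) (at x)"
    "\<And>x. x \<in> ball x0 e \<Longrightarrow> es x0 (f x) = s x * (al x + r x)"
    "\<And>x. x \<in> ball x0 e \<Longrightarrow> Q x0 (f x) = (q x)\<^sup>2" "q x0 = 1"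
proof -
  define y1 where "y1 = fder f x0 (X x0)"
  define y2 where "y2 = f x0"
  have y1: "es x0 y1 = - l"
    by (simp add: es_def y1_def components_Df[OF x0] th_X[OF x0])
  have y2: "Q x0 y2 = 1"
    by (simp add: Q_def y2_def components_f[OF x0] h_lin[OF x0] th_lin[OF x0])
  have "continuous_on V (\<lambda>x. - (es x y1 / l))"
    by (intro continuous_intros smooth_on_continuous_on smooth_es) (simp add: l_nz)
  then obtain e1 where e1: "e1 > 0" "ball x0 e1 \<subseteq> V" "\<And>x. x \<in> ball x0 e1 \<Longrightarrow> - (es x y1 / l) > 0"
    by (rule ball_pos[OF V(1) x0]) (auto simp: y1 l_nz)
  obtain e2 where e2: "e2 > 0" "ball x0 e2 \<subseteq> V" "\<And>x. x \<in> ball x0 e2 \<Longrightarrow> Q x y2 > 0"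
    by (rule ball_pos[OF V(1) x0 smooth_on_continuous_on[OF smooth_Q], of y2]) (auto simp: y2)
  define e where "e = min e1 e2"
  define B where "B = ball x0 e"
  have B: "open B" "convex B" "B \<subseteq> V" "x0 \<in> B" "B \<subseteq> ball x0 e1" "B \<subseteq> ball x0 e2"
    using e1 e2 by (auto simp: B_def e_def)
  have nz: "es x y1 \<noteq> 0" if "x \<in> B" for x
    using e1(3)[of x] B that by auto
  have pos: "Q x y2 > 0" if "x \<in> B" for x
    using e2(3)[of x] B that by auto
  have sq: "sqrt (Q x y2) \<noteq> 0" if "x \<in> B" for x
    using pos[OF that] by simp
  define s where "s x = - l / es x y1" for x
  define q where "q x = 1 / sqrt (Q x y2)" for x
  have "s x > 0" if "x \<in> B" for x
    using e1(3)[of x] B that l_nz nz[OF that] by (auto simp: s_def divide_less_0_iff zero_less_divide_iff)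
  moreover have "q x > 0" if "x \<in> B" for x
    using pos[OF that] by (simp add: q_def)
  moreover have "smooth_on B s"
    unfolding s_def[abs_def]
    by (intro smooth_on_divide smooth_on_const smooth_on_subset[OF smooth_es] B nz)
  moreover have "smooth_on B q"
    unfolding q_def[abs_def]
    by (intro smooth_on_divide smooth_on_const smooth_on_sqrt smooth_on_subset[OF smooth_Q] B pos sq)
  moreover have "(s has_derivative (\<lambda>w. (n * r x + al x) * s x * th x w)) (at x)" if "x \<in> B" for x
    unfolding s_def[abs_def]
    by (rule derivative_eq_intros des refl)+
       (use that B nz[OF that] in \<open>auto simp: fun_eq_iff field_simps\<close>)
  moreover have "(q has_derivative (\<lambda>w. be x * q x * th x w)) (at x)" if x: "x \<in> B" for x
  proof -
    have "((\<lambda>x. sqrt (Q x y2)) has_derivative (\<lambda>w. - be x * th x w * sqrt (Q x y2))) (at x)"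
      using x B by (intro has_derivative_eq_rhs[OF has_derivative_real_sqrt[OF pos[OF x] dQ]])
         (use pos[OF x] real_sqrt_mult_self[of "Q x y2"] in \<open>auto simp: fun_eq_iff field_simps\<close>)
    from has_derivative_divide'[OF has_derivative_const this sq[OF x], of 1] show ?thesis
      unfolding q_def[abs_def]
      by (rule has_derivative_eq_rhs) (use pos[OF x] in \<open>auto simp: fun_eq_iff field_simps\<close>)
  qed
  moreover have "es x0 (f x) = s x * (al x + r x)" if x: "x \<in> B" for x
  proof -
    have "es x (f x) = es x y1 / es x0 y1 * es x0 (f x)"
      by (rule recurrent_proportional[OF B(1,2,4) x, where \<rho> = "\<lambda>x w. - (n * r x + al x) * th x w"])
         (use B nz des in auto)
    moreover have "es x (f x) = al x + r x"
      using B x by (auto simp: es_def components_f th_lin)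
    ultimately show ?thesis
      using nz[OF x] l_nz by (simp add: s_def y1 field_simps)
  qed
  moreover have "Q x0 (f x) = (q x)\<^sup>2" if x: "x \<in> B" for x
  proof -
    have "Q x (f x) = Q x y2 / Q x0 y2 * Q x0 (f x)"
      by (rule recurrent_proportional[OF B(1,2,4) x, where \<rho> = "\<lambda>x w. - 2 * be x * th x w"])
         (use B pos dQ in \<open>force+\<close>)
    moreover have "Q x (f x) = 1"
      using B x by (auto simp: Q_def components_f th_lin h_lin)
    ultimately show ?thesis
      using pos[OF x] by (simp add: q_def y2 field_simps)
  qed
  moreover have "q x0 = 1" by (simp add: q_def y2)
  moreover have "e > 0" "B \<subseteq> V" using e1 e2 B by (auto simp: e_def)
  ultimately show ?thesis
    using that[of e s q] unfolding B_def by blast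
qed

text \<open>The derivative of \<open>et\<close> contains \<open>h x w (U x y)\<close> with the
  coefficient \<open>be x * (al x + r x) + l\<close>, which is \<open>kk x\<close>; when it
  vanishes, a multiple of \<open>et\<close> remains.\<close>

lemma et_recurrent:
  assumes x: "x \<in> V" and k: "kk x = 0"
  shows "((\<lambda>x. et x y) has_derivative (\<lambda>w. (- be x * th x w) * et x y)) (at x)"
  unfolding et_def
  apply (rule derivative_eq_intros dbe[OF x] dthU[OF x] dU(2)[OF x] refl)+
  apply (rule ext)
  using k unfolding be_def kk_def
  apply algebra
  done

lemma parabolic_nonzero:
  assumes "kk x = 0" shows "al x + r x \<noteq> 0" "be x \<noteq> 0" "l = - be x * (al x + r x)"
proof -
  show l: "l = - be x * (al x + r x)"
    using assms unfolding be_def kk_def by algebra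
  then show "al x + r x \<noteq> 0" "be x \<noteq> 0"
    using l_nz by auto
qed

lemma dalr:
  assumes x: "x \<in> V" and k: "kk x = 0"
  shows "((\<lambda>x. al x + r x) has_derivative (\<lambda>w. (be x - n * r x - al x) * (al x + r x) * th x w)) (at x)"
  apply (rule derivative_eq_intros dr_has_derivative[OF x] dal[OF x] refl)+
  apply (rule ext)
  using k unfolding be_def kk_def
  apply algebra
  done

lemma dR1:
  assumes x: "x \<in> V" and k: "kk x = 0"
  shows "((\<lambda>x. R1 x y) has_derivative
    (\<lambda>w. th x w * (2 * r x * R1 x y - 2 / (al x + r x) * (et x y)\<^sup>2))) (at x)"
proof -
  let ?p = "al x + r x" and ?u = "U x y"
  have p: "?p \<noteq> 0" by (rule parabolic_nonzero[OF k])
  have d2: "((\<lambda>x. (th x (U x y))\<^sup>2) has_derivative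
    (\<lambda>w. 2 * th x ?u * (?p * h x w ?u - (al x + n * r x) * th x w * th x ?u - a x y * th x w))) (at x)"
    by (rule derivative_eq_intros dthU[OF x] refl)+ (simp add: fun_eq_iff algebra_simps)
  have d3: "((\<lambda>x. 2 * th x (U x y) * et x y) has_derivative
    (\<lambda>w. 2 * (?p * h x w ?u - (al x + n * r x) * th x w * th x ?u - a x y * th x w) * et x y
        + 2 * th x ?u * (- be x * th x w * et x y))) (at x)"
    by (rule derivative_eq_intros dthU[OF x] et_recurrent[OF x k] refl)+ (simp add: algebra_simps)
  note d4 = has_derivative_divide'[OF d3 dalr[OF x k] p]
  have "((\<lambda>x. h x (U x y) (U x y) - (th x (U x y))\<^sup>2 + 2 * th x (U x y) * et x y / (al x + r x)) has_derivative
    (\<lambda>w. (- 2 * C x w ?u ?u - 2 * a x y * h x w ?u)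
      - 2 * th x ?u * (?p * h x w ?u - (al x + n * r x) * th x w * th x ?u - a x y * th x w)
      + ((2 * (?p * h x w ?u - (al x + n * r x) * th x w * th x ?u - a x y * th x w) * et x y
        + 2 * th x ?u * (- be x * th x w * et x y)) * ?p
        - 2 * th x ?u * et x y * ((be x - n * r x - al x) * ?p * th x w)) / (?p * ?p))) (at x)"
    by (rule has_derivative_add[OF has_derivative_diff[OF dhUU[OF x] d2] d4])
  moreover have "(- 2 * C x w ?u ?u - 2 * a x y * h x w ?u)
      - 2 * th x ?u * (?p * h x w ?u - (al x + n * r x) * th x w * th x ?u - a x y * th x w)
      + ((2 * (?p * h x w ?u - (al x + n * r x) * th x w * th x ?u - a x y * th x w) * et x y
        + 2 * th x ?u * (- be x * th x w * et x y)) * ?p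
        - 2 * th x ?u * et x y * ((be x - n * r x - al x) * ?p * th x w)) / (?p * ?p)
     = th x w * (2 * r x * R1 x y - 2 / (al x + r x) * (et x y)\<^sup>2)" (is "?L + ?N / (?p * ?p) = ?R") for w
  proof -
    \<comment> \<open>Clears the denominator \<open>al x + r x\<close>, so that the remaining
      identity is polynomial.\<close>
    have gen: "T * (2 * r' * (M * (P * P) + N * P) - 2 * P * E) = T * (2 * r' * (M + N / P) - 2 / P * E) * (P * P)"
      if "P \<noteq> 0" for T r' M N P E :: real
      using that by (simp add: field_simps)
    have "?L * (?p * ?p) + ?N = th x w * (2 * r x * ((h x ?u ?u - (th x ?u)\<^sup>2) * (?p * ?p) + 2 * th x ?u * et x y * ?p)
        - 2 * ?p * (et x y)\<^sup>2)"
      unfolding C_eq et_def be_def by algebra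
    also have "\<dots> = ?R * (?p * ?p)"
      unfolding R1_def by (rule gen[OF p])
    finally have "?L * (?p * ?p) + ?N = ?R * (?p * ?p)" .
    moreover have "L * P + N = M * P \<Longrightarrow> P \<noteq> 0 \<Longrightarrow> L + N / P = M" for L N M P :: real
      by (simp add: field_simps)
    moreover have "?p * ?p \<noteq> 0"
      using p by simp
    ultimately show ?thesis
      by blast
  qed
  ultimately show ?thesis
    unfolding R1_def by simp
qed

lemma smooth_R1:
  assumes "\<And>x. x \<in> V \<Longrightarrow> kk x = 0"
  shows "smooth_on V (\<lambda>x. R1 x y)"
  unfolding R1_def
  by (intro smooth_on_add smooth_on_diff smooth_on_power smooth_on_mult smooth_on_divide smooth_on_const
      smooth_thU smooth_et smooth_hUU smooth_al smooth V parabolic_nonzero assms)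

text \<open>At \<open>y5 = f x0\<close> one has \<open>et x0 y5 = 1\<close> and
  \<open>R1 x0 y5 = 0\<close>, so the correction \<open>c\<close> vanishes at \<open>x0\<close> and
  \<open>R x0 = R1 x0\<close>. On the leaf direction \<open>y6\<close> the form \<open>R x0\<close>
  takes the value \<open>h x0 z z > 0\<close>, which allows the proportionality factor
  \<open>m\<close> to be read off there. The values \<open>et x (f x) = 1\<close> and
  \<open>R x (f x) = c x\<close> are then carried over to \<open>x0\<close>.\<close>

lemma leaf_functions_parabolic:
  assumes x0: "x0 \<in> V" and k0: "kk x0 = 0"
  obtains e t m c where "e > 0" "ball x0 e \<subseteq> V" "smooth_on (ball x0 e) t" "smooth_on (ball x0 e) m"
    "smooth_on (ball x0 e) c"
    "\<And>x. x \<in> ball x0 e \<Longrightarrow> t x > 0" "\<And>x. x \<in> ball x0 e \<Longrightarrow> m x > 0"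
    "\<And>x. x \<in> ball x0 e \<Longrightarrow> (t has_derivative (\<lambda>w. be x * t x * th x w)) (at x)"
    "\<And>x. x \<in> ball x0 e \<Longrightarrow> (m has_derivative (\<lambda>w. 2 * r x * m x * th x w)) (at x)"
    "\<And>x. x \<in> ball x0 e \<Longrightarrow> (c has_derivative (\<lambda>w. (2 * al x * c x + 2 / (al x + r x)) * th x w)) (at x)"
    "\<And>x. x \<in> ball x0 e \<Longrightarrow> et x0 (f x) = t x"
    "\<And>x. x \<in> ball x0 e \<Longrightarrow> R1 x0 (f x) = c x / m x" "t x0 = 1"
proof -
  have k: "kk x = 0" if "x \<in> V" for x
    using kk_zero_iff[OF x0 that] k0 by simp
  define y5 where "y5 = f x0"
  obtain z where z: "z \<noteq> 0" "h x0 (X x0) z = 0" "h x0 (X x0) z = 0"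
    by (rule ex_orthogonal[OF x0])
  define y6 where "y6 = fder f x0 z"
  have thz: "th x0 z = 0" using z by (simp add: th_def)
  have y5: "et x0 y5 = 1" "R1 x0 y5 = 0"
    by (simp_all add: et_def R1_def y5_def components_f[OF x0] h_lin[OF x0] th_lin[OF x0])
  obtain e1 where e1: "e1 > 0" "ball x0 e1 \<subseteq> V" "\<And>x. x \<in> ball x0 e1 \<Longrightarrow> et x y5 > 0"
    by (rule ball_pos[OF V(1) x0 smooth_on_continuous_on[OF smooth_et], of y5]) (auto simp: y5)
  define B1 where "B1 = ball x0 e1"
  have B1: "open B1" "B1 \<subseteq> V" "x0 \<in> B1"
    using e1 by (auto simp: B1_def)
  have pos1: "et x y5 > 0" if "x \<in> B1" for x
    using e1(3) that by (auto simp: B1_def)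
  \<comment> \<open>The multiple of \<open>et\<^sup>2\<close> normalized by \<open>R x y5 = 0\<close> makes \<open>R\<close> recurrent.\<close>
  define c where "c x = - R1 x y5 / (et x y5)\<^sup>2" for x
  define R where "R x y = R1 x y + c x * (et x y)\<^sup>2" for x y
  have smc: "smooth_on B1 c"
    unfolding c_def[abs_def]
    by (intro smooth_on_divide smooth_on_minus smooth_on_power smooth_on_subset[OF smooth_et]
        smooth_on_subset[OF smooth_R1] B1 k) (use pos1 in force)+
  have smR: "smooth_on B1 (\<lambda>x. R x y)" for y
    unfolding R_def
    by (intro smooth_on_add smooth_on_mult smooth_on_power smooth_on_subset[OF smooth_et]
        smooth_on_subset[OF smooth_R1] smc B1 k)
  have dc: "(c has_derivative (\<lambda>w. (2 * al x * c x + 2 / (al x + r x)) * th x w)) (at x)" if x: "x \<in> B1" for x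
  proof -
    have xV: "x \<in> V" using x B1 by auto
    have p: "al x + r x \<noteq> 0" using parabolic_nonzero[OF k[OF xV]] by simp
    have ep: "et x y5 \<noteq> 0" "(et x y5)\<^sup>2 \<noteq> 0" using pos1[OF x] by auto
    have d1: "((\<lambda>x. (et x y5)\<^sup>2) has_derivative (\<lambda>w. - 2 * be x * th x w * (et x y5)\<^sup>2)) (at x)"
      by (rule derivative_eq_intros et_recurrent[OF xV k[OF xV]] refl)+
         (simp add: fun_eq_iff power2_eq_square algebra_simps)
    note d2 = has_derivative_divide'[OF has_derivative_minus[OF dR1[OF xV k[OF xV], of y5]] d1 ep(2)]
    have "(- (th x w * (2 * r x * R1 x y5 - 2 / (al x + r x) * (et x y5)\<^sup>2)) * (et x y5)\<^sup>2
        - (- R1 x y5) * (- 2 * be x * th x w * (et x y5)\<^sup>2)) / ((et x y5)\<^sup>2 * (et x y5)\<^sup>2) =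
       (2 * al x * c x + 2 / (al x + r x)) * th x w" for w
      using ep p by (simp add: c_def be_def divide_simps) (simp add: algebra_simps)
    with d2 show ?thesis
      unfolding c_def[abs_def] by simp
  qed
  have dR: "((\<lambda>x. R x y) has_derivative (\<lambda>w. (2 * r x * th x w) * R x y)) (at x)" if x: "x \<in> B1" for x y
  proof -
    have xV: "x \<in> V" using x B1 by auto
    have p: "al x + r x \<noteq> 0" using parabolic_nonzero[OF k[OF xV]] by simp
    have d1: "((\<lambda>x. (et x y)\<^sup>2) has_derivative (\<lambda>w. - 2 * be x * th x w * (et x y)\<^sup>2)) (at x)"
      by (rule derivative_eq_intros et_recurrent[OF xV k[OF xV]] refl)+
         (simp add: fun_eq_iff power2_eq_square algebra_simps)
    show ?thesis
      unfolding R_def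
      by (rule has_derivative_eq_rhs[OF has_derivative_add[OF dR1[OF xV k[OF xV]] has_derivative_mult[OF dc[OF x] d1]]])
         (simp add: fun_eq_iff be_def algebra_simps)
  qed
  have y6: "R x0 y6 > 0"
    using h(3)[OF x0 z(1)]
    by (simp add: R_def R1_def et_def y6_def components_Df[OF x0] thz)
  obtain e where e: "e > 0" "ball x0 e \<subseteq> B1" "\<And>x. x \<in> ball x0 e \<Longrightarrow> R x y6 > 0"
    by (rule ball_pos[OF B1(1,3) smooth_on_continuous_on[OF smR], of y6]) (auto simp: y6)
  define B where "B = ball x0 e"
  have B: "open B" "convex B" "x0 \<in> B" "B \<subseteq> B1" "B \<subseteq> V"
    using e B1 by (auto simp: B_def)
  have pos: "et x y5 > 0" "R x y6 > 0" if "x \<in> B" for x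
    using that e B pos1 by (auto simp: B_def)
  define t where "t x = 1 / et x y5" for x
  define m where "m x = R x y6 / R x0 y6" for x
  have "smooth_on B t"
    unfolding t_def[abs_def]
    by (intro smooth_on_divide smooth_on_const smooth_on_subset[OF smooth_et] B) (use pos in force)
  moreover have "smooth_on B m"
    unfolding m_def[abs_def]
    by (intro smooth_on_divide smooth_on_const smooth_on_subset[OF smR] B) (use y6 in simp)
  moreover have "smooth_on B c"
    by (rule smooth_on_subset[OF smc B(4)])
  moreover have "t x > 0" "m x > 0" if "x \<in> B" for x
    using pos[OF that] y6 by (simp_all add: t_def m_def)
  moreover have "(t has_derivative (\<lambda>w. be x * t x * th x w)) (at x)" if x: "x \<in> B" for x
  proof -
    have xV: "x \<in> V" using x B by auto
    show ?thesis
      unfolding t_def[abs_def]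
      by (rule derivative_eq_intros et_recurrent[OF xV k[OF xV]] refl)+
         (use pos[OF x] in \<open>auto simp: fun_eq_iff field_simps\<close>)
  qed
  moreover have "(m has_derivative (\<lambda>w. 2 * r x * m x * th x w)) (at x)" if x: "x \<in> B" for x
  proof -
    have "x \<in> B1" using x B by auto
    have "((\<lambda>x. R x y6 * (1 / R x0 y6)) has_derivative (\<lambda>w. (2 * r x * th x w) * R x y6 * (1 / R x0 y6))) (at x)"
      by (intro has_derivative_mult_left dR \<open>x \<in> B1\<close>)
    then show ?thesis
      unfolding m_def[abs_def] by (simp add: algebra_simps)
  qed
  moreover have "(c has_derivative (\<lambda>w. (2 * al x * c x + 2 / (al x + r x)) * th x w)) (at x)" if x: "x \<in> B" for x
    using dc x B by blast
  moreover have "et x0 (f x) = t x" if x: "x \<in> B" for x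
  proof -
    have "et x (f x) = et x y5 / et x0 y5 * et x0 (f x)"
      by (rule recurrent_proportional[OF B(1,2,3) x, where \<rho> = "\<lambda>x w. - be x * th x w"])
         (use B pos(1) et_recurrent k in \<open>force+\<close>)
    moreover have "et x (f x) = 1"
      using B x by (auto simp: et_def components_f th_lin)
    ultimately show ?thesis
      using pos[OF x] by (simp add: t_def y5 field_simps)
  qed
  moreover have "R1 x0 (f x) = c x / m x" if x: "x \<in> B" for x
  proof -
    have "R x (f x) = R x y6 / R x0 y6 * R x0 (f x)"
      by (rule recurrent_proportional[OF B(1,2,3) x, where \<rho> = "\<lambda>x w. 2 * r x * th x w"])
         (use B pos(2) dR in \<open>force+\<close>)
    moreover have "R x (f x) = c x"
      using B x by (auto simp: R_def R1_def et_def components_f th_lin h_lin)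
    moreover have "R x0 (f x) = R1 x0 (f x)"
      by (simp add: R_def c_def y5)
    ultimately show ?thesis
      using pos[OF x] y6 by (simp add: m_def field_simps)
  qed
  moreover have "t x0 = 1" by (simp add: t_def y5)
  moreover have "e > 0" "B \<subseteq> V" using e B by auto
  ultimately show ?thesis
    using that[of e t m c] unfolding B_def by blast
qed

end

section \<open>Orthonormal frames\<close>

locale positive_form =
  fixes b :: "real^'n \<Rightarrow> real^'n \<Rightarrow> real"
  assumes b_linear: "linear (b u)" and b_commute: "b u v = b v u" and b_pos: "v \<noteq> 0 \<Longrightarrow> b v v > 0"
begin

lemma b_lin: "b u (v + w) = b u v + b u w" "b (v + w) u = b v u + b w u"
    "b u (c *\<^sub>R v) = c * b u v" "b (c *\<^sub>R v) u = c * b v u"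
    "b u (v - w) = b u v - b u w" "b (v - w) u = b v u - b w u"
    "b u (- v) = - b u v" "b (- v) u = - b v u" "b u 0 = 0" "b 0 u = 0"
  using linear_add[OF b_linear] linear_cmul[OF b_linear] linear_diff[OF b_linear]
    linear_neg[OF b_linear] linear_0[OF b_linear]
  by (simp_all add: b_commute[of _ u])

lemma b_sum: "b u (\<Sum>i\<in>S. g i) = (\<Sum>i\<in>S. b u (g i))" "b (\<Sum>i\<in>S. g i) u = (\<Sum>i\<in>S. b (g i) u)"
  using linear_sum[OF b_linear, of u g S] by (simp_all add: b_commute[of _ u])

lemma b_nondegenerate: "(\<And>w. b u w = b v w) \<Longrightarrow> u = v"
  using b_pos[of "u - v"] by (force simp: b_lin)

lemma orthonormal_frame_expand:
  assumes X: "orthonormal_frame b X"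
  shows "v = (\<Sum>i\<in>UNIV. b v (X i) *\<^sub>R X i)"
proof -
  define L where "L c = (\<Sum>i\<in>UNIV. (c $ i) *\<^sub>R X i)" for c :: "real^'n"
  have lin: "linear L"
    by (rule linearI) (simp_all add: L_def algebra_simps sum.distrib scaleR_sum_right)
  have coeff: "b (L c) (X j) = c $ j" for c j
    using X by (simp add: L_def b_sum b_lin orthonormal_frame_def if_distrib[of "(*) _"] cong: if_cong)
  have "inj L"
    unfolding linear_injective_0[OF lin]
  proof safe
    fix c assume "L c = 0"
    then have "c $ j = 0" for j using coeff[of c j] by (simp add: b_lin)
    then show "c = 0" by (simp add: vec_eq_iff)
  qed
  then have "surj L"
    using lin linear_injective_imp_surjective by blast
  then obtain c where c: "v = L c" by blast
  then show ?thesis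
    using coeff[of c] by (simp add: L_def)
qed

lemma orthonormal_frame_parseval:
  assumes X: "orthonormal_frame b X"
  shows "b u v = (\<Sum>i\<in>UNIV. b u (X i) * b v (X i))"
  by (subst orthonormal_frame_expand[OF X, of v]) (simp add: b_sum b_lin mult.commute)

text \<open>A new vector comes from counting dimensions: the map of pairings with the vectors found
  so far misses the direction of the new index \<open>k\<close>, so it is not surjective and has a
  kernel. The index \<open>a\<close> enters first and keeps its prescribed vector.\<close>

lemma ex_orthonormal_frame:
  assumes X1: "b X1 X1 = 1"
  obtains X where "orthonormal_frame b X" "X a = X1"
proof -
  have "\<exists>X. X a = X1 \<and> (\<forall>i\<in>insert a S. \<forall>j\<in>insert a S. b (X i) (X j) = (if i = j then 1 else 0))"
    for S :: "'n set"
  proof (induction S rule: infinite_finite_induct)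
    case (insert k S)
    then obtain X where X: "X a = X1"
      "\<And>i j. i \<in> insert a S \<Longrightarrow> j \<in> insert a S \<Longrightarrow> b (X i) (X j) = (if i = j then 1 else 0)"
      by blast
    show ?case
    proof (cases "k = a")
      case True
      then show ?thesis using X by auto
    next
      case False
      define L where "L z = (\<chi> i. if i \<in> insert a S then b (X i) z else 0)" for z
      have lin: "linear L"
        by (rule linearI) (simp_all add: L_def vec_eq_iff b_lin)
      have "\<not> surj L"
      proof
        assume "surj L"
        then obtain z where "L z = axis k 1" by (metis surjD)
        then have "L z $ k = 1" by (simp add: axis_def)
        then show False using False insert by (simp add: L_def)
      qed
      then have "\<not> inj L"
        using lin linear_injective_imp_surjective by blast
      then obtain z where z: "z \<noteq> 0" "L z = 0"
        using linear_injective_0[OF lin] by blast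
      then have orth: "b (X i) z = 0" if "i \<in> insert a S" for i
      proof -
        have "L z $ i = 0" by (simp add: z)
        then show ?thesis using that by (auto simp: L_def split: if_splits)
      qed
      define Z where "Z = (1 / sqrt (b z z)) *\<^sub>R z"
      have Z: "b Z Z = 1"
        using b_pos[OF z(1)] by (simp add: Z_def b_lin field_simps)
      have orthZ: "b (X i) Z = 0" "b Z (X i) = 0" if "i \<in> insert a S" for i
        using orth[OF that] b_commute[of Z "X i"] by (simp_all add: Z_def b_lin)
      have "(X(k := Z)) a = X1"
        using False X by simp
      moreover have "b ((X(k := Z)) i) ((X(k := Z)) j) = (if i = j then 1 else 0)"
        if "i \<in> insert a (insert k S)" "j \<in> insert a (insert k S)" for i j
        using that Z orthZ X(2) insert(2) False by (auto simp: fun_upd_def)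
      ultimately show ?thesis by blast
    qed
  qed (use X1 in auto)
  from this[of UNIV] show ?thesis
    using that by (auto simp: orthonormal_frame_def)
qed

end

section \<open>Coordinates adapted to a function\<close>

lemma vsnoc_nth [simp]: "vsnoc u t $ None = t" "vsnoc u t $ Some j = u $ j"
  by (simp_all add: vsnoc_def)

lemma vec_option_eq_iff: "u = v \<longleftrightarrow> u $ None = v $ None \<and> (\<forall>j. u $ Some j = v $ Some j)"
  for u v :: "real^('k::finite) option"
  by (auto simp: vec_eq_iff) (metis option.exhaust)

lemma vsnoc_eq_iff: "vsnoc u s = vsnoc v t \<longleftrightarrow> u = v \<and> s = t"
  by (auto simp: vec_option_eq_iff vec_eq_iff)

lemma vsnoc_zero: "vsnoc 0 0 = 0"
  by (simp add: vec_option_eq_iff)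

lemma vsnoc_add: "vsnoc u s + vsnoc v t = vsnoc (u + v) (s + t)"
  by (simp add: vec_option_eq_iff)

lemma vsnoc_scaleR: "c *\<^sub>R vsnoc u s = vsnoc (c *\<^sub>R u) (c * s)"
  by (simp add: vec_option_eq_iff)

lemma linear_vsnoc: "linear (\<lambda>(t, u). vsnoc u t)"
  by (rule linearI) (auto simp: vec_option_eq_iff)

lemma sum_option: "(\<Sum>i\<in>UNIV. g i) = g None + (\<Sum>j\<in>UNIV. g (Some j))"
  for g :: "('k::finite) option \<Rightarrow> 'a::comm_monoid_add"
  by (simp add: UNIV_option_conv sum.reindex)

lemma smooth_on_vsnoc:
  assumes "open V" "smooth_on V u" "smooth_on V t"
  shows "smooth_on V (\<lambda>x. vsnoc (u x) (t x))"
proof (rule smooth_on_vec[OF assms(1)])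
  fix i
  show "smooth_on V (\<lambda>x. vsnoc (u x) (t x) $ i)"
    using assms by (cases i) (auto intro: smooth_on_vec_nth)
qed

lemma smooth_on_Pair:
  fixes f :: "'a::euclidean_space \<Rightarrow> 'b::euclidean_space" and g :: "'a \<Rightarrow> 'c::euclidean_space"
  assumes "open V" "smooth_on V f" "smooth_on V g"
  shows "smooth_on V (\<lambda>x. (f x, g x))"
proof -
  have "smooth_on V (\<lambda>x. (f x, 0) + (0, g x))"
    using bounded_linear_Pair[OF bounded_linear_ident bounded_linear_zero]
      bounded_linear_Pair[OF bounded_linear_zero bounded_linear_ident] assms
    by (intro smooth_on_add) (auto intro: smooth_on_bounded_linear)
  then show ?thesis by simp
qed

text \<open>\<open>\<sigma>\<close> and \<open>\<eta>\<close> become the coordinates, with inverse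
  \<open>\<kappa>\<close>. The product domain and the convexity of \<open>W\<close> ensure that a
  function with vanishing \<open>u\<close>-derivative depends on \<open>t\<close> alone.\<close>

definition adapted_chart ::
  "'a::euclidean_space set \<Rightarrow> 'a \<Rightarrow> ('a \<Rightarrow> real) \<Rightarrow> ('a \<Rightarrow> 'c::euclidean_space) \<Rightarrow>
   real set \<Rightarrow> 'c set \<Rightarrow> (real \<times> 'c \<Rightarrow> 'a) \<Rightarrow> bool" where
  "adapted_chart V x0 \<sigma> \<eta> I W \<kappa> \<longleftrightarrow>
     is_interval I \<and> open I \<and> open W \<and> convex W \<and> smooth_on (I \<times> W) \<kappa> \<and>
     homeomorphism (I \<times> W) (\<kappa> ` (I \<times> W)) \<kappa> (\<lambda>x. (\<sigma> x, \<eta> x)) \<and>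
     smooth_on V (\<lambda>x. (\<sigma> x, \<eta> x)) \<and>
     open (\<kappa> ` (I \<times> W)) \<and> \<kappa> ` (I \<times> W) \<subseteq> V \<and> x0 \<in> \<kappa> ` (I \<times> W)"

text \<open>\<open>P\<close> and \<open>S\<close> identify the product of the parameter line and the
  leaf space with the domain, because the smooth local inverse is stated for maps of a space into
  itself. The set \<open>N\<close> allows the leaf coordinate to be confined, later to the unit
  ball.\<close>

lemma ex_adapted_chart:
  fixes \<sigma> :: "real^('k::finite) option \<Rightarrow> real" and \<eta> :: "real^'k option \<Rightarrow> real^'k"
  assumes V: "open V" "x0 \<in> V" and \<sigma>: "smooth_on V \<sigma>" and \<eta>: "smooth_on V \<eta>"
    and inj: "\<And>w. fder \<sigma> x0 w = 0 \<Longrightarrow> fder \<eta> x0 w = 0 \<Longrightarrow> w = 0"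
    and N: "open N" "\<eta> x0 \<in> N"
  obtains I W \<kappa> where "adapted_chart V x0 \<sigma> \<eta> I W \<kappa>" "W \<subseteq> N"
proof -
  define P :: "real \<times> (real^'k) \<Rightarrow> real^'k option" where "P = (\<lambda>(t, u). vsnoc u t)"
  define S :: "real^'k option \<Rightarrow> real \<times> (real^'k)" where "S v = (v $ None, \<chi> j. v $ Some j)" for v
  have P: "linear P" unfolding P_def by (rule linear_vsnoc)
  have S: "linear S" by (rule linearI) (auto simp: S_def vec_eq_iff)
  have SP: "S (P z) = z" for z
    by (cases z) (simp add: S_def P_def vec_eq_iff)
  have PS: "P (S v) = v" for v
    by (simp add: S_def P_def vec_option_eq_iff)
  define T where "T x = P (\<sigma> x, \<eta> x)" for x
  have sm: "smooth_on V (\<lambda>x. (\<sigma> x, \<eta> x))"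
    by (rule smooth_on_Pair[OF V(1) \<sigma> \<eta>])
  have T: "smooth_on V T"
    unfolding T_def[abs_def]
    using P by (intro smooth_on_bounded_linear[OF V(1) _ sm]) (simp add: linear_conv_bounded_linear)
  have "(T has_derivative (\<lambda>w. P (fder \<sigma> x0 w, fder \<eta> x0 w))) (at x0)"
    unfolding T_def[abs_def] using P
    by (intro bounded_linear.has_derivative[of P] has_derivative_Pair smooth_on_has_derivative[OF _ V(2)] \<sigma> \<eta>)
       (simp add: linear_conv_bounded_linear)
  then have dT: "fder T x0 w = P (fder \<sigma> x0 w, fder \<eta> x0 w)" for w
    by (simp add: fder_eq)
  have "inj (fder T x0)"
    unfolding linear_injective_0[OF smooth_on_linear_fder[OF T V(2)]]
  proof safe
    fix w assume "fder T x0 w = 0"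
    then have "S (P (fder \<sigma> x0 w, fder \<eta> x0 w)) = 0"
      using dT linear_0[OF S] by simp
    then show "w = 0" using inj by (simp add: SP prod_eq_iff)
  qed
  then obtain U Z g where U: "open U" "x0 \<in> U" "U \<subseteq> V" "open Z" and hom: "homeomorphism U Z T g"
    and g: "smooth_on Z g"
    by (rule smooth_local_inverse[OF V T])
  have contP: "continuous_on A P" and contS: "continuous_on B S" for A B
    using P S linear_continuous_on linear_conv_bounded_linear by blast+
  have "open (P -` Z)"
    using open_vimage[OF U(4) contP] .
  moreover have "(\<sigma> x0, \<eta> x0) \<in> P -` Z"
    using hom U(2) by (auto simp: homeomorphism_def T_def)
  ultimately obtain A B where AB: "open A" "open B" "(\<sigma> x0, \<eta> x0) \<in> A \<times> B" "A \<times> B \<subseteq> P -` Z"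
    by (rule open_prod_elim)
  obtain d where d: "d > 0" "ball (\<sigma> x0) d \<subseteq> A"
    using AB openE by blast
  obtain d' where d': "d' > 0" "ball (\<eta> x0) d' \<subseteq> B \<inter> N"
    using AB N openE[of "B \<inter> N" "\<eta> x0"] by auto
  define I where "I = ball (\<sigma> x0) d"
  define W where "W = ball (\<eta> x0) d'"
  define \<kappa> where "\<kappa> z = g (P z)" for z
  have IW: "I \<times> W \<subseteq> P -` Z" "open (I \<times> W)" "(\<sigma> x0, \<eta> x0) \<in> I \<times> W"
    using AB(4) d d' by (auto simp: I_def W_def open_Times)
  have \<kappa>V: "\<kappa> z \<in> U" "(\<sigma> (\<kappa> z), \<eta> (\<kappa> z)) = z" if "z \<in> I \<times> W" for z
  proof -
    have "P z \<in> Z" using IW that by auto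
    then have "g (P z) \<in> U" "T (g (P z)) = P z"
      using hom by (auto simp: homeomorphism_def)
    then show "\<kappa> z \<in> U" "(\<sigma> (\<kappa> z), \<eta> (\<kappa> z)) = z"
      using SP[of z] SP[of "(\<sigma> (\<kappa> z), \<eta> (\<kappa> z))"] by (auto simp: \<kappa>_def T_def)
  qed
  have im: "\<kappa> ` (I \<times> W) = {x \<in> U. (\<sigma> x, \<eta> x) \<in> I \<times> W}"
  proof (intro equalityI subsetI)
    fix x assume x: "x \<in> {x \<in> U. (\<sigma> x, \<eta> x) \<in> I \<times> W}"
    then have "g (T x) = x" using hom by (auto simp: homeomorphism_def)
    then have "\<kappa> (\<sigma> x, \<eta> x) = x" by (simp add: \<kappa>_def T_def)
    then show "x \<in> \<kappa> ` (I \<times> W)" using x by (metis (mono_tags) image_eqI mem_Collect_eq)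
  qed (use \<kappa>V in auto)
  have cont: "continuous_on V (\<lambda>x. (\<sigma> x, \<eta> x))"
    by (rule smooth_on_continuous_on[OF sm])
  have "open (\<kappa> ` (I \<times> W))"
  proof -
    have "open ((\<lambda>x. (\<sigma> x, \<eta> x)) -` (I \<times> W) \<inter> U)"
      using continuous_on_open_vimage[OF U(1)] continuous_on_subset[OF cont U(3)] IW(2) by blast
    then show ?thesis
      unfolding im by (simp add: vimage_def Int_def conj_commute)
  qed
  moreover have "smooth_on (I \<times> W) \<kappa>"
    unfolding \<kappa>_def[abs_def]
    using IW by (intro smooth_on_comp[OF IW(2) U(4) _ smooth_on_linear[OF IW(2) P] g]) auto
  moreover from this have "homeomorphism (I \<times> W) (\<kappa> ` (I \<times> W)) \<kappa> (\<lambda>x. (\<sigma> x, \<eta> x))"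
    using \<kappa>V U(3) unfolding homeomorphism_def
    by (auto intro!: smooth_on_continuous_on continuous_on_subset[OF cont] simp: image_iff)
  moreover have "x0 \<in> \<kappa> ` (I \<times> W)"
    using im U IW by auto
  ultimately have "adapted_chart V x0 \<sigma> \<eta> I W \<kappa>"
    using sm im U(3) unfolding adapted_chart_def
    by (auto simp: I_def W_def is_interval_convex_1)
  moreover have "W \<subseteq> N" using d' by (auto simp: W_def)
  ultimately show ?thesis by (rule that)
qed

lemma adapted_chart_inverse:
  assumes "adapted_chart V x0 \<sigma> \<eta> I W \<kappa>" "t \<in> I" "u \<in> W"
  shows "\<sigma> (\<kappa> (t, u)) = t" "\<eta> (\<kappa> (t, u)) = u" "\<kappa> (t, u) \<in> V"
  using assms unfolding adapted_chart_def homeomorphism_def by auto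

text \<open>In the chart \<open>\<sigma>\<close> is the projection to \<open>t\<close>, so
  \<open>dq = q1 d\<sigma>\<close> says that the \<open>u\<close>-derivative of \<open>q\<close>
  vanishes and its \<open>t\<close>-derivative is \<open>q1\<close>. Such a function of the leaf
  becomes a function of one variable, represented at a fixed \<open>u0\<close>.\<close>

lemma adapted_chart_leaf_function:
  fixes \<kappa> :: "real \<times> 'c::euclidean_space \<Rightarrow> 'a::euclidean_space"
  assumes V: "open V" and ch: "adapted_chart V x0 \<sigma> \<eta> I W \<kappa>"
    and q: "smooth_on V q" and \<sigma>: "smooth_on V \<sigma>"
    and dq: "\<And>x w. x \<in> V \<Longrightarrow> fder q x w = q1 x * fder \<sigma> x w"
    and u0: "u0 \<in> W" and t: "t \<in> I"
  shows "u \<in> W \<Longrightarrow> q (\<kappa> (t, u)) = q (\<kappa> (t, u0))"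
    and "((\<lambda>t. q (\<kappa> (t, u0))) has_real_derivative q1 (\<kappa> (t, u0))) (at t)"
    and "smooth_on I (\<lambda>t. q (\<kappa> (t, u0)))"
proof -
  have I: "open I" and W: "open W" "convex W" and \<kappa>: "smooth_on (I \<times> W) \<kappa>"
    using ch by (auto simp: adapted_chart_def)
  have IW: "open (I \<times> W)" using I W by (simp add: open_Times)
  have d: "((\<lambda>z. q (\<kappa> z)) has_derivative (\<lambda>z'. q1 (\<kappa> z) * fst z')) (at z)" if z: "z \<in> I \<times> W" for z
  proof -
    have kz: "\<kappa> z \<in> V" using adapted_chart_inverse(3)[OF ch] z by (cases z) auto
    have dk: "(\<kappa> has_derivative fder \<kappa> z) (at z)"
      by (rule smooth_on_has_derivative[OF \<kappa> z])
    have "((\<lambda>z. \<sigma> (\<kappa> z)) has_derivative (\<lambda>z'. fder \<sigma> (\<kappa> z) (fder \<kappa> z z'))) (at z)"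
      using diff_chain_at[OF dk smooth_on_has_derivative[OF \<sigma> kz]] by (simp add: o_def)
    moreover have "fder (\<lambda>z. \<sigma> (\<kappa> z)) z = fder fst z"
      by (rule fder_cong[OF IW z]) (use adapted_chart_inverse(1)[OF ch] in auto)
    moreover have "(fst has_derivative fst) (at z)"
      by (rule bounded_linear_imp_has_derivative[OF bounded_linear_fst])
    ultimately have "fder \<sigma> (\<kappa> z) (fder \<kappa> z z') = fst z'" for z'
      using fder_eq by metis
    then show ?thesis
      using diff_chain_at[OF dk smooth_on_has_derivative[OF q kz]] dq[OF kz] by (simp add: o_def)
  qed
  show "u \<in> W \<Longrightarrow> q (\<kappa> (t, u)) = q (\<kappa> (t, u0))"
  proof (rule has_derivative_zero_unique[OF W(2) _ _ u0])
    fix v assume v: "v \<in> W"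
    have "((\<lambda>u. (t, u)) has_derivative (\<lambda>u'. (0, u'))) (at v)"
      by (auto intro!: derivative_eq_intros)
    from diff_chain_at[OF this d] show "((\<lambda>u. q (\<kappa> (t, u))) has_derivative (\<lambda>h. 0)) (at v within W)"
      using t v by (auto simp: o_def intro: has_derivative_at_withinI)
  qed
  have "((\<lambda>s. (s, u0)) has_derivative (\<lambda>s'. (s', 0))) (at t)"
    by (auto intro!: derivative_eq_intros)
  from diff_chain_at[OF this d]
  show "((\<lambda>t. q (\<kappa> (t, u0))) has_real_derivative q1 (\<kappa> (t, u0))) (at t)"
    using t u0 by (auto simp: o_def has_field_derivative_def)
  have "smooth_on I (\<lambda>s. \<kappa> (s, u0))"
    using u0 by (intro smooth_on_comp[OF I IW _ _ \<kappa>] smooth_on_Pair I smooth_on_ident smooth_on_const) auto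
  then show "smooth_on I (\<lambda>t. q (\<kappa> (t, u0)))"
    by (intro smooth_on_comp[OF I V _ _ q]) (use adapted_chart_inverse(3)[OF ch _ u0] in auto)
qed

section \<open>The two normal forms\<close>

lemma norm_vec_option: "(norm x)\<^sup>2 = (\<Sum>j\<in>UNIV. (x $ Some j)\<^sup>2) + (x $ None)\<^sup>2"
  for x :: "real^('k::finite) option"
  unfolding power2_norm_eq_inner inner_vec_def sum_option by (simp add: power2_eq_square)

lemma norm_vec_sum: "(norm u)\<^sup>2 = (\<Sum>j\<in>UNIV. (u $ j)\<^sup>2)" for u :: "real^'n"
  unfolding power2_norm_eq_inner inner_vec_def by (simp add: power2_eq_square)

text \<open>A piece of the standard quadric as a graph, so the matrix \<open>T\<close> is the
  identity. The unit ball keeps the radicand positive for both signs, and the image is cut out of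
  the quadric by open conditions: the projection lies in \<open>W\<close> and the last coordinate is
  positive.\<close>

lemma quadric_graph_immersion:
  fixes W :: "(real^('k::finite)) set"
  assumes W: "open W" "W \<subseteq> ball 0 1" and \<epsilon>: "\<epsilon> = 1 \<or> \<epsilon> = -1"
  shows "quadric_immersion \<epsilon> W (\<lambda>u. vsnoc u (sqrt (1 - \<epsilon> * (norm u)\<^sup>2)))"
proof -
  define \<phi> where "\<phi> = (\<lambda>u :: real^'k. vsnoc u (sqrt (1 - \<epsilon> * (norm u)\<^sup>2)))"
  have pos: "1 - \<epsilon> * (norm u)\<^sup>2 > 0" if "u \<in> W" for u
  proof -
    have "norm u < 1" using that W(2) by auto
    then have "(norm u)\<^sup>2 < 1" using power_strict_mono[of "norm u" 1 2] by simp
    then show ?thesis using \<epsilon> zero_le_power2[of "norm u"] by (elim disjE; hypsubst; linarith)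
  qed
  have sm: "smooth_on W \<phi>"
    unfolding \<phi>_def power2_norm_eq_inner
    using pos by (intro smooth_on_vsnoc smooth_on_sqrt smooth_on_diff smooth_on_mult smooth_on_inner
        smooth_on_const smooth_on_ident W) (simp add: power2_norm_eq_inner)
  have "inj (fder \<phi> u)" if u: "u \<in> W" for u
  proof (rule injI)
    fix v w assume eq: "fder \<phi> u v = fder \<phi> u w"
    have "fder \<phi> u z $ Some j = z $ j" for z j
    proof -
      have "((\<lambda>u. \<phi> u $ Some j) has_derivative (\<lambda>z. fder \<phi> u z $ Some j)) (at u)"
        by (rule bounded_linear.has_derivative[OF bounded_linear_vec_nth smooth_on_has_derivative[OF sm u]])
      moreover have "(\<lambda>u. \<phi> u $ Some j) = (\<lambda>u. u $ j)" by (simp add: \<phi>_def)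
      moreover have "((\<lambda>u. u $ j) has_derivative (\<lambda>z. z $ j)) (at u)"
        by (rule bounded_linear_imp_has_derivative[OF bounded_linear_vec_nth])
      ultimately show ?thesis
        using fder_eq by metis
    qed
    then show "v = w" using eq by (metis vec_eq_iff)
  qed
  then have "immersion_on W \<phi>" using sm by (auto simp: immersion_on_def)
  moreover have "openin (top_of_set (model_quadric \<epsilon>)) (\<phi> ` W)"
  proof -
    define pr where "pr x = (\<chi> j. x $ Some j)" for x :: "real^'k option"
    have pr: "pr (vsnoc u t) = u" for u t by (simp add: pr_def vec_eq_iff)
    have normpr: "(norm (pr x))\<^sup>2 = (\<Sum>j\<in>UNIV. (x $ Some j)\<^sup>2)" for x
      by (simp add: norm_vec_sum pr_def)
    have "linear pr" by (rule linearI) (auto simp: pr_def vec_eq_iff)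
    then have "continuous_on UNIV pr"
      using linear_continuous_on linear_conv_bounded_linear by blast
    then have "open (pr -` W)" by (rule open_vimage[OF W(1)])
    moreover have "open {x :: real^'k option. x $ None > 0}"
      by (intro open_Collect_less continuous_intros)
    ultimately have op: "open (pr -` W \<inter> {x. x $ None > 0})" by (rule open_Int)
    have mem: "x \<in> model_quadric \<epsilon> \<longleftrightarrow> (x $ None)\<^sup>2 = 1 - \<epsilon> * (norm (pr x))\<^sup>2" if "x $ None > 0" for x
    proof -
      have "norm x \<noteq> -1"
        using norm_ge_zero[of x] by linarith
      then show ?thesis
        using \<epsilon> that norm_vec_option[of x] normpr[of x]
        by (auto simp: model_quadric_def power2_eq_1_iff)
    qed
    have "\<phi> ` W = model_quadric \<epsilon> \<inter> (pr -` W \<inter> {x. x $ None > 0})"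
    proof (intro equalityI subsetI)
      fix x assume "x \<in> \<phi> ` W"
      then obtain u where u: "u \<in> W" "x = \<phi> u" by blast
      then have "x $ None > 0" "pr x = u" "(x $ None)\<^sup>2 = 1 - \<epsilon> * (norm u)\<^sup>2"
        using pos[OF u(1)] by (simp_all add: \<phi>_def pr)
      then show "x \<in> model_quadric \<epsilon> \<inter> (pr -` W \<inter> {x. x $ None > 0})"
        using mem u by auto
    next
      fix x assume x: "x \<in> model_quadric \<epsilon> \<inter> (pr -` W \<inter> {x. x $ None > 0})"
      then have "x $ None = sqrt (1 - \<epsilon> * (norm (pr x))\<^sup>2)"
        using mem[of x] by (metis IntD2 mem_Collect_eq less_imp_le real_sqrt_unique IntD1)
      then have "x = \<phi> (pr x)"
        by (simp add: \<phi>_def vec_option_eq_iff) (simp add: pr_def)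
      then show "x \<in> \<phi> ` W" using x by auto
    qed
    then show ?thesis using openin_open_Int[OF op] by simp
  qed
  ultimately show ?thesis
    unfolding quadric_immersion_def \<phi>_def[symmetric]
    by (intro conjI exI[of _ "mat 1"]) simp_all
qed

text \<open>\<open>g\<close> stands for the hypersurface after a linear change of the ambient
  coordinates, so that no affine map occurs here.\<close>

definition elliptic_model ::
  "nat \<Rightarrow> real set \<Rightarrow> (real^('k::finite)) set \<Rightarrow> (real \<times> (real^'k) \<Rightarrow> real^'k option option) \<Rightarrow> bool" where
  "elliptic_model n I W g \<longleftrightarrow> (\<exists>\<epsilon> \<phi> \<gamma>1 \<gamma>2 c.
     (\<epsilon> = 1 \<or> \<epsilon> = -1) \<and> quadric_immersion \<epsilon> W \<phi> \<and> centro_affine_curve I \<gamma>1 \<gamma>2 \<and> c \<noteq> 0 \<and>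
     (\<forall>t\<in>I. c * (deriv \<gamma>2 t * \<gamma>1 t - deriv \<gamma>1 t * \<gamma>2 t) ^ (n + 2) * \<gamma>1 t ^ (n - 1) =
        deriv \<gamma>2 t ^ (n - 1) *
          (deriv (deriv \<gamma>1) t * deriv \<gamma>2 t - deriv (deriv \<gamma>2) t * deriv \<gamma>1 t)) \<and>
     (\<forall>t\<in>I. \<forall>u\<in>W. g (t, u) = vsnoc (\<gamma>1 t *\<^sub>R \<phi> u) (\<gamma>2 t)))"

definition parabolic_model ::
  "nat \<Rightarrow> real set \<Rightarrow> (real^('k::finite)) set \<Rightarrow> (real \<times> (real^'k) \<Rightarrow> real^'k option option) \<Rightarrow> bool" where
  "parabolic_model n I W g \<longleftrightarrow> (\<exists>\<gamma>1 \<gamma>2 c.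
     centro_affine_curve I \<gamma>1 \<gamma>2 \<and> c \<noteq> 0 \<and>
     (\<forall>t\<in>I. c * (deriv \<gamma>1 t * \<gamma>2 t - deriv \<gamma>2 t * \<gamma>1 t) ^ (n + 2) * \<gamma>1 t ^ (n - 1) =
        deriv \<gamma>1 t ^ (n - 1) *
          (deriv (deriv \<gamma>2) t * deriv \<gamma>1 t - deriv (deriv \<gamma>1) t * deriv \<gamma>2 t)) \<and>
     (\<forall>t\<in>I. \<forall>u\<in>W. g (t, u) =
        vsnoc (vsnoc (\<gamma>1 t *\<^sub>R u) (\<gamma>1 t * ((norm u)\<^sup>2 / 2) + \<gamma>2 t)) (\<gamma>1 t)))"

lemma deriv_on_open:
  fixes g :: "real \<Rightarrow> real"
  assumes "open I" "\<And>t. t \<in> I \<Longrightarrow> (g has_real_derivative g1 t) (at t)"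
    "\<And>t. t \<in> I \<Longrightarrow> (g1 has_real_derivative g2 t) (at t)" "t \<in> I"
  shows "deriv g t = g1 t" "deriv (deriv g) t = g2 t"
proof -
  show "deriv g t = g1 t" by (rule DERIV_imp_deriv[OF assms(2)[OF assms(4)]])
  have "(deriv g has_real_derivative g2 t) (at t)"
    using assms(3)[OF assms(4)]
    by (rule DERIV_cong_ev[OF refl _ refl, THEN iffD2, rotated])
       (use eventually_nhds_in_open[OF assms(1,4)] in
         \<open>eventually_elim; auto intro: DERIV_imp_deriv assms(2)\<close>)
  then show "deriv (deriv g) t = g2 t" by (rule DERIV_imp_deriv)
qed

section \<open>Ambient coordinates taken from the frame at \<open>x0\<close>\<close>

context axial_affine_sphere
begin

lemma linear_components:
  assumes x: "x \<in> V" shows "linear (U x)" "linear (a x)"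
proof -
  have "U x (y + z) = U x y + U x z \<and> a x (y + z) = a x y + a x z" for y z
    by (rule frame_unique[OF x]) (use split[OF x, of y] split[OF x, of z] split[OF x, of "y + z"] in
      \<open>simp add: Df_lin[OF x] algebra_simps\<close>)
  moreover have "U x (c *\<^sub>R y) = c *\<^sub>R U x y \<and> a x (c *\<^sub>R y) = c * a x y" for c y
    by (rule frame_unique[OF x]) (use split[OF x, of "c *\<^sub>R y"] arg_cong[OF split[OF x, of y], of "\<lambda>y. c *\<^sub>R y"] in
      \<open>simp add: Df_lin[OF x] algebra_simps\<close>)
  ultimately show "linear (U x)" "linear (a x)"
    by (auto intro!: linearI)
qed

lemma linear_es: "x \<in> V \<Longrightarrow> linear (es x)" and linear_et: "x \<in> V \<Longrightarrow> linear (et x)"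
  using linear_components[of x, THEN linear_add] linear_components[of x, THEN linear_cmul]
  by (auto intro!: linearI simp: es_def et_def th_lin algebra_simps)

lemma fder_linear_f:
  fixes L :: "'b \<Rightarrow> 'c::euclidean_space"
  assumes "x \<in> V" "linear L"
  shows "fder (\<lambda>x. L (f x)) x w = L (fder f x w)"
  using assms smooth_on_has_derivative[OF smooth(1) assms(1)]
  by (intro fun_cong[OF fder_eq] bounded_linear.has_derivative[of L]) (auto simp: linear_conv_bounded_linear)

lemma smooth_linear_f:
  fixes L :: "'b \<Rightarrow> 'c::euclidean_space"
  shows "linear L \<Longrightarrow> smooth_on V (\<lambda>x. L (f x))"
  by (rule smooth_on_bounded_linear[OF V(1) _ smooth(1)]) (simp add: linear_conv_bounded_linear)

lemma positive_form: "x \<in> V \<Longrightarrow> positive_form (h x)"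
  by (intro positive_form.intro h)

end

text \<open>The leaves have dimension \<open>CARD('k)\<close> and the ambient space two more, so
  that the models with two nested \<open>vsnoc\<close> can be compared with
  \<open>f\<close>.\<close>

locale axial_affine_sphere_in_space =
  axial_affine_sphere V f G h U a X r l n
  for V :: "(real^('k::finite) option) set" and f :: "real^'k option \<Rightarrow> real^'k option option"
    and G h U a X r l n
begin

text \<open>\<open>p\<close> reads off the components orthogonal to the axis at \<open>x0\<close>.
  Prescribing only its norm leaves the choice of the frame free; the scale \<open>c\<close> will be
  the absolute value of \<open>kk x0\<close> or 1.\<close>

definition axial_coordinates where
  "axial_coordinates x0 c p \<longleftrightarrow> linear p \<and> c > 0 \<and>
     (\<forall>y. (norm (p y :: real^'k))\<^sup>2 = c * (h x0 (U x0 y) (U x0 y) - (th x0 (U x0 y))\<^sup>2))"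

lemma ex_axial_coordinates:
  assumes x0: "x0 \<in> V" and c: "c > 0"
  obtains p where "axial_coordinates x0 c p"
proof -
  interpret positive_form "h x0" by (rule positive_form[OF x0])
  obtain Y where Y: "orthonormal_frame (h x0) Y" "Y None = X x0"
    by (rule ex_orthonormal_frame[OF unit[OF x0]])
  define p where "p y = (\<chi> j. sqrt c * h x0 (U x0 y) (Y (Some j)))" for y
  note lU = linear_components(1)[OF x0]
  have "linear p"
    by (rule linearI)
      (simp_all add: p_def vec_eq_iff linear_add[OF lU] linear_cmul[OF lU] b_lin algebra_simps)
  moreover have "(norm (p y))\<^sup>2 = c * (h x0 (U x0 y) (U x0 y) - (th x0 (U x0 y))\<^sup>2)" for y
  proof -
    have "h x0 (U x0 y) (U x0 y) = (th x0 (U x0 y))\<^sup>2 + (\<Sum>j\<in>UNIV. (h x0 (U x0 y) (Y (Some j)))\<^sup>2)"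
      by (subst orthonormal_frame_parseval[OF Y(1)])
         (simp add: sum_option Y(2) h_X[OF x0] power2_eq_square)
    then show ?thesis
      using c by (simp add: norm_vec_sum p_def power_mult_distrib sum_distrib_left)
  qed
  ultimately show ?thesis
    using that c by (auto simp: axial_coordinates_def)
qed

lemma axial_coordinates_zero:
  assumes x0: "x0 \<in> V" and p: "axial_coordinates x0 c p"
  shows "U x0 y = 0 \<Longrightarrow> p y = 0" "p y = 0 \<Longrightarrow> th x0 (U x0 y) = 0 \<Longrightarrow> U x0 y = 0"
proof -
  have *: "(norm (p y))\<^sup>2 = c * (h x0 (U x0 y) (U x0 y) - (th x0 (U x0 y))\<^sup>2)" and c: "c > 0"
    using p by (auto simp: axial_coordinates_def)
  show "p y = 0" if "U x0 y = 0"
    using * that by (simp add: h_lin[OF x0] th_lin[OF x0])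
  show "U x0 y = 0" if "p y = 0" "th x0 (U x0 y) = 0"
    using * that c h(3)[OF x0, of "U x0 y"] by force
qed

text \<open>The position vector at \<open>x0\<close> has no tangential component, so
  \<open>p (f x0) = 0\<close>. Hence the derivative of the quotient at \<open>x0\<close> involves
  only that of \<open>p (f x)\<close>, and the leaf coordinate starts at the centre of the unit
  ball. The derivative of \<open>S (f x)\<close> detects the axis direction and that of
  \<open>p (f x)\<close> the others.\<close>

lemma ex_axial_chart:
  assumes B: "open B" "B \<subseteq> V" "x0 \<in> B" and S: "linear S"
    and SX: "\<And>w. S (fder f x0 w) = 0 \<Longrightarrow> th x0 w = 0"
    and q: "smooth_on B q" "\<And>x. x \<in> B \<Longrightarrow> q x > 0" and p: "axial_coordinates x0 c p"
  obtains I W \<kappa> where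
    "adapted_chart B x0 (\<lambda>x. S (f x)) (\<lambda>x. (1 / q x) *\<^sub>R p (f x)) I W \<kappa>" "W \<subseteq> ball 0 1"
proof -
  have x0: "x0 \<in> V" using B by auto
  have lp: "linear p" using p by (simp add: axial_coordinates_def)
  have pf: "p (f x0) = 0"
    by (rule axial_coordinates_zero[OF x0 p]) (rule components_f[OF x0])
  have sp: "smooth_on B (\<lambda>x. p (f x))" by (rule smooth_on_subset[OF smooth_linear_f[OF lp] B(2)])
  have smq: "smooth_on B (\<lambda>x. 1 / q x)"
    by (intro smooth_on_divide smooth_on_const q B) (use q(2) in force)
  have "((\<lambda>x. (1 / q x) *\<^sub>R p (f x)) has_derivative (\<lambda>w. (1 / q x0) *\<^sub>R fder (\<lambda>x. p (f x)) x0 w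
      + fder (\<lambda>x. 1 / q x) x0 w *\<^sub>R p (f x0))) (at x0)"
    by (intro has_derivative_scaleR smooth_on_has_derivative[OF _ B(3)] smq sp)
  then have d\<eta>: "fder (\<lambda>x. (1 / q x) *\<^sub>R p (f x)) x0 w = (1 / q x0) *\<^sub>R p (fder f x0 w)" for w
    by (simp add: fder_eq pf fder_linear_f[OF x0 lp])
  show ?thesis
  proof (rule ex_adapted_chart[OF B(1,3), of "\<lambda>x. S (f x)" "\<lambda>x. (1 / q x) *\<^sub>R p (f x)" "ball 0 1"])
    show "smooth_on B (\<lambda>x. S (f x))"
      by (rule smooth_on_subset[OF smooth_linear_f[OF S] B(2)])
    show "smooth_on B (\<lambda>x. (1 / q x) *\<^sub>R p (f x))"
      by (intro smooth_on_scaleR smq sp B)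
    show "w = 0" if "fder (\<lambda>x. S (f x)) x0 w = 0" "fder (\<lambda>x. (1 / q x) *\<^sub>R p (f x)) x0 w = 0" for w
    proof -
      have "th x0 w = 0" using that(1) SX by (simp add: fder_linear_f[OF x0 S])
      moreover have "p (fder f x0 w) = 0" using that(2) q(2)[OF B(3)] by (simp add: d\<eta>)
      ultimately show "w = 0"
        using axial_coordinates_zero(2)[OF x0 p, of "fder f x0 w"] by (simp add: components_Df[OF x0])
    qed
  qed (auto simp: pf intro: that)
qed

end

section \<open>The normal forms for \<open>kk \<noteq> 0\<close> and for
  \<open>kk = 0\<close>\<close>

context axial_affine_sphere_in_space
begin

text \<open>In the coordinates \<open>p\<close>, \<open>et x0\<close>, \<open>es x0\<close> the form
  \<open>Q x0\<close> is \<open>\<epsilon>\<close> times the squared norm of \<open>p\<close> plus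
  the square of \<open>et x0\<close>, where \<open>\<epsilon>\<close> is the sign of
  \<open>kk x0\<close>. Since its value at \<open>f x\<close> is the square of \<open>q x\<close>,
  division by \<open>q\<close> puts the first two blocks on the quadric. So \<open>\<gamma>1\<close>
  is \<open>q\<close>, and \<open>\<gamma>2\<close> is the parameter \<open>t = es x0 (f x)\<close>
  itself.\<close>

lemma elliptic_normal_form:
  assumes x0: "x0 \<in> V" and k0: "kk x0 \<noteq> 0"
  obtains B \<sigma> \<eta> I and W :: "(real^'k) set" and \<kappa> L where "open B" "B \<subseteq> V" "adapted_chart B x0 \<sigma> \<eta> I W \<kappa>"
    "linear L" "inj L" "elliptic_model CARD('k option) I W (\<lambda>z. L (f (\<kappa> z)))"
proof -
  define N where "N = CARD('k option)"
  have nN: "n = real N" "N \<ge> 1" using n by (auto simp: N_def)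
  obtain e s q where e: "e > 0" "ball x0 e \<subseteq> V" and sm: "smooth_on (ball x0 e) s" "smooth_on (ball x0 e) q"
    and pos: "\<And>x. x \<in> ball x0 e \<Longrightarrow> s x > 0" "\<And>x. x \<in> ball x0 e \<Longrightarrow> q x > 0"
    and ds: "\<And>x. x \<in> ball x0 e \<Longrightarrow> (s has_derivative (\<lambda>w. (n * r x + al x) * s x * th x w)) (at x)"
    and dq: "\<And>x. x \<in> ball x0 e \<Longrightarrow> (q has_derivative (\<lambda>w. be x * q x * th x w)) (at x)"
    and es: "\<And>x. x \<in> ball x0 e \<Longrightarrow> es x0 (f x) = s x * (al x + r x)"
    and Q: "\<And>x. x \<in> ball x0 e \<Longrightarrow> Q x0 (f x) = (q x)\<^sup>2" and q0: "q x0 = 1"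
    by (rule leaf_functions_elliptic[OF x0]) (rule that)
  define B0 where "B0 = ball x0 e"
  have B0: "open B0" "x0 \<in> B0" "B0 \<subseteq> V" using e by (auto simp: B0_def)
  have "continuous_on B0 (\<lambda>x. et x0 (f x))"
    by (intro smooth_on_continuous_on smooth_on_subset[OF smooth_linear_f[OF linear_et[OF x0]] B0(3)])
  \<comment> \<open>The value at \<open>x0\<close> is 1. Keeping it positive selects the positive
    square root in the graph of the quadric.\<close>
  then obtain e' where e': "e' > 0" "ball x0 e' \<subseteq> B0" "\<And>x. x \<in> ball x0 e' \<Longrightarrow> et x0 (f x) > 0"
    by (rule ball_pos[OF B0(1,2)]) (auto simp: et_def components_f[OF x0] th_lin[OF x0])
  define B where "B = ball x0 e'"
  have B: "open B" "convex B" "x0 \<in> B" "B \<subseteq> V" and BB: "\<And>x. x \<in> B \<Longrightarrow> x \<in> ball x0 e"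
    using e' B0 by (auto simp: B_def B0_def)
  note ds = ds[OF BB] and dq = dq[OF BB] and es = es[OF BB] and Q = Q[OF BB] and pos = pos[OF BB]
  have BV: "x \<in> V" if "x \<in> B" for x using that B by auto
  have sm: "smooth_on B s" "smooth_on B q"
    using smooth_on_subset[OF sm(1)] smooth_on_subset[OF sm(2)] BB by blast+
  obtain p where p: "axial_coordinates x0 \<bar>kk x0\<bar> p"
    by (rule ex_axial_coordinates[OF x0, of "\<bar>kk x0\<bar>"]) (use k0 in auto)
  have lp: "linear p" using p by (simp add: axial_coordinates_def)
  define \<sigma> where "\<sigma> = (\<lambda>x. es x0 (f x))"
  define \<eta> where "\<eta> = (\<lambda>x. (1 / q x) *\<^sub>R p (f x))"
  obtain I W \<kappa> where ch: "adapted_chart B x0 \<sigma> \<eta> I W \<kappa>" and W: "W \<subseteq> ball 0 1"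
    unfolding \<sigma>_def \<eta>_def
    by (rule ex_axial_chart[OF B(1,4,3) linear_es[OF x0] _ sm(2) pos(2) p])
       (use l_nz in \<open>auto simp: es_def components_Df[OF x0]\<close>)
  have I: "open I" and oW: "open W" and "x0 \<in> \<kappa> ` (I \<times> W)" using ch by (auto simp: adapted_chart_def)
  then obtain tI u0 where tI: "tI \<in> I" and u0: "u0 \<in> W" by auto
  have d\<sigma>: "fder \<sigma> x w = - l * s x * th x w" if x: "x \<in> B" for x w
  proof -
    have "(\<sigma> has_derivative (\<lambda>w. s x * (- (n * (r x)\<^sup>2 + (al x)\<^sup>2 + l) * th x w + - (n + 1) * r x * al x * th x w)
      + (n * r x + al x) * s x * th x w * (al x + r x))) (at x)"
      by (rule has_derivative_transform_within_open[OF
            has_derivative_mult[OF ds[OF x] has_derivative_add[OF dal[OF BV[OF x]] dr_has_derivative[OF BV[OF x]]]] B(1) x])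
         (simp add: \<sigma>_def es)
    from fder_eq[OF this] show ?thesis
      by (simp add: power2_eq_square algebra_simps)
  qed
  \<comment> \<open>These are the first and second derivatives of \<open>q\<close> with respect to
    \<open>t\<close>, read off by dividing by \<open>d\<sigma>\<close>.\<close>
  define q1 where "q1 x = - (be x * q x) / (l * s x)" for x
  define q2 where "q2 x = - (q x * kk x) / (l * s x)\<^sup>2" for x
  have dq1: "(q1 has_derivative (\<lambda>w. q2 x * (- l * s x * th x w))) (at x)" if x: "x \<in> B" for x
  proof -
    have nz: "l * s x \<noteq> 0" using pos(1)[OF x] l_nz by simp
    have 1: "((\<lambda>x. - (be x * q x)) has_derivative
      (\<lambda>w. - (be x * (be x * q x * th x w) + ((n * r x - al x) * be x - l) * th x w * q x))) (at x)"
      by (intro has_derivative_minus has_derivative_mult dbe[OF BV[OF x]] dq[OF x])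
    have 2: "((\<lambda>x. l * s x) has_derivative (\<lambda>w. l * ((n * r x + al x) * s x * th x w))) (at x)"
      by (intro has_derivative_mult_right ds[OF x])
    have "- (be x * (be x * q x * th x w) + ((n * r x - al x) * be x - l) * th x w * q x) * (l * s x)
        - - (be x * q x) * (l * ((n * r x + al x) * s x * th x w)) = q x * kk x * (l * s x) * th x w" for w
      unfolding kk_def be_def by algebra
    moreover have "q x * kk x * (l * s x) * th x w / (l * s x * (l * s x)) = q2 x * (- l * s x * th x w)" for w
      using nz by (simp add: q2_def power2_eq_square)
    ultimately show ?thesis
      using has_derivative_divide'[OF 1 2 nz] unfolding q1_def[abs_def] by simp
  qed
  have sm1: "smooth_on B q1"
    unfolding q1_def[abs_def]
    by (intro smooth_on_divide smooth_on_minus smooth_on_mult smooth_on_const sm B smooth_on_subset[OF smooth_be])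
       (use pos(1) l_nz in force)
  have sm\<sigma>: "smooth_on B \<sigma>"
    unfolding \<sigma>_def by (rule smooth_on_subset[OF smooth_linear_f[OF linear_es[OF x0]] B(4)])
  have dq_\<sigma>: "fder q x w = q1 x * fder \<sigma> x w" if "x \<in> B" for x w
    using pos(1)[OF that] l_nz by (simp add: fder_eq[OF dq[OF that]] d\<sigma>[OF that] q1_def)
  have dq1_\<sigma>: "fder q1 x w = q2 x * fder \<sigma> x w" if "x \<in> B" for x w
    by (simp add: fder_eq[OF dq1[OF that]] d\<sigma>[OF that])
  note leaf_q = adapted_chart_leaf_function[OF B(1) ch sm(2) sm\<sigma> dq_\<sigma> u0]
  note leaf_q1 = adapted_chart_leaf_function[OF B(1) ch sm1 sm\<sigma> dq1_\<sigma> u0]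
  define \<gamma> where "\<gamma> t = q (\<kappa> (t, u0))" for t
  have \<gamma>: "deriv \<gamma> t = q1 (\<kappa> (t, u0))" "deriv (deriv \<gamma>) t = q2 (\<kappa> (t, u0))" if "t \<in> I" for t
    using deriv_on_open[OF I leaf_q(2) leaf_q1(2) that] by (simp_all add: \<gamma>_def[abs_def])
  have kk_nz: "kk x \<noteq> 0" if "x \<in> B" for x
    using kk_zero_iff[OF x0 BV[OF that]] k0 by simp
  \<comment> \<open>The exponents are those for which the logarithmic derivatives of \<open>kk\<close>, \<open>q\<close>, \<open>s\<close> cancel.\<close>
  define c where "c x = - (l ^ N) / (kk x ^ (N + 1) * q x ^ (2 * N) * (s x)\<^sup>2)" for x
  have c_nz: "c x \<noteq> 0" if "x \<in> B" for x
    using pos[OF that] l_nz kk_nz[OF that] by (simp add: c_def)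
  have c_const: "c x = c x0" if x: "x \<in> B" for x
  proof -
    have "kk x ^ (N + 1) * q x ^ (2 * N) * (s x)\<^sup>2 = kk x0 ^ (N + 1) * q x0 ^ (2 * N) * (s x0)\<^sup>2"
    proof (rule has_derivative_zero_unique[OF B(2) _ x B(3)])
      fix z assume z: "z \<in> B"
      have 1: "((\<lambda>x. kk x ^ (N + 1)) has_derivative (\<lambda>w. (n + 1) * (- 2 * al z * th z w) * kk z ^ (N + 1))) (at z)"
        by (rule has_derivative_eq_rhs[OF has_derivative_power[OF dkk[OF BV[OF z]]]])
           (simp add: fun_eq_iff nN algebra_simps)
      have qp: "q z * q z ^ (2 * N - 1) = q z ^ (2 * N)"
        using nN by (simp flip: power_Suc)
      have 2: "((\<lambda>x. q x ^ (2 * N)) has_derivative (\<lambda>w. (2 * n) * (be z * th z w) * q z ^ (2 * N))) (at z)"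
        by (rule has_derivative_eq_rhs[OF has_derivative_power[OF dq[OF z]]])
           (use qp in \<open>simp add: fun_eq_iff nN(1) algebra_simps\<close>)
      have 3: "((\<lambda>x. (s x)\<^sup>2) has_derivative (\<lambda>w. 2 * ((n * r z + al z) * th z w) * (s z)\<^sup>2)) (at z)"
        by (rule has_derivative_eq_rhs[OF has_derivative_power[OF ds[OF z]]])
           (simp add: fun_eq_iff power2_eq_square algebra_simps)
      show "((\<lambda>x. kk x ^ (N + 1) * q x ^ (2 * N) * (s x)\<^sup>2) has_derivative (\<lambda>w. 0)) (at z within B)"
        by (rule has_derivative_at_withinI, rule has_derivative_eq_rhs[OF has_derivative_mult[OF has_derivative_mult[OF 1 2] 3]])
           (simp add: fun_eq_iff be_def algebra_simps)
    qed
    then show ?thesis by (simp add: c_def)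
  qed
  \<comment> \<open>The determinant of the curve \<open>(\<gamma>, t)\<close> and its derivative. It
    is nonzero because \<open>kk\<close> is, which gives the centro-affine condition, and it is the
    base of the power in the differential equation.\<close>
  have w: "\<gamma> t - deriv \<gamma> t * t = q (\<kappa> (t, u0)) * kk (\<kappa> (t, u0)) / l" if t: "t \<in> I" for t
  proof -
    define x where "x = \<kappa> (t, u0)"
    have x: "x \<in> B" "\<sigma> x = t" using adapted_chart_inverse[OF ch t u0] by (auto simp: x_def)
    have "t = s x * (al x + r x)" using x es by (simp add: \<sigma>_def)
    then have "q1 x * t = - (be x * q x * (al x + r x) / l)"
      using pos(1)[OF x(1)] by (simp add: q1_def)
    then have "q x - q1 x * t = q x * (l + be x * (al x + r x)) / l"
      using l_nz by (simp add: field_simps)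
    moreover have "l + be x * (al x + r x) = kk x"
      by (simp add: kk_def be_def power2_eq_square algebra_simps)
    ultimately show ?thesis
      by (simp add: \<gamma>(1)[OF t]) (simp add: \<gamma>_def x_def)
  qed
  define \<epsilon> where "\<epsilon> = sgn (kk x0)"
  have \<epsilon>: "\<epsilon> = 1 \<or> \<epsilon> = -1" "\<epsilon> * \<bar>kk x0\<bar> = kk x0"
    using k0 by (auto simp: \<epsilon>_def sgn_if)
  define \<phi> where "\<phi> u = vsnoc u (sqrt (1 - \<epsilon> * (norm u)\<^sup>2))" for u :: "real^'k"
  define L where "L y = vsnoc (vsnoc (p y) (et x0 y)) (es x0 y)" for y
  have lL: "linear L"
    by (rule linearI)
      (simp_all add: L_def vsnoc_add vsnoc_scaleR linear_add[OF lp] linear_cmul[OF lp]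
        linear_add[OF linear_et[OF x0]] linear_cmul[OF linear_et[OF x0]]
        linear_add[OF linear_es[OF x0]] linear_cmul[OF linear_es[OF x0]])
  have "inj L"
    unfolding linear_injective_0[OF lL]
  proof safe
    fix y assume "L y = 0"
    then have 0: "p y = 0" "et x0 y = 0" "es x0 y = 0"
      by (simp_all add: L_def vsnoc_eq_iff flip: vsnoc_zero)
    have a0: "a x0 y = - be x0 * th x0 (U x0 y)"
      using 0(2) by (simp add: et_def)
    \<comment> \<open>On the kernel of \<open>et x0\<close> the form \<open>es x0\<close> is
      \<open>- kk x0\<close> times the axis component; this is how \<open>kk x0 \<noteq> 0\<close>
      makes \<open>L\<close> injective.\<close>
    have "kk x0 * th x0 (U x0 y) = 0"
    proof -
      have "es x0 y = - (kk x0 * th x0 (U x0 y))"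
        by (simp add: es_def a0 kk_def be_def power2_eq_square algebra_simps)
      then show ?thesis using 0(3) by simp
    qed
    then have th0: "th x0 (U x0 y) = 0" using k0 by simp
    then have "a x0 y = 0" "U x0 y = 0"
      using 0 axial_coordinates_zero(2)[OF x0 p] by (simp_all add: et_def)
    then show "y = 0" using split[OF x0, of y] by (simp add: Df_lin[OF x0])
  qed
  moreover have "elliptic_model N I W (\<lambda>z. L (f (\<kappa> z)))"
    unfolding elliptic_model_def
  proof (intro exI conjI ballI)
    show "\<epsilon> = 1 \<or> \<epsilon> = -1" by (rule \<epsilon>)
    show "quadric_immersion \<epsilon> W \<phi>"
      unfolding \<phi>_def by (rule quadric_graph_immersion[OF oW W \<epsilon>(1)])
    show "c x0 \<noteq> 0" by (rule c_nz[OF B(3)])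
    fix t assume t: "t \<in> I"
    define x where "x = \<kappa> (t, u0)"
    have x: "x \<in> B" "\<sigma> x = t" using adapted_chart_inverse[OF ch t u0] by (auto simp: x_def)
    have xp: "s x > 0" "q x > 0" using pos x by auto
    have w: "\<gamma> t - deriv \<gamma> t * t = q x * kk x / l"
      using w[OF t] by (simp add: x_def)
    show "c x0 * (deriv (\<lambda>t. t) t * \<gamma> t - deriv \<gamma> t * t) ^ (N + 2) * \<gamma> t ^ (N - 1) =
        deriv (\<lambda>t. t) t ^ (N - 1) *
          (deriv (deriv \<gamma>) t * deriv (\<lambda>t. t) t - deriv (deriv (\<lambda>t. t)) t * deriv \<gamma> t)"
    proof -
      have "c x * (q x * kk x / l) ^ (N + 2) * q x ^ (N - 1) = q2 x"
      proof -
        \<comment> \<open>The exponents add up to \<open>2 * N + 1\<close>, so the denominator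
          \<open>q x ^ (2 * N)\<close> of \<open>c\<close> leaves the single factor
          \<open>q x\<close> of \<open>q2\<close>.\<close>
        have a1: "q x ^ (N + 2) * q x ^ (N - 1) = q x * q x ^ (2 * N)"
          using nN by (simp flip: power_add power_Suc add: mult_2)
        have a2: "c x * (q x * kk x / l) ^ (N + 2) * q x ^ (N - 1) =
          c x * (kk x ^ (N + 2) / l ^ (N + 2)) * (q x ^ (N + 2) * q x ^ (N - 1))"
          by (simp add: power_mult_distrib power_divide)
        have "- L / (K * P * T\<^sup>2) * (K * k' / (L * l\<^sup>2)) * (p' * P) = - (p' * k') / (l * T)\<^sup>2"
          if "L \<noteq> 0" "K \<noteq> 0" "P \<noteq> 0" for L K P T k' p'
          using that by (simp add: field_simps)
        from this[of "l ^ N" "kk x ^ (N + 1)" "q x ^ (2 * N)" "s x" "kk x" "q x"]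
        have a3: "c x * (kk x ^ (N + 2) / l ^ (N + 2)) * (q x * q x ^ (2 * N)) = q2 x"
          using xp l_nz kk_nz[OF x(1)] by (simp add: c_def q2_def power_add power2_eq_square mult.commute)
        show ?thesis
          unfolding a2 a1 by (rule a3)
      qed
      then show ?thesis
        using w by (simp add: \<gamma>(2)[OF t] x_def[symmetric] c_const[OF x(1), symmetric])
          (simp add: \<gamma>_def x_def)
    qed
    fix u assume u: "u \<in> W"
    define z where "z = \<kappa> (t, u)"
    have z: "z \<in> B" "\<sigma> z = t" "\<eta> z = u" using adapted_chart_inverse[OF ch t u] by (auto simp: z_def)
    have qz: "q z = \<gamma> t" using leaf_q(1)[OF _ t u] by (simp add: z_def \<gamma>_def)
    have zp: "q z > 0" "et x0 (f z) > 0" using pos z e'(3) by (auto simp: B_def)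
    have pz: "p (f z) = q z *\<^sub>R u" using z(3) zp by (auto simp: \<eta>_def)
    have "(q z)\<^sup>2 = \<epsilon> * (norm (p (f z)))\<^sup>2 + (et x0 (f z))\<^sup>2"
    proof -
      have "\<epsilon> * (norm (p (f z)))\<^sup>2 = (\<epsilon> * \<bar>kk x0\<bar>) * (h x0 (U x0 (f z)) (U x0 (f z)) - (th x0 (U x0 (f z)))\<^sup>2)"
        using p by (simp add: axial_coordinates_def)
      then show ?thesis
        using Q[OF z(1)] unfolding \<epsilon>(2) by (simp add: Q_def et_def)
    qed
    then have e1: "(et x0 (f z))\<^sup>2 = (q z)\<^sup>2 * (1 - \<epsilon> * (norm u)\<^sup>2)"
      by (simp add: pz power_mult_distrib algebra_simps)
    then have "et x0 (f z) = sqrt ((q z)\<^sup>2 * (1 - \<epsilon> * (norm u)\<^sup>2))"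
      using zp by (metis abs_of_pos real_sqrt_abs)
    then have "et x0 (f z) = q z * sqrt (1 - \<epsilon> * (norm u)\<^sup>2)"
      using zp by (simp add: real_sqrt_mult)
    then show "L (f (\<kappa> (t, u))) = vsnoc (\<gamma> t *\<^sub>R \<phi> u) t"
      using z(2) pz by (simp add: L_def z_def[symmetric] \<phi>_def vsnoc_scaleR qz \<sigma>_def)
  next
    have "q (\<kappa> (t, u0)) * kk (\<kappa> (t, u0)) / l \<noteq> 0" if "t \<in> I" for t
      using pos(2) kk_nz l_nz adapted_chart_inverse(3)[OF ch that u0] by force
    moreover have "smooth_on I \<gamma>"
      unfolding \<gamma>_def[abs_def] by (rule leaf_q(3)[OF _ tI])
    ultimately show "centro_affine_curve I \<gamma> (\<lambda>t. t)"
      using w by (auto simp: centro_affine_curve_def smooth_on_ident mult.commute)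
  qed
  ultimately show ?thesis
    using that[of B \<sigma> \<eta> I W \<kappa> L] B(1,4) ch lL unfolding N_def by blast
qed

text \<open>With \<open>yn\<close> the scaled axis component, \<open>R1 x0 y\<close> is the squared
  norm of \<open>p y\<close> minus \<open>2 * yn y * et x0 y\<close>. For
  \<open>t = et x0 (f x)\<close> and \<open>p (f x)\<close> equal to \<open>t\<close> times
  \<open>u\<close>, the equation \<open>R1 x0 (f x) = c x / m x\<close> can be solved for
  \<open>yn (f x)\<close>: it is the paraboloid term plus \<open>g x\<close>, and \<open>g\<close>
  becomes \<open>\<gamma>2\<close>.\<close>

lemma parabolic_normal_form:
  assumes x0: "x0 \<in> V" and k0: "kk x0 = 0"
  obtains B \<sigma> \<eta> I and W :: "(real^'k) set" and \<kappa> L where "open B" "B \<subseteq> V" "adapted_chart B x0 \<sigma> \<eta> I W \<kappa>"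
    "linear L" "inj L" "parabolic_model CARD('k option) I W (\<lambda>z. L (f (\<kappa> z)))"
proof -
  define N where "N = CARD('k option)"
  have nN: "n = real N" "N \<ge> 1" using n by (auto simp: N_def)
  obtain e t m c where e: "e > 0" "ball x0 e \<subseteq> V" and sm: "smooth_on (ball x0 e) t"
    "smooth_on (ball x0 e) m" "smooth_on (ball x0 e) c"
    and pos: "\<And>x. x \<in> ball x0 e \<Longrightarrow> t x > 0" "\<And>x. x \<in> ball x0 e \<Longrightarrow> m x > 0"
    and dt: "\<And>x. x \<in> ball x0 e \<Longrightarrow> (t has_derivative (\<lambda>w. be x * t x * th x w)) (at x)"
    and dm: "\<And>x. x \<in> ball x0 e \<Longrightarrow> (m has_derivative (\<lambda>w. 2 * r x * m x * th x w)) (at x)"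
    and dc: "\<And>x. x \<in> ball x0 e \<Longrightarrow> (c has_derivative (\<lambda>w. (2 * al x * c x + 2 / (al x + r x)) * th x w)) (at x)"
    and et: "\<And>x. x \<in> ball x0 e \<Longrightarrow> et x0 (f x) = t x"
    and R1: "\<And>x. x \<in> ball x0 e \<Longrightarrow> R1 x0 (f x) = c x / m x" and t0: "t x0 = 1"
    by (rule leaf_functions_parabolic[OF x0 k0]) (rule that)
  define B where "B = ball x0 e"
  note sm = sm[folded B_def] and pos = pos[folded B_def] and dt = dt[folded B_def]
    and dm = dm[folded B_def] and dc = dc[folded B_def] and et = et[folded B_def] and R1 = R1[folded B_def]
  have B: "open B" "convex B" "x0 \<in> B" "B \<subseteq> V"
    using e by (auto simp: B_def)
  have BV: "x \<in> V" if "x \<in> B" for x using that B by auto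
  have kk: "kk x = 0" if "x \<in> B" for x
    using kk_zero_iff[OF x0 BV[OF that]] k0 by simp
  note nz = parabolic_nonzero[OF kk]
  obtain p where p: "axial_coordinates x0 1 p"
    by (rule ex_axial_coordinates[OF x0, of 1]) auto
  have lp: "linear p" using p by (simp add: axial_coordinates_def)
  define \<sigma> where "\<sigma> = (\<lambda>x. et x0 (f x))"
  define \<eta> where "\<eta> = (\<lambda>x. (1 / t x) *\<^sub>R p (f x))"
  have \<sigma>t: "\<sigma> x = t x" if "x \<in> B" for x using et[OF that] by (simp add: \<sigma>_def)
  obtain I W \<kappa> where ch: "adapted_chart B x0 \<sigma> \<eta> I W \<kappa>" and W: "W \<subseteq> ball 0 1"
    unfolding \<sigma>_def \<eta>_def
    by (rule ex_axial_chart[OF B(1,4,3) linear_et[OF x0] _ sm(1) pos(1) p])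
       (use nz(2)[OF B(3)] in \<open>auto simp: et_def components_Df[OF x0]\<close>)
  have I: "open I" and oW: "open W" and "x0 \<in> \<kappa> ` (I \<times> W)" using ch by (auto simp: adapted_chart_def)
  then obtain tI u0 where tI: "tI \<in> I" and u0: "u0 \<in> W" by auto
  have d\<sigma>: "fder \<sigma> x w = be x * t x * th x w" if x: "x \<in> B" for x w
    using fder_cong[OF B(1) x \<sigma>t] fder_eq[OF dt[OF x]] by simp
  \<comment> \<open>\<open>j\<close> is \<open>g - t g'\<close> with the derivative taken in
    \<open>t\<close>, that is, the determinant of the curve and its derivative. Starting from it,
    \<open>g1\<close> and \<open>g2\<close> are the first two derivatives of
    \<open>g\<close>.\<close>
  define j where "j x = - 1 / (l * (m x * t x))" for x
  define g where "g x = - (c x / m x) / (2 * t x)" for x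
  define g1 where "g1 x = (g x - j x) / t x" for x
  define g2 where "g2 x = (al x + r x) * j x / (be x * (t x)\<^sup>2)" for x
  have dj: "(j has_derivative (\<lambda>w. - (al x + r x) * j x * th x w)) (at x)" if x: "x \<in> B" for x
  proof -
    have 1: "((\<lambda>x. l * (m x * t x)) has_derivative (\<lambda>w. (al x + r x) * (l * (m x * t x)) * th x w)) (at x)"
      by (rule has_derivative_eq_rhs[OF has_derivative_mult_right[OF has_derivative_mult[OF dm[OF x] dt[OF x]]]])
         (simp add: fun_eq_iff be_def algebra_simps)
    have "l * (m x * t x) \<noteq> 0" using pos[OF x] l_nz by simp
    then show ?thesis
      unfolding j_def[abs_def]
      by (intro has_derivative_eq_rhs[OF has_derivative_divide'[OF has_derivative_const 1]])
         (simp_all add: fun_eq_iff field_simps)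
  qed
  have dg: "(g has_derivative (\<lambda>w. g1 x * (be x * t x * th x w))) (at x)" if x: "x \<in> B" for x
  proof -
    have xm: "m x \<noteq> 0" "2 * t x \<noteq> 0" "t x \<noteq> 0" using pos[OF x] by auto
    define P where "P = al x + r x"
    have P: "P \<noteq> 0" "be x \<noteq> 0" "l = - be x * P" using nz[OF x] by (auto simp: P_def)
    have 1: "((\<lambda>x. - (c x / m x)) has_derivative (\<lambda>w. - ((2 / m x) * (be x * c x + 1 / P) * th x w))) (at x)"
      by (rule has_derivative_minus[OF has_derivative_eq_rhs[OF has_derivative_divide'[OF dc[OF x, folded P_def] dm[OF x] xm(1)]]])
         (use xm(1) P(1) in \<open>simp add: fun_eq_iff be_def field_simps\<close>)
    have 2: "((\<lambda>x. 2 * t x) has_derivative (\<lambda>w. 2 * (be x * t x * th x w))) (at x)"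
      by (rule has_derivative_mult_right[OF dt[OF x]])
    have "(- ((2 / m x) * (be x * c x + 1 / P) * T) * (2 * t x) - - (c x / m x) * (2 * (be x * t x * T))) / (2 * t x * (2 * t x))
        = g1 x * (be x * t x * T)" for T
      using xm P(1,2) by (simp add: g1_def g_def j_def P(3) divide_simps) (simp add: algebra_simps)
    then show ?thesis
      using has_derivative_divide'[OF 1 2 xm(2)] unfolding g_def[abs_def] by simp
  qed
  have dg1: "(g1 has_derivative (\<lambda>w. g2 x * (be x * t x * th x w))) (at x)" if x: "x \<in> B" for x
  proof -
    have xm: "t x \<noteq> 0" "be x \<noteq> 0" using pos[OF x] nz[OF x] by auto
    have "((g1 x * (be x * t x * T) - - (al x + r x) * j x * T) * t x - (g x - j x) * (be x * t x * T)) / (t x * t x)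
        = g2 x * (be x * t x * T)" for T
    proof -
      have "g1 x * t x = g x - j x" using xm by (simp add: g1_def)
      then have "(g1 x * (be x * t x * T) - - (al x + r x) * j x * T) * t x - (g x - j x) * (be x * t x * T)
          = (al x + r x) * j x * T * t x"
        by (simp flip: \<open>g1 x * t x = g x - j x\<close> add: algebra_simps)
      then show ?thesis
        using xm by (simp only: g2_def) (simp add: power2_eq_square)
    qed
    then show ?thesis
      using has_derivative_divide'[OF has_derivative_diff[OF dg[OF x] dj[OF x]] dt[OF x] xm(1)]
      unfolding g1_def[abs_def] by simp
  qed
  have smj: "smooth_on B j"
    unfolding j_def[abs_def]
    by (intro smooth_on_divide smooth_on_const smooth_on_mult sm B) (use pos l_nz in force)
  have smg: "smooth_on B g"
    unfolding g_def[abs_def]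
    by (intro smooth_on_divide smooth_on_minus smooth_on_const smooth_on_mult sm B) (use pos in force)+
  have smg1: "smooth_on B g1"
    unfolding g1_def[abs_def]
    by (intro smooth_on_divide smooth_on_diff smg smj sm B) (use pos in force)
  have sm\<sigma>: "smooth_on B \<sigma>"
    unfolding \<sigma>_def by (rule smooth_on_subset[OF smooth_linear_f[OF linear_et[OF x0]] B(4)])
  have dg_\<sigma>: "fder g x w = g1 x * fder \<sigma> x w" if "x \<in> B" for x w
    by (simp add: fder_eq[OF dg[OF that]] d\<sigma>[OF that])
  have dg1_\<sigma>: "fder g1 x w = g2 x * fder \<sigma> x w" if "x \<in> B" for x w
    by (simp add: fder_eq[OF dg1[OF that]] d\<sigma>[OF that])
  note leaf_g = adapted_chart_leaf_function[OF B(1) ch smg sm\<sigma> dg_\<sigma> u0]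
  note leaf_g1 = adapted_chart_leaf_function[OF B(1) ch smg1 sm\<sigma> dg1_\<sigma> u0]
  define \<gamma> where "\<gamma> t = g (\<kappa> (t, u0))" for t
  have \<gamma>: "deriv \<gamma> t = g1 (\<kappa> (t, u0))" "deriv (deriv \<gamma>) t = g2 (\<kappa> (t, u0))" if "t \<in> I" for t
    using deriv_on_open[OF I leaf_g(2) leaf_g1(2) that] by (simp_all add: \<gamma>_def[abs_def])
  have w: "\<gamma> s - deriv \<gamma> s * s = j (\<kappa> (s, u0))" if s: "s \<in> I" for s
  proof -
    define x where "x = \<kappa> (s, u0)"
    have x: "x \<in> B" "t x = s" using adapted_chart_inverse[OF ch s u0] \<sigma>t by (auto simp: x_def)
    have "g x - g1 x * t x = j x" using pos(1)[OF x(1)] by (simp add: g1_def)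
    then show ?thesis
      using x(2) by (simp add: \<gamma>(1)[OF s]) (simp add: \<gamma>_def x_def)
  qed
  \<comment> \<open>Up to the factor \<open>(- l) ^ (N + 1)\<close> this is the ratio of the two
    sides of the equation for the curve. Its logarithmic derivative vanishes by
    \<open>be = al - r\<close> and \<open>l = - be (al + r)\<close>.\<close>
  define k where "k x = (al x + r x) * m x ^ (N + 1) / be x" for x
  have k_const: "k x = k x0" if x: "x \<in> B" for x
  proof (rule has_derivative_zero_unique[OF B(2) _ x B(3)])
    fix z assume z: "z \<in> B"
    have 1: "((\<lambda>x. m x ^ (N + 1)) has_derivative (\<lambda>w. (n + 1) * (2 * r z * th z w) * m z ^ (N + 1))) (at z)"
      by (rule has_derivative_eq_rhs[OF has_derivative_power[OF dm[OF z]]])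
         (simp add: fun_eq_iff nN algebra_simps)
    have 2: "(be has_derivative (\<lambda>w. (n * r z + r z) * be z * th z w)) (at z)"
    proof (rule has_derivative_eq_rhs[OF dbe[OF BV[OF z]]])
      have "(n * r z - al z) * be z - l = (n * r z + r z) * be z"
        using nz(3)[OF z] by (simp add: algebra_simps)
      then show "(\<lambda>w. ((n * r z - al z) * be z - l) * th z w) = (\<lambda>w. (n * r z + r z) * be z * th z w)"
        by simp
    qed
    show "(k has_derivative (\<lambda>w. 0)) (at z within B)"
      unfolding k_def[abs_def]
      by (rule has_derivative_at_withinI, rule has_derivative_eq_rhs[OF
          has_derivative_divide'[OF has_derivative_mult[OF dalr[OF BV[OF z] kk[OF z]] 1] 2 nz(2)[OF z]]])
         (simp add: fun_eq_iff, simp add: be_def algebra_simps)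
  qed
  have k_nz: "k x \<noteq> 0" if "x \<in> B" for x
    using nz[OF that] pos(2)[OF that] by (simp add: k_def)
  define yn where "yn y = - th x0 (U x0 y) / (al x0 + r x0)" for y
  define L where "L y = vsnoc (vsnoc (p y) (yn y)) (et x0 y)" for y
  have lL: "linear L"
    using linear_add[OF linear_components(1)[OF x0]] linear_cmul[OF linear_components(1)[OF x0]]
    by (intro linearI)
      (simp_all add: L_def vsnoc_add vsnoc_scaleR linear_add[OF lp] linear_cmul[OF lp] yn_def
        linear_add[OF linear_et[OF x0]] linear_cmul[OF linear_et[OF x0]] th_lin[OF x0] diff_divide_distrib)
  have "inj L"
    unfolding linear_injective_0[OF lL]
  proof safe
    fix y assume "L y = 0"
    then have 0: "p y = 0" "et x0 y = 0" "yn y = 0"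
      by (simp_all add: L_def vsnoc_eq_iff flip: vsnoc_zero)
    then have th0: "th x0 (U x0 y) = 0" using nz(1)[OF B(3)] by (simp add: yn_def)
    then have "a x0 y = 0" "U x0 y = 0"
      using 0 axial_coordinates_zero(2)[OF x0 p] by (simp_all add: et_def)
    then show "y = 0" using split[OF x0, of y] by (simp add: Df_lin[OF x0])
  qed
  moreover have "parabolic_model N I W (\<lambda>z. L (f (\<kappa> z)))"
    unfolding parabolic_model_def
  proof (intro exI conjI ballI)
    show "k x0 * (- l) ^ (N + 1) \<noteq> 0" using k_nz[OF B(3)] l_nz by simp
    fix s assume s: "s \<in> I"
    define x where "x = \<kappa> (s, u0)"
    have x: "x \<in> B" "t x = s" using adapted_chart_inverse[OF ch s u0] \<sigma>t by (auto simp: x_def)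
    have xm: "m x > 0" "t x > 0" using pos x by auto
    show "k x0 * (- l) ^ (N + 1) * (deriv (\<lambda>t. t) s * \<gamma> s - deriv \<gamma> s * s) ^ (N + 2) * s ^ (N - 1) =
        deriv (\<lambda>t. t) s ^ (N - 1) *
          (deriv (deriv \<gamma>) s * deriv (\<lambda>t. t) s - deriv (deriv (\<lambda>t. t)) s * deriv \<gamma> s)"
    proof -
      \<comment> \<open>This relation trades the powers of \<open>j\<close> and \<open>t\<close> for
        those of \<open>m\<close> and \<open>- l\<close>, which then cancel against
        \<open>k\<close>.\<close>
      have "j x * t x * (m x * (- l)) = 1"
        using xm l_nz by (simp add: j_def)
      then have e1: "(j x * t x) ^ (N + 1) * (m x ^ (N + 1) * (- l) ^ (N + 1)) = 1"
        by (metis power_mult_distrib power_one)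
      have e2: "j x ^ (N + 2) * t x ^ (N - 1) = (j x * t x) ^ (N + 1) * (j x / (t x)\<^sup>2)"
      proof -
        have "t x ^ (N + 1) = t x ^ (N - 1) * (t x)\<^sup>2"
          using nN by (simp flip: power_add)
        moreover have "j x ^ (N + 2) = j x ^ (N + 1) * j x" by simp
        ultimately show ?thesis
          unfolding power_mult_distrib using xm by (simp del: power_Suc power_Suc2 add_2_eq_Suc')
      qed
      have gen: "A * M / b' * l' * (J * (j' / T)) = (J * (M * l')) * (A * j' / (b' * T))"
        for A M b' l' J j' T :: real by simp
      have "k x * (- l) ^ (N + 1) * (j x ^ (N + 2) * t x ^ (N - 1)) = g2 x"
        unfolding e2 k_def gen e1 g2_def by simp
      then have "k x0 * (- l) ^ (N + 1) * (\<gamma> s - deriv \<gamma> s * s) ^ (N + 2) * s ^ (N - 1) = deriv (deriv \<gamma>) s"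
        unfolding w[OF s] \<gamma>(2)[OF s] x_def[symmetric] k_const[OF x(1)] x(2) by (simp only: mult.assoc)
      then show ?thesis by simp
    qed
    fix u assume u: "u \<in> W"
    define z where "z = \<kappa> (s, u)"
    have z: "z \<in> B" "t z = s" "\<eta> z = u" using adapted_chart_inverse[OF ch s u] \<sigma>t by (auto simp: z_def)
    have gz: "g z = \<gamma> s" using leaf_g(1)[OF _ s u] by (simp add: z_def \<gamma>_def)
    have zp: "t z > 0" using pos z by auto
    have pz: "p (f z) = t z *\<^sub>R u" using z(3) zp by (auto simp: \<eta>_def)
    have "c z / m z = (norm (p (f z)))\<^sup>2 - 2 * yn (f z) * t z"
      using R1[OF z(1)] p et[OF z(1)] by (simp add: R1_def yn_def axial_coordinates_def)
    moreover have "(norm (p (f z)))\<^sup>2 = (t z)\<^sup>2 * (norm u)\<^sup>2"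
      by (simp add: pz power_mult_distrib)
    moreover have "Y = T * (M / 2) + - C / (2 * T)" if "C = T\<^sup>2 * M - 2 * Y * T" "T > 0" for C T M Y :: real
      using that by (simp add: field_simps power2_eq_square)
    ultimately have "yn (f z) = t z * ((norm u)\<^sup>2 / 2) + g z"
      using zp unfolding g_def by metis
    then show "L (f (\<kappa> (s, u))) = vsnoc (vsnoc (s *\<^sub>R u) (s * ((norm u)\<^sup>2 / 2) + \<gamma> s)) s"
      using z(2) pz et[OF z(1)] by (simp add: L_def z_def[symmetric] gz)
  next
    have "s * deriv \<gamma> s - \<gamma> s \<noteq> 0" if "s \<in> I" for s
    proof -
      have "j (\<kappa> (s, u0)) \<noteq> 0"
        using pos l_nz adapted_chart_inverse(3)[OF ch that u0] by (force simp: j_def)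
      then show ?thesis using w[OF that] by (simp add: mult.commute)
    qed
    moreover have "smooth_on I \<gamma>"
      unfolding \<gamma>_def[abs_def] by (rule leaf_g(3)[OF _ tI])
    ultimately show "centro_affine_curve I (\<lambda>t. t) \<gamma>"
      by (simp add: centro_affine_curve_def smooth_on_ident)
  qed
  ultimately show ?thesis
    using that[of B \<sigma> \<eta> I W \<kappa> L] B(1,4) ch lL unfolding N_def by blast
qed

end

section \<open>Rotationally invariant cubic forms\<close>

text \<open>Linear algebra at one point: total symmetry, apolarity and invariance under rotations
  about the axis are all that is retained of the difference tensor.\<close>

locale invariant_cubic = positive_form b for b :: "real^'n \<Rightarrow> real^'n \<Rightarrow> real" +
  fixes K :: "real^'n \<Rightarrow> real^'n \<Rightarrow> real^'n" and X1 :: "real^'n"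
  assumes K_bilinear: "bilinear K"
    and K_commute: "K u v = K v u" and K_sym: "b (K u v) w = b (K u w) v"
    and X1: "b X1 X1 = 1" and dim: "CARD('n) \<ge> 3"
    and invariant: "axis_rotation b X1 g \<Longrightarrow> K (g v) (g w) = g (K v w)"
    and trace: "orthonormal_frame b Y \<Longrightarrow> (\<Sum>i\<in>UNIV. b (K u (Y i)) (Y i)) = 0"
begin

definition c where "c u v w = b (K u v) w"

lemma c_commute: "c u v w = c v u w" "c u v w = c u w v"
  using K_commute K_sym by (simp_all add: c_def)

lemma c_lin: "c (v + w) u z = c v u z + c w u z" "c (k *\<^sub>R v) u z = k * c v u z"
    "c (v - w) u z = c v u z - c w u z" "c (- v) u z = - c v u z"
  using bilinear_ladd[OF K_bilinear] bilinear_lmul[OF K_bilinear] bilinear_lsub[OF K_bilinear]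
    bilinear_lneg[OF K_bilinear]
  by (simp_all add: c_def b_lin)

lemma c_lin': "c u (v + w) z = c u v z + c u w z" "c u (k *\<^sub>R v) z = k * c u v z"
    "c u (v - w) z = c u v z - c u w z" "c u (- v) z = - c u v z"
    "c u z (v + w) = c u z v + c u z w" "c u z (k *\<^sub>R v) = k * c u z v"
    "c u z (v - w) = c u z v - c u z w" "c u z (- v) = - c u z v"
  using bilinear_radd[OF K_bilinear] bilinear_rmul[OF K_bilinear] bilinear_rsub[OF K_bilinear]
    bilinear_rneg[OF K_bilinear]
  by (simp_all add: c_def b_lin)

lemma c_zero: "c 0 u v = 0" "c u 0 v = 0" "c u v 0 = 0"
  using bilinear_lzero[OF K_bilinear] bilinear_rzero[OF K_bilinear] by (simp_all add: c_def b_lin)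

text \<open>The rotation by the angle with cosine \<open>p\<close> and sine \<open>q\<close> in the plane of \<open>y\<close> and \<open>z\<close>.\<close>

definition rot where
  "rot y z p q v = v + b v y *\<^sub>R ((p - 1) *\<^sub>R y + q *\<^sub>R z) + b v z *\<^sub>R (- q *\<^sub>R y + (p - 1) *\<^sub>R z)"

lemma linear_rot: "linear (rot y z p q)"
  by (rule linearI) (simp_all add: rot_def b_lin algebra_simps)

context
  fixes y z
  assumes y: "b y y = 1" "b X1 y = 0" and z: "b z z = 1" "b X1 z = 0" and yz: "b y z = 0"
begin

lemma yz': "b z y = 0" "b y X1 = 0" "b z X1 = 0"
  using y z yz b_commute[of z y] b_commute[of y X1] b_commute[of z X1] by simp_all

text \<open>The pairs \<open>p\<close>, \<open>q\<close> multiply like the complex numbers p +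
  iq.\<close>

lemma rot_compose: "rot y z p q (rot y z p' q' v) = rot y z (p * p' - q * q') (p * q' + q * p') v"
  by (simp add: rot_def b_lin y z yz yz' algebra_simps)

lemma rot_isometry:
  assumes "p\<^sup>2 + q\<^sup>2 = 1"
  shows "b (rot y z p q v) (rot y z p q w) = b v w"
proof -
  have "b (rot y z p q v) (rot y z p q w) = b v w + (p\<^sup>2 + q\<^sup>2 - 1) * (b v y * b w y + b v z * b w z)"
    by (simp add: rot_def b_lin y z yz yz' b_commute[of y w] b_commute[of z w] power2_eq_square algebra_simps)
  then show ?thesis using assms by simp
qed

lemma det_rot_compose:
  "det (matrix (rot y z (p * p' - q * q') (p * q' + q * p'))) =
   det (matrix (rot y z p q)) * det (matrix (rot y z p' q'))"
proof -
  have "rot y z (p * p' - q * q') (p * q' + q * p') = rot y z p q \<circ> rot y z p' q'"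
    by (simp add: fun_eq_iff rot_compose)
  then show ?thesis
    by (simp add: matrix_compose linear_rot det_mul)
qed

text \<open>Every rotation is the square of the rotation by half the angle, which excludes the
  determinant \<open>-1\<close>.\<close>

lemma det_rot: "det (matrix (rot y z 0 1)) = 1" "det (matrix (rot y z (-1) 0)) = 1"
proof -
  let ?h = "sqrt (1/2)"
  have id: "rot y z 1 0 = id" by (simp add: rot_def fun_eq_iff)
  have 1: "det (matrix (rot y z 0 1)) = (det (matrix (rot y z ?h ?h)))\<^sup>2"
    using det_rot_compose[of ?h ?h ?h ?h] by (simp add: power2_eq_square)
  have 2: "det (matrix (rot y z (-1) 0)) = (det (matrix (rot y z 0 1)))\<^sup>2"
    using det_rot_compose[of 0 0 1 1] by (simp add: power2_eq_square)
  have "(det (matrix (rot y z (-1) 0)))\<^sup>2 = 1"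
    using det_rot_compose[of "-1" "-1" 0 0] by (simp add: id matrix_id_mat_1 power2_eq_square)
  moreover have sq1: "x = 1" if "x\<^sup>2 = 1" "x = y\<^sup>2" for x y :: real
  proof -
    have "x \<ge> 0" using that by simp
    then show ?thesis using that(1) power2_eq_1_iff[of x] by auto
  qed
  ultimately have *: "det (matrix (rot y z (-1) 0)) = 1"
    using 2 by blast
  show "det (matrix (rot y z (-1) 0)) = 1" by (rule *)
  show "det (matrix (rot y z 0 1)) = 1"
    using sq1[OF _ 1] * 2 by simp
qed

lemma rot_axis_rotation:
  assumes "p\<^sup>2 + q\<^sup>2 = 1" "det (matrix (rot y z p q)) = 1"
  shows "axis_rotation b X1 (rot y z p q)"
  unfolding axis_rotation_def
proof (intro conjI allI impI)
  show "rot y z p q X1 = X1" by (simp add: rot_def y z)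
  show "b X1 (rot y z p q v) = 0" if "b X1 v = 0" for v
    using that by (simp add: rot_def b_lin y z)
qed (use assms rot_isometry linear_rot in auto)

lemma c_rot:
  assumes "p\<^sup>2 + q\<^sup>2 = 1" "det (matrix (rot y z p q)) = 1"
  shows "c (rot y z p q u) (rot y z p q v) (rot y z p q w) = c u v w"
  unfolding c_def invariant[OF rot_axis_rotation[OF assms]] rot_isometry[OF assms(1)] ..

lemma rot_values: "rot y z p q X1 = X1" "rot y z 0 1 y = z" "rot y z 0 1 z = - y"
  "rot y z (-1) 0 y = - y" "rot y z (-1) 0 z = - z"
  by (simp_all add: rot_def y z yz yz' vec_eq_iff)

text \<open>The half turn reverses \<open>y\<close> and \<open>z\<close> and fixes
  \<open>X1\<close>, killing the terms of odd degree in \<open>y\<close>. The quarter turn sends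
  \<open>y\<close> to \<open>z\<close> and \<open>z\<close> to \<open>- y\<close>, which equates the
  two squares and makes the mixed term its own negative.\<close>

lemma c_unit: "c X1 X1 y = 0" "c X1 y z = 0" "c X1 y y = c X1 z z" "c y y y = 0"
proof -
  note half = c_rot[OF _ det_rot(2)] and quarter = c_rot[OF _ det_rot(1)]
  show "c X1 X1 y = 0" using half[of X1 X1 y] by (simp add: rot_values c_lin')
  show "c y y y = 0" using half[of y y y] by (simp add: rot_values c_lin c_lin')
  show "c X1 y y = c X1 z z" using quarter[of X1 y y] by (simp add: rot_values)
  show "c X1 y z = 0" using quarter[of X1 y z] c_commute(2)[of X1 z y] by (simp add: rot_values c_lin')
qed

end

lemma ex_perp: 
  obtains z where "b z z = 1" "b X1 z = 0" "b v z = 0"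
proof -
  have "linear (\<lambda>z. (b X1 z, b v z))"
    by (rule linearI) (simp_all add: b_lin)
  moreover have "DIM(real \<times> real) < DIM(real^'n)"
    using dim by simp
  ultimately obtain z where z: "z \<noteq> 0" "(b X1 z, b v z) = 0"
    by (rule linear_not_inj_pair)
  then show ?thesis
    using b_pos[OF z(1)] by (intro that[of "(1 / sqrt (b z z)) *\<^sub>R z"]) (simp_all add: b_lin prod_eq_iff field_simps)
qed

lemma normalize:
  assumes "v \<noteq> 0"
  obtains k y where "v = k *\<^sub>R y" "b y y = 1" "k \<noteq> 0"
  using b_pos[OF assms] by (intro that[of "sqrt (b v v)" "(1 / sqrt (b v v)) *\<^sub>R v"]) (simp_all add: b_lin field_simps)

lemma c_perp:
  assumes v: "b X1 v = 0"
  shows "c X1 X1 v = 0" "c v v v = 0"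
proof -
  have "c X1 X1 v = 0 \<and> c v v v = 0"
  proof (cases "v = 0")
    case False
    then obtain k y where k: "v = k *\<^sub>R y" "b y y = 1" "k \<noteq> 0" by (rule normalize)
    moreover obtain z where "b z z = 1" "b X1 z = 0" "b y z = 0" by (rule ex_perp)
    ultimately show ?thesis
      using c_unit(1,4)[of y z] v by (simp add: c_lin c_lin' b_lin)
  qed (simp add: c_zero)
  then show "c X1 X1 v = 0" "c v v v = 0" by auto
qed

text \<open>Polarization of the cubic form, which vanishes on the diagonal of the complement of the
  axis.\<close>

lemma c_perp3:
  assumes u: "b X1 u = 0" and v: "b X1 v = 0" and w: "b X1 w = 0"
  shows "c u v w = 0"
proof -
  have *: "c u u v = 0" if "b X1 u = 0" "b X1 v = 0" for u v
  proof -
    have "c (u + v) (u + v) (u + v) = 0" "c (u - v) (u - v) (u - v) = 0" "c u u u = 0" "c v v v = 0"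
      using that by (auto intro!: c_perp(2) simp: b_lin)
    moreover have "c u v u = c u u v" "c v u u = c u u v" "c v u v = c u v v" "c v v u = c u v v"
      using c_commute by metis+
    ultimately show ?thesis
      by (simp add: c_lin c_lin')
  qed
  have "c (u + v) (u + v) w = 0" "c u u w = 0" "c v v w = 0"
    using u v w by (auto intro!: * simp: b_lin)
  then show ?thesis
    using c_commute(1)[of u v w] by (simp add: c_lin c_lin')
qed

text \<open>\<open>- r\<close> is the common value of \<open>c X1 y y\<close> on unit vectors
  \<open>y\<close> orthogonal to the axis: quarter turns compare \<open>y\<close> with
  \<open>z0\<close>, and polarization gives the mixed terms. Apolarity in a frame through
  \<open>X1\<close> fixes the remaining value \<open>c X1 X1 X1\<close>.\<close>

lemma cubic_form:
  obtains r where "\<And>u v w. b (K u v) w = axis_cubic (real CARD('n)) r b X1 u v w"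
proof -
  obtain z0 where z0: "b z0 z0 = 1" "b X1 z0 = 0" "b X1 z0 = 0" by (rule ex_perp)
  define r where "r = - c X1 z0 z0"
  have orth: "c X1 z0 v = 0 \<and> c X1 v v = - r * b v v" if v: "b X1 v = 0" "b z0 v = 0" for v
  proof (cases "v = 0")
    case False
    then obtain k y where k: "v = k *\<^sub>R y" "b y y = 1" "k \<noteq> 0" by (rule normalize)
    then have "b X1 y = 0" "b z0 y = 0" using v by (simp_all add: b_lin)
    then show ?thesis
      using c_unit(2,3)[OF z0(1,2) k(2)] k by (simp add: c_lin' b_lin r_def)
  qed (simp add: c_zero b_lin)
  have sq: "c X1 v v = - r * b v v" if v: "b X1 v = 0" for v
  proof -
    define s where "s = b z0 v"
    define v' where "v' = v - s *\<^sub>R z0"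
    have "b X1 v' = 0" "b z0 v' = 0" using v z0 by (simp_all add: v'_def s_def b_lin)
    note o = orth[OF this]
    have "v = s *\<^sub>R z0 + v'" by (simp add: v'_def)
    then show ?thesis
      using o z0 c_commute(2)[of X1 v' z0] \<open>b z0 v' = 0\<close> b_commute[of v' z0]
      by (simp add: c_lin' b_lin r_def algebra_simps)
  qed
  have two: "c X1 v w = - r * b v w" if v: "b X1 v = 0" "b X1 w = 0" for v w
  proof -
    have "c X1 (v + w) (v + w) = - r * b (v + w) (v + w)"
      using v by (intro sq) (simp add: b_lin)
    then show ?thesis
      using sq[OF v(1)] sq[OF v(2)] c_commute(2)[of X1 w v] b_commute[of w v]
      by (simp add: c_lin' b_lin algebra_simps)
  qed
  define n where "n = real CARD('n)"
  have axis: "c X1 X1 X1 = (n - 1) * r"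
  proof -
    obtain Y and a :: 'n where Y: "orthonormal_frame b Y" "Y a = X1"
      using ex_orthonormal_frame[OF X1] by blast
    have "0 = (\<Sum>i\<in>UNIV. c X1 (Y i) (Y i))"
      using trace[OF Y(1), of X1] by (simp add: c_def)
    also have "\<dots> = c X1 X1 X1 + (\<Sum>i\<in>UNIV - {a}. c X1 (Y i) (Y i))"
      by (simp add: sum.remove[of UNIV a] Y(2))
    also have "(\<Sum>i\<in>UNIV - {a}. c X1 (Y i) (Y i)) = (\<Sum>i\<in>UNIV - {a}. - r)"
    proof (rule sum.cong)
      fix i assume "i \<in> UNIV - {a}"
      then have "b X1 (Y i) = 0" "b (Y i) (Y i) = 1"
        using Y by (auto simp: orthonormal_frame_def)
      then show "c X1 (Y i) (Y i) = - r" using sq by simp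
    qed simp
    also have "\<dots> = - (n - 1) * r"
      using dim by (simp add: n_def of_nat_diff algebra_simps)
    finally show ?thesis by (simp add: algebra_simps)
  qed
  have "c u v w = axis_cubic n r b X1 u v w" for u v w
  proof -
    define u' where "u' = u - b X1 u *\<^sub>R X1"
    define v' where "v' = v - b X1 v *\<^sub>R X1"
    define w' where "w' = w - b X1 w *\<^sub>R X1"
    have p: "b X1 u' = 0" "b X1 v' = 0" "b X1 w' = 0"
      by (simp_all add: u'_def v'_def w'_def b_lin X1)
    have q: "b X1 (t *\<^sub>R X1 + x) = t" if "b X1 x = 0" for t x
      using that by (simp add: b_lin X1)
    have z: "c X1 X1 x = 0" "c X1 x X1 = 0" "c x X1 X1 = 0" if "b X1 x = 0" for x
      using c_perp(1)[OF that] c_commute by metis+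
    have t: "c X1 x y = - r * b x y" "c x X1 y = - r * b x y" "c x y X1 = - r * b x y"
      if "b X1 x = 0" "b X1 y = 0" for x y
      using two[OF that] c_commute by metis+
    have b': "b x X1 = 0" if "b X1 x = 0" for x using that b_commute by simp
    have "c (t *\<^sub>R X1 + u') (t' *\<^sub>R X1 + v') (t'' *\<^sub>R X1 + w') =
        axis_cubic n r b X1 (t *\<^sub>R X1 + u') (t' *\<^sub>R X1 + v') (t'' *\<^sub>R X1 + w')" for t t' t''
      by (simp add: c_lin c_lin' z t c_perp3 p axis axis_cubic_def q b_lin b' X1 algebra_simps)
    from this[of "b X1 u" "b X1 v" "b X1 w"] show ?thesis
      by (simp add: u'_def v'_def w'_def)
  qed
  then show ?thesis using that by (simp add: c_def n_def)
qed

end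

section \<open>The structure equations of a Blaschke hypersurface in coordinates\<close>

lemma det_replace_row:
  fixes A :: "real^'n^'n"
  shows "det (\<chi> i. if i = k then (\<Sum>i\<in>UNIV. y i *\<^sub>R (A $ i)) else A $ i) = y k * det A"
proof -
  have r: "row i A = A $ i" for i
    by (simp add: row_def vec_eq_iff)
  show ?thesis
    using cramer_lemma_transpose[of k "\<chi> i. y i" A] by (simp only: r scalar_mult_eq_scaleR vec_lambda_beta)
qed

locale blaschke_chart =
  fixes V :: "(real^'n) set" and f \<xi> :: "real^'n \<Rightarrow> real^'n option" and l :: real
  assumes V: "open V" and immersion: "immersion_on V f" and normal: "affine_normal_on V f \<xi>"
    and positive: "\<And>x v. x \<in> V \<Longrightarrow> v \<noteq> 0 \<Longrightarrow> aff_form f \<xi> x v v > 0"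
    and l_nz: "l \<noteq> 0" and sphere: "\<And>x v. x \<in> V \<Longrightarrow> shape_op f \<xi> x v = l *\<^sub>R v"
    and dim: "CARD('n) \<ge> 3"
    and symmetry: "\<And>x. x \<in> V \<Longrightarrow> \<exists>X1. symmetry_axis f \<xi> x X1"
    and coeff_nonzero: "\<And>x X1 r. x \<in> V \<Longrightarrow> symmetry_axis f \<xi> x X1 \<Longrightarrow>
      symmetry_coeff f \<xi> x X1 r \<Longrightarrow> r \<noteq> 0"
begin

abbreviation "h \<equiv> aff_form f \<xi>"
abbreviation "G \<equiv> conn f \<xi>"

lemma smooth_f: "smooth_on V f" and smooth_\<xi>: "smooth_on V \<xi>"
  using immersion normal by (auto simp: immersion_on_def affine_normal_on_def)

text \<open>The moving frame as an endomorphism of the ambient space: components with respect to it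
  solve a square linear system, which makes them smooth.\<close>

definition M where
  "M x = (\<lambda>v :: real^'n option. fder f x (\<chi> i. v $ Some i) + v $ None *\<^sub>R \<xi> x)"

lemma M_vsnoc: "M x (vsnoc u t) = fder f x u + t *\<^sub>R \<xi> x"
  by (simp add: M_def vec_lambda_eta)

context
  fixes x assumes x: "x \<in> V"
begin

lemma linear_Df: "linear (fder f x)"
  by (rule smooth_on_linear_fder[OF smooth_f x])

lemmas Df_lin = linear_add[OF linear_Df] linear_cmul[OF linear_Df] linear_diff[OF linear_Df]
  linear_neg[OF linear_Df] linear_0[OF linear_Df]

lemma transversal: "fder f x v + t *\<^sub>R \<xi> x = 0 \<Longrightarrow> v = 0 \<and> t = 0"
proof -
  assume 0: "fder f x v + t *\<^sub>R \<xi> x = 0"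
  have "\<xi> x \<notin> range (fder f x)"
    using normal x by (auto simp: affine_normal_on_def)
  moreover have "\<xi> x = fder f x ((- 1 / t) *\<^sub>R v)" if "t \<noteq> 0"
  proof -
    have "t *\<^sub>R \<xi> x = - fder f x v"
      using 0 by (simp add: eq_neg_iff_add_eq_0 add.commute)
    then have "(1 / t) *\<^sub>R (t *\<^sub>R \<xi> x) = (1 / t) *\<^sub>R (- fder f x v)" by simp
    then show ?thesis using that by (simp add: Df_lin)
  qed
  ultimately have "t = 0" by blast
  moreover have "inj (fder f x)" using immersion x by (auto simp: immersion_on_def)
  ultimately show ?thesis
    using 0 linear_injective_0[OF linear_Df] by auto
qed

lemma linear_M: "linear (M x)"
proof (rule linearI)
  fix v w :: "real^'n option" and c :: real
  have "(\<chi> i. (v + w) $ Some i) = (\<chi> i. v $ Some i) + (\<chi> i. w $ Some i)"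
    "(\<chi> i. (c *\<^sub>R v) $ Some i) = c *\<^sub>R (\<chi> i. v $ Some i)"
    by (simp_all add: vec_eq_iff)
  then show "M x (v + w) = M x v + M x w" "M x (c *\<^sub>R v) = c *\<^sub>R M x v"
    by (simp_all add: M_def Df_lin algebra_simps)
qed

lemma inj_M: "inj (M x)"
  unfolding linear_injective_0[OF linear_M]
proof safe
  fix v assume "M x v = 0"
  then have "(\<chi> i. v $ Some i) = 0 \<and> v $ None = 0" unfolding M_def by (rule transversal)
  then show "v = 0" by (simp add: vec_option_eq_iff) (simp add: vec_eq_iff)
qed

lemma split_unique: "fder f x v + t *\<^sub>R \<xi> x = fder f x v' + t' *\<^sub>R \<xi> x \<Longrightarrow> v = v' \<and> t = t'"
  using transversal[of "v - v'" "t - t'"] by (simp add: Df_lin algebra_simps)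

lemma split_exists: "\<exists>v t. w = fder f x v + t *\<^sub>R \<xi> x"
proof -
  obtain z where "w = M x z"
    using linear_injective_imp_surjective[OF linear_M inj_M] by blast
  then show ?thesis unfolding M_def by blast
qed

lemma parts_unique:
  assumes "w = fder f x v + t *\<^sub>R \<xi> x"
  shows "tan_part f \<xi> x w = v" "trans_part f \<xi> x w = t"
  unfolding tan_part_def trans_part_def using split_unique assms by (blast intro!: the_equality)+

lemma parts: "w = fder f x (tan_part f \<xi> x w) + trans_part f \<xi> x w *\<^sub>R \<xi> x"
proof -
  obtain v t where *: "w = fder f x v + t *\<^sub>R \<xi> x"
    using split_exists by blast
  show ?thesis
    unfolding parts_unique[OF *] by (rule *)
qed

lemma gauss: "flat_deriv f x u v = fder f x (G x u v) + h x u v *\<^sub>R \<xi> x"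
  unfolding conn_def aff_form_def by (rule parts)

lemma linear_flat: "linear (flat_deriv f x u)" "linear (\<lambda>u. flat_deriv f x u v)"
proof -
  show "linear (flat_deriv f x u)"
    unfolding flat_deriv_def[abs_def]
    using smooth_on_linear_fder[OF smooth_f] by (intro linear_fder_field[OF V x] smooth_on_fder smooth_f) auto
  show "linear (\<lambda>u. flat_deriv f x u v)"
    unfolding flat_deriv_def by (rule smooth_on_linear_fder[OF smooth_on_fder[OF smooth_f] x])
qed

lemma flat_sym: "flat_deriv f x u v = flat_deriv f x v u"
  unfolding flat_deriv_def by (rule fder_fder_commute[OF V x smooth_f])

lemma G_sym: "G x u v = G x v u" and h_sym: "h x u v = h x v u"
  using flat_sym[of u v] by (simp_all add: conn_def aff_form_def)

lemma linear_parts: "linear (tan_part f \<xi> x)" "linear (trans_part f \<xi> x)"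
proof -
  have "tan_part f \<xi> x (w + w') = tan_part f \<xi> x w + tan_part f \<xi> x w'
      \<and> trans_part f \<xi> x (w + w') = trans_part f \<xi> x w + trans_part f \<xi> x w'" for w w'
    by (rule split_unique) (use parts[of w] parts[of w'] parts[of "w + w'"] in \<open>simp add: Df_lin algebra_simps\<close>)
  moreover have "tan_part f \<xi> x (c *\<^sub>R w) = c *\<^sub>R tan_part f \<xi> x w
      \<and> trans_part f \<xi> x (c *\<^sub>R w) = c * trans_part f \<xi> x w" for c w
    by (rule split_unique) (use arg_cong[OF parts[of w], of "\<lambda>y. c *\<^sub>R y"] parts[of "c *\<^sub>R w"] in \<open>simp add: Df_lin algebra_simps\<close>)
  ultimately show "linear (tan_part f \<xi> x)" "linear (trans_part f \<xi> x)"
    by (auto intro!: linearI)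
qed

lemma linear_G: "linear (G x u)" and linear_h: "linear (h x u)"
  using linear_compose[OF linear_flat(1) linear_parts(1)] linear_compose[OF linear_flat(1) linear_parts(2)]
  by (simp_all add: conn_def[abs_def] aff_form_def[abs_def] o_def)

lemma positive_form_h: "positive_form (h x)"
  by (intro positive_form.intro linear_h h_sym positive x)

end

lemma smooth_parts:
  assumes w: "smooth_on V w"
  shows "smooth_on V (\<lambda>x. tan_part f \<xi> x (w x))" "smooth_on V (\<lambda>x. trans_part f \<xi> x (w x))"
proof -
  define z where "z x = vsnoc (tan_part f \<xi> x (w x)) (trans_part f \<xi> x (w x))" for x
  have "smooth_on V z"
  proof (rule smooth_on_linear_system[OF V _ w])
    fix i j
    have "smooth_on V (\<lambda>x. M x (axis j 1))"
      unfolding M_def by (intro smooth_on_add smooth_on_scaleR smooth_on_const smooth_on_fder smooth_f smooth_\<xi> V)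
    then show "smooth_on V (\<lambda>x. matrix (M x) $ i $ j)"
      unfolding matrix_def by (simp add: smooth_on_vec_nth[OF V])
  next
    fix x assume x: "x \<in> V"
    show "det (matrix (M x)) \<noteq> 0"
      using det_nz_iff_inj[OF linear_M[OF x]] inj_M[OF x] by blast
    show "matrix (M x) *v z x = w x"
      using parts[OF x, of "w x"] matrix_works[OF linear_M[OF x, folded linear_matrix_vector_mul_eq]]
      by (simp add: z_def M_vsnoc)
  qed
  note this[THEN smooth_on_vec_nth[OF V]]
  from this[of None] this[of "Some _"]
  show "smooth_on V (\<lambda>x. tan_part f \<xi> x (w x))" "smooth_on V (\<lambda>x. trans_part f \<xi> x (w x))"
    by (auto simp: z_def intro: smooth_on_vec[OF V])
qed

lemma smooth_flat: "smooth_on V (\<lambda>x. flat_deriv f x u v)"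
  unfolding flat_deriv_def by (intro smooth_on_fder smooth_f)

lemma smooth_G: "smooth_on V (\<lambda>x. G x u v)" and smooth_h: "smooth_on V (\<lambda>x. h x u v)"
  unfolding conn_def aff_form_def by (intro smooth_parts smooth_flat)+

text \<open>Minus half the covariant derivative of \<open>h\<close>; \<open>diff_tensor_C3\<close>
  identifies it with the cubic form of the difference tensor.\<close>

definition C3 where
  "C3 x w u v = - (fder (\<lambda>y. h y u v) x w - h x (G x w u) v - h x u (G x w v)) / 2"

definition \<tau> where "\<tau> x u = trans_part f \<xi> x (fder \<xi> x u)"

section \<open>The volume of a frame: vanishing of \<open>\<tau>\<close> and apolarity\<close>

context
  fixes x Y assumes x: "x \<in> V" and Y: "orthonormal_frame (h x) Y"
begin

interpretation positive_form "h x" by (rule positive_form_h[OF x])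

lemma Y_expand: "v = (\<Sum>i\<in>UNIV. h x v (Y i) *\<^sub>R Y i)"
  by (rule orthonormal_frame_expand[OF Y])

lemma frame_Y: "tangent_frame Y"
proof -
  have "h x (Y i) (Y i) \<noteq> h x (Y i) (Y j)" if "i \<noteq> j" for i j
    using Y that by (simp add: orthonormal_frame_def)
  then have inj: "inj Y" unfolding inj_def by metis
  moreover have "span (range Y) = UNIV"
  proof -
    have "v \<in> span (range Y)" for v
      by (subst Y_expand) (rule span_sum, rule span_scale, rule span_base, rule rangeI)
    then show ?thesis by blast
  qed
  then have "independent (range Y)"
    by (intro card_le_dim_spanning[of _ UNIV]) (simp_all add: card_image[OF inj])
  ultimately show ?thesis by (simp add: tangent_frame_def)
qed

lemma vol_sq: "y \<in> V \<Longrightarrow> (vol_form f \<xi> y Y)\<^sup>2 = \<bar>det (\<chi> i j. h y (Y i) (Y j))\<bar>"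
  using normal frame_Y by (auto simp: affine_normal_on_def)

lemma gram_Y: "(\<chi> i j. h x (Y i) (Y j)) = mat 1"
  using Y by (simp add: orthonormal_frame_def mat_def vec_eq_iff)

lemma vol_Y: "(vol_form f \<xi> x Y)\<^sup>2 = 1" "vol_form f \<xi> x Y \<noteq> 0"
  using vol_sq[OF x] unfolding gram_Y by auto

definition "W \<equiv> (\<chi> j. case j of None \<Rightarrow> \<xi> x | Some i \<Rightarrow> fder f x (Y i))"

lemma split_W:
  "fder f x v + t *\<^sub>R \<xi> x = (\<Sum>j\<in>UNIV. (case j of None \<Rightarrow> t | Some i \<Rightarrow> h x v (Y i)) *\<^sub>R (W $ j))"
proof -
  have "fder f x v = (\<Sum>i\<in>UNIV. h x v (Y i) *\<^sub>R fder f x (Y i))"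
    by (subst (1) Y_expand[of v]) (simp add: linear_sum[OF linear_Df[OF x]] Df_lin[OF x])
  then show ?thesis by (simp add: sum_option W_def add.commute)
qed

lemma det_W_replace:
  "det (\<chi> j. if j = k then fder f x v + t *\<^sub>R \<xi> x else W $ j) =
     (case k of None \<Rightarrow> t | Some i \<Rightarrow> h x v (Y i)) * vol_form f \<xi> x Y"
  unfolding split_W det_replace_row by (simp add: W_def vol_form_def)

lemma vol_replace: "vol_form f \<xi> x (Y(i := v)) = h x v (Y i) * vol_form f \<xi> x Y"
proof -
  have "(\<chi> j. case j of None \<Rightarrow> \<xi> x | Some l \<Rightarrow> fder f x ((Y(i := v)) l)) =
      (\<chi> j. if j = Some i then fder f x v + 0 *\<^sub>R \<xi> x else W $ j)"
    by (auto simp: vec_eq_iff W_def split: option.split)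
  then have "vol_form f \<xi> x (Y(i := v)) = det (\<chi> j. if j = Some i then fder f x v + 0 *\<^sub>R \<xi> x else W $ j)"
    unfolding vol_form_def by (rule arg_cong)
  then show ?thesis
    unfolding det_W_replace by simp
qed

text \<open>\<open>Y\<close> consists of constant coordinate vectors and is orthonormal only at
  \<open>x\<close>. When one row is replaced by its derivative and expanded in the frame, only its
  own coefficient survives: the diagonal entries of the connection, and \<open>\<tau>\<close> for
  the row of \<open>\<xi>\<close>.\<close>

lemma dvol:
  "((\<lambda>y. vol_form f \<xi> y Y) has_derivative
     (\<lambda>u. ((\<Sum>i\<in>UNIV. h x (G x u (Y i)) (Y i)) + \<tau> x u) * vol_form f \<xi> x Y)) (at x)"
proof -
  define A where "A y = (\<chi> j. case j of None \<Rightarrow> \<xi> y | Some i \<Rightarrow> fder f y (Y i))" for y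
  define A' where "A' j u = (case j of None \<Rightarrow> fder \<xi> x u | Some i \<Rightarrow> flat_deriv f x u (Y i))" for j u
  have row: "((\<lambda>y. A y $ j) has_derivative A' j) (at x)" for j
    using smooth_on_has_derivative[OF smooth_\<xi> x] smooth_on_has_derivative[OF smooth_on_fder[OF smooth_f] x]
    by (cases j) (simp_all add: A_def A'_def[abs_def] flat_deriv_def[abs_def])
  have "((\<lambda>y. A y $ i $ j) has_derivative (\<lambda>u. A' i u $ j)) (at x)" for i j
    by (rule bounded_linear.has_derivative[OF bounded_linear_vec_nth row])
  note has_derivative_det[OF this]
  moreover have "(\<Sum>i\<in>UNIV. det (\<chi> l. if l = i then (\<chi> j. A' i u $ j) else A x $ l)) =
    ((\<Sum>i\<in>UNIV. h x (G x u (Y i)) (Y i)) + \<tau> x u) * vol_form f \<xi> x Y" for u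
  proof -
    have AW: "A x = W" by (simp add: A_def W_def)
    have A'_Some: "A' (Some i) u = fder f x (G x u (Y i)) + h x u (Y i) *\<^sub>R \<xi> x" for i
      by (simp add: A'_def gauss[OF x])
    have A'_None: "A' None u = fder f x (tan_part f \<xi> x (fder \<xi> x u)) + \<tau> x u *\<^sub>R \<xi> x"
      using parts[OF x, of "fder \<xi> x u"] by (simp add: A'_def \<tau>_def)
    have 1: "det (\<chi> l. if l = Some i then A' (Some i) u else A x $ l) = h x (G x u (Y i)) (Y i) * vol_form f \<xi> x Y" for i
      unfolding A'_Some AW det_W_replace by simp
    have 2: "det (\<chi> l. if l = None then A' None u else A x $ l) = \<tau> x u * vol_form f \<xi> x Y"
      unfolding A'_None AW det_W_replace by simp
    show ?thesis
      unfolding sum_option vec_lambda_eta 1 2 by (simp add: distrib_right sum_distrib_right)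
  qed
  ultimately show ?thesis by (simp add: vol_form_def A_def[symmetric])
qed

text \<open>The trace of the connection cancels in the covariant derivative of the volume form,
  which leaves \<open>\<tau>\<close> times this form.\<close>

lemma tau_zero: "\<tau> x u = 0"
proof -
  have "cov_deriv_vol f \<xi> x u Y = 0"
    using normal x by (auto simp: affine_normal_on_def)
  then have "\<tau> x u * vol_form f \<xi> x Y = 0"
    by (simp add: cov_deriv_vol_def fder_eq[OF dvol] vol_replace flip: sum_distrib_right)
       blast
  then show ?thesis using vol_Y by simp
qed

text \<open>The volume normalization is differentiated along the constant frame. The squared volume
  contributes twice the trace of the connection, the Gram determinant the trace of the derivative of
  \<open>h\<close>; their difference is a multiple of the trace of \<open>C3\<close>.\<close>

lemma apolarity_frame: "(\<Sum>i\<in>UNIV. C3 x u (Y i) (Y i)) = 0"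
proof -
  define g where "g y = det (\<chi> i j. h y (Y i) (Y j))" for y
  have dh: "((\<lambda>y. (\<chi> i j. h y (Y i) (Y j)) $ i $ j) has_derivative fder (\<lambda>y. h y (Y i) (Y j)) x) (at x)" for i j
    using smooth_on_has_derivative[OF smooth_h x] by simp
  have "det (\<chi> l. if l = i then (\<chi> j. fder (\<lambda>y. h y (Y i) (Y j)) x u) else mat 1 $ l) =
      fder (\<lambda>y. h y (Y i) (Y i)) x u" for i u
  proof -
    have "(\<chi> j. fder (\<lambda>y. h y (Y i) (Y j)) x u) = (\<Sum>j\<in>UNIV. fder (\<lambda>y. h y (Y i) (Y j)) x u *\<^sub>R (mat 1 $ j))"
      by (simp add: vec_eq_iff mat_def if_distrib[of "(*) _"] cong: if_cong)
    then show ?thesis by (simp only: det_replace_row det_I mult_1_right)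
  qed
  then have dg: "(g has_derivative (\<lambda>u. \<Sum>i\<in>UNIV. fder (\<lambda>y. h y (Y i) (Y i)) x u)) (at x)"
    using has_derivative_det[OF dh] unfolding gram_Y g_def[abs_def] by simp
  have g1: "g x = 1" unfolding g_def gram_Y by simp
  \<comment> \<open>The determinant is 1 at \<open>x\<close>; on this neighbourhood it is positive,
    so the absolute value in the normalization disappears.\<close>
  have "open (g -` {0<..} \<inter> V)"
  proof -
    have "continuous_on V g"
      unfolding g_def[abs_def]
      by (rule C_diff_imp_continuous_on[of 0], rule C_diff_det[OF V]) (simp, intro smooth_on_continuous_on smooth_h)
    then show ?thesis
      using continuous_on_open_vimage[OF V] open_greaterThan by blast
  qed
  moreover have "x \<in> g -` {0<..} \<inter> V" using x g1 by simp
  ultimately have "((\<lambda>y. (vol_form f \<xi> y Y)\<^sup>2) has_derivative (\<lambda>u. \<Sum>i\<in>UNIV. fder (\<lambda>y. h y (Y i) (Y i)) x u)) (at x)"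
    by (rule has_derivative_transform_within_open[OF dg]) (simp add: vol_sq g_def)
  moreover have "((\<lambda>y. (vol_form f \<xi> y Y)\<^sup>2) has_derivative
      (\<lambda>u. 2 * (\<Sum>i\<in>UNIV. h x (G x u (Y i)) (Y i)))) (at x)"
    by (rule has_derivative_eq_rhs[OF has_derivative_power[OF dvol, of 2]])
       (use vol_Y(1) in \<open>simp add: fun_eq_iff tau_zero power2_eq_square\<close>)
  ultimately have "(\<Sum>i\<in>UNIV. fder (\<lambda>y. h y (Y i) (Y i)) x u) = 2 * (\<Sum>i\<in>UNIV. h x (G x u (Y i)) (Y i))"
    by (rule has_derivative_unique[THEN fun_cong])
  then have "(\<Sum>i\<in>UNIV. fder (\<lambda>y. h y (Y i) (Y i)) x u - 2 * h x (G x u (Y i)) (Y i)) = 0"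
    by (simp add: sum_subtractf sum_distrib_left)
  moreover have C: "C3 x u (Y i) (Y i) = (- 1 / 2) * (fder (\<lambda>y. h y (Y i) (Y i)) x u - 2 * h x (G x u (Y i)) (Y i))" for i
    by (simp add: C3_def h_sym[OF x, of "Y i"] field_simps)
  ultimately show ?thesis
    unfolding C sum_distrib_left[symmetric] by simp
qed

end

lemma axis_unit: "symmetry_axis f \<xi> x X1 \<Longrightarrow> h x X1 X1 = 1"
  by (simp add: symmetry_axis_def)

lemma ex_frame:
  assumes x: "x \<in> V"
  obtains Y where "orthonormal_frame (h x) Y"
  using positive_form.ex_orthonormal_frame[OF positive_form_h[OF x]] symmetry[OF x] axis_unit by metis

lemma fder_\<xi>:
  assumes x: "x \<in> V"
  shows "fder \<xi> x u = - l *\<^sub>R fder f x u"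
proof -
  obtain Y where "orthonormal_frame (h x) Y" by (rule ex_frame[OF x])
  then have "\<tau> x u = 0" by (rule tau_zero[OF x])
  moreover have "tan_part f \<xi> x (fder \<xi> x u) = - (l *\<^sub>R u)"
    using sphere[OF x, of u] by (simp add: shape_op_def eq_neg_iff_add_eq_0 add.commute neg_eq_iff_add_eq_0)
  ultimately show ?thesis
    using parts[OF x, of "fder \<xi> x u"] by (simp add: \<tau>_def Df_lin[OF x])
qed

text \<open>The transversal part of the equality of second derivatives; the derivative of
  \<open>\<xi>\<close> contributes nothing to it because \<open>\<tau> = 0\<close>. It will give the
  symmetry of \<open>C3\<close> in its first two arguments.\<close>

lemma codazzi_h:
  assumes x: "x \<in> V"
  shows "fder (\<lambda>y. h y u v) x w + h x w (G x u v) = fder (\<lambda>y. h y w v) x u + h x u (G x w v)"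
proof -
  have *: "fder (\<lambda>y. fder (\<lambda>y. fder f y v) y u) x w =
    fder f x (G x w (G x u v) + fder (\<lambda>y. G y u v) x w - (l * h x u v) *\<^sub>R w)
    + (h x w (G x u v) + fder (\<lambda>y. h y u v) x w) *\<^sub>R \<xi> x" for u w
  proof -
    have 1: "((\<lambda>y. fder f y (G y u v)) has_derivative
      (\<lambda>w. flat_deriv f x w (G x u v) + fder f x (fder (\<lambda>y. G y u v) x w))) (at x)"
      unfolding flat_deriv_def
      by (rule has_derivative_linear_field[OF V x linear_Df])
         (auto intro: smooth_on_fder smooth_f smooth_on_has_derivative[OF smooth_G x])
    have 2: "((\<lambda>y. h y u v *\<^sub>R \<xi> y) has_derivative
       (\<lambda>w. h x u v *\<^sub>R fder \<xi> x w + fder (\<lambda>y. h y u v) x w *\<^sub>R \<xi> x)) (at x)"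
      by (intro has_derivative_scaleR smooth_on_has_derivative[OF _ x] smooth_h smooth_\<xi>)
    have "fder (\<lambda>y. fder (\<lambda>y. fder f y v) y u) x = fder (\<lambda>y. fder f y (G y u v) + h y u v *\<^sub>R \<xi> y) x"
      by (rule fder_cong[OF V x]) (use gauss in \<open>simp add: flat_deriv_def\<close>)
    then show ?thesis
      unfolding fder_eq[OF has_derivative_add[OF 1 2]]
      by (simp add: gauss[OF x] fder_\<xi>[OF x] Df_lin[OF x] algebra_simps)
  qed
  show ?thesis
    using fder_fder_commute[OF V x smooth_on_fder[OF smooth_f], of v u w]
    unfolding * using split_unique[OF x] by (metis add.commute)
qed

section \<open>The difference tensor and its cubic form\<close>

context
  fixes x assumes x: "x \<in> V"
begin

interpretation positive_form "h x" by (rule positive_form_h[OF x])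

lemma C3_commute: "C3 x u v w = C3 x v u w" "C3 x u v w = C3 x u w v"
proof -
  show "C3 x u v w = C3 x v u w"
    using codazzi_h[OF x, of v w u] G_sym[OF x, of u v] b_commute[of u "G x v w"] b_commute[of v "G x u w"]
    by (simp add: C3_def)
  have "fder (\<lambda>y. h y v w) x = fder (\<lambda>y. h y w v) x"
    by (rule fder_cong[OF V x]) (rule h_sym)
  then show "C3 x u v w = C3 x u w v"
    using b_commute by (simp add: C3_def)
qed

lemma linear_C3: "linear (C3 x u v)"
proof -
  have "linear (\<lambda>w. fder (\<lambda>y. h y v w) x u)"
    using linear_h by (intro linear_fder_field[OF V x] smooth_h) auto
  from linear_add[OF this] linear_cmul[OF this] show ?thesis
    using linear_add[OF linear_G[OF x]] linear_cmul[OF linear_G[OF x]]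
    by (intro linearI) (simp_all add: C3_def b_lin algebra_simps diff_divide_distrib add_divide_distrib)
qed

text \<open>The difference of two candidates, lowered by \<open>h\<close>, is symmetric in the first
  two arguments and skew in the last two, hence zero.\<close>

lemma levi_civita_unique:
  assumes "bilinear \<Gamma>" "\<And>u v. \<Gamma> u v = \<Gamma> v u"
    "\<And>u v w. fder (\<lambda>y. h y v w) x u = h x (\<Gamma> u v) w + h x v (\<Gamma> u w)"
  shows "levi_civita h x = \<Gamma>"
  unfolding levi_civita_def
proof (rule the_equality)
  fix \<Delta> assume D: "bilinear \<Delta> \<and> (\<forall>u v. \<Delta> u v = \<Delta> v u) \<and>
    (\<forall>u v w. fder (\<lambda>y. h y v w) x u = h x (\<Delta> u v) w + h x v (\<Delta> u w))"
  define s where "s u v w = h x (\<Delta> u v) w - h x (\<Gamma> u v) w" for u v w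
  have sym: "s u v w = s v u w" for u v w
    using D assms(2) by (metis s_def)
  have skew: "s u v w = - s u w v" for u v w
    using D assms(3)[of v w u] b_commute[of v] by (simp add: s_def)
  have "s u v w = 0" for u v w
    using sym[of u v w] skew[of v u w] sym[of v w u] skew[of w v u] sym[of w u v] skew[of u w v] by linarith
  then have "\<Delta> u v = \<Gamma> u v" for u v
    by (intro b_nondegenerate) (simp add: s_def)
  then show "\<Delta> = \<Gamma>" by (simp add: fun_eq_iff)
qed (use assms in auto)

text \<open>A tensor \<open>K\<close> with cubic form \<open>C3\<close> is built from a frame, and
  \<open>G - K\<close> is checked to be torsion-free and metric; it is therefore the Levi-Civita
  connection.\<close>

lemma diff_tensor_C3: "h x (diff_tensor f \<xi> x u v) w = C3 x u v w"
proof -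
  obtain Y where Y: "orthonormal_frame (h x) Y" by (rule ex_frame[OF x])
  define K where "K u v = (\<Sum>i\<in>UNIV. C3 x u v (Y i) *\<^sub>R Y i)" for u v
  have hK: "h x (K u v) w = C3 x u v w" for u v w
  proof -
    have "C3 x u v w = C3 x u v (\<Sum>i\<in>UNIV. h x w (Y i) *\<^sub>R Y i)"
      using orthonormal_frame_expand[OF Y, of w] by simp
    then show ?thesis
      by (simp add: K_def b_sum b_lin linear_sum[OF linear_C3] linear_cmul[OF linear_C3] b_commute[of w] mult.commute)
  qed
  have Kc: "K u v = K v u" for u v
    using C3_commute by (simp add: K_def)
  have lK: "linear (K u)" for u
  proof (rule linearI)
    show "K u (v + w) = K u v + K u w" for v w
      by (rule b_nondegenerate)
         (simp add: hK b_lin C3_commute(2)[of u "_ + _"] C3_commute(2)[of u v] C3_commute(2)[of u w] linear_add[OF linear_C3])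
    show "K u (k *\<^sub>R v) = k *\<^sub>R K u v" for k v
      by (rule b_nondegenerate)
         (simp add: hK b_lin C3_commute(2)[of u "_ *\<^sub>R _"] C3_commute(2)[of u v] linear_cmul[OF linear_C3])
  qed
  have "levi_civita h x = (\<lambda>u v. G x u v - K u v)"
  proof (rule levi_civita_unique)
    have "linear (\<lambda>v. G x u v - K u v)" for u
      by (intro linear_compose_sub lK linear_G[OF x])
    moreover have "(\<lambda>u. G x u v - K u v) = (\<lambda>u. G x v u - K v u)" for v
      using G_sym[OF x] Kc by auto
    ultimately show "bilinear (\<lambda>u v. G x u v - K u v)"
      unfolding bilinear_def by simp
    show "G x u v - K u v = G x v u - K v u" for u v
      using G_sym[OF x] Kc by auto
    show "fder (\<lambda>y. h y v w) x u = h x (G x u v - K u v) w + h x v (G x u w - K u w)" for u v w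
      by (simp add: b_lin hK b_commute[of v "K u w"] C3_commute(2)[of u w v]) (simp add: C3_def field_simps)
  qed
  then have "diff_tensor f \<xi> x = K"
    by (simp add: diff_tensor_def[abs_def] fun_eq_iff)
  then show ?thesis using hK by simp
qed

abbreviation "K \<equiv> diff_tensor f \<xi> x"

lemma bilinear_K: "bilinear K"
proof -
  have 1: "linear (\<lambda>v. K u v)" for u
  proof (rule linearI)
    show "K u (v + w) = K u v + K u w" for v w
      by (rule b_nondegenerate)
         (simp add: diff_tensor_C3 b_lin C3_commute(2)[of u "_ + _"] C3_commute(2)[of u v] C3_commute(2)[of u w] linear_add[OF linear_C3])
    show "K u (k *\<^sub>R v) = k *\<^sub>R K u v" for k v
      by (rule b_nondegenerate)
         (simp add: diff_tensor_C3 b_lin C3_commute(2)[of u "_ *\<^sub>R _"] C3_commute(2)[of u v] linear_cmul[OF linear_C3])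
  qed
  moreover have "(\<lambda>u. K u v) = (\<lambda>u. K v u)" for v
    by (rule ext, rule b_nondegenerate) (simp add: diff_tensor_C3 C3_commute(1)[of _ v])
  ultimately show ?thesis
    unfolding bilinear_def by simp
qed

text \<open>The \<open>r\<close> supplied by invariance is shown to satisfy
  \<open>symmetry_coeff\<close>, so the standing assumption on that function excludes
  \<open>r = 0\<close>.\<close>

lemma cubic_form_axis:
  assumes ax: "symmetry_axis f \<xi> x X1"
  obtains r where "r \<noteq> 0" "\<And>u v w. C3 x u v w = axis_cubic (real CARD('n)) r (h x) X1 u v w"
proof -
  interpret invariant_cubic "h x" K X1
  proof
    show "bilinear K" by (rule bilinear_K)
    show "K u v = K v u" for u v
      by (rule b_nondegenerate) (simp add: diff_tensor_C3 C3_commute(1)[of u v])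
    show "h x (K u v) w = h x (K u w) v" for u v w
      by (simp add: diff_tensor_C3 C3_commute(2)[of u v])
    show "K (g v) (g w) = g (K v w)" if "axis_rotation (h x) X1 g" for g v w
      using ax that by (auto simp: symmetry_axis_def)
    show "(\<Sum>i\<in>UNIV. h x (K u (Y i)) (Y i)) = 0" if "orthonormal_frame (h x) Y" for u Y
      using apolarity_frame[OF x that] by (simp add: diff_tensor_C3)
  qed (use ax dim axis_unit in auto)
  obtain r where r: "\<And>u v w. h x (K u v) w = axis_cubic (real CARD('n)) r (h x) X1 u v w"
    by (rule cubic_form) (rule that)
  have "symmetry_coeff f \<xi> x X1 r"
    unfolding symmetry_coeff_def
  proof (intro allI impI conjI)
    fix Y and a i j :: 'n assume Y: "orthonormal_frame (h x) Y" "Y a = X1"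
    have on: "h x (Y i) (Y j) = (if i = j then 1 else 0)" for i j
      using Y by (simp add: orthonormal_frame_def)
    have X1Y: "h x X1 (Y i) = (if i = a then 1 else 0)" "h x (Y i) X1 = (if i = a then 1 else 0)" for i
      using on[of a i] on[of i a] Y(2) by auto
    show "K X1 X1 = (real (CARD('n) - 1) * r) *\<^sub>R X1"
      by (rule b_nondegenerate)
         (use dim in \<open>simp add: r axis_cubic_def b_lin axis_unit[OF ax] of_nat_diff algebra_simps\<close>)
    show "K X1 (Y i) = (- r) *\<^sub>R Y i" if "i \<noteq> a"
      by (rule b_nondegenerate)
         (use that in \<open>simp add: r axis_cubic_def b_lin axis_unit[OF ax] X1Y algebra_simps\<close>)
    show "K (Y i) (Y j) = (if i = j then (- r) *\<^sub>R X1 else 0)" if "i \<noteq> a" "j \<noteq> a"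
      by (rule b_nondegenerate)
         (use that in \<open>simp add: r axis_cubic_def b_lin X1Y on algebra_simps\<close>)
  qed
  then have "r \<noteq> 0" using coeff_nonzero[OF x ax] by blast
  with r show ?thesis
    using that by (simp add: diff_tensor_C3)
qed

end

end

section \<open>The axis as a smooth vector field\<close>

lemma trace_rank_one:
  fixes \<phi> :: "'a::euclidean_space \<Rightarrow> real"
  assumes "linear \<phi>"
  shows "(\<Sum>b\<in>Basis. \<phi> b * (z \<bullet> b)) = \<phi> z"
  using linear_field_expand[OF assms, of z] by (simp add: mult.commute)

context blaschke_chart
begin

lemma smooth_C3: "smooth_on V (\<lambda>x. C3 x u v w)"
proof -
  have "smooth_on V (\<lambda>x. h x a (G x b c))" "smooth_on V (\<lambda>x. h x (G x b c) a)" for a b c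
  proof -
    show 1: "smooth_on V (\<lambda>x. h x a (G x b c))"
      by (rule smooth_on_linear_field[OF V linear_h smooth_h smooth_G])
    show "smooth_on V (\<lambda>x. h x (G x b c) a)"
      by (rule smooth_on_cong[OF V _ 1]) (rule h_sym)
  qed
  then show ?thesis
    unfolding C3_def
    by (intro smooth_on_divide smooth_on_minus smooth_on_diff smooth_on_const smooth_on_fder smooth_h V) auto
qed

text \<open>The pairings of \<open>z\<close> with the standard basis form a linear system whose
  matrix is the Gram matrix of \<open>h\<close>, invertible by positivity.\<close>

lemma smooth_on_riesz:
  assumes \<phi>: "\<And>w. smooth_on V (\<lambda>x. \<phi> x w)" and z: "\<And>x w. x \<in> V \<Longrightarrow> h x (z x) w = \<phi> x w"
  shows "smooth_on V z"
proof -
  define H where "H x = (\<chi> i j. h x (axis i 1) (axis j 1))" for x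
  have Hv: "(H x *v v) $ i = h x (axis i 1) v" if x: "x \<in> V" for x v i
  proof -
    interpret positive_form "h x" by (rule positive_form_h[OF x])
    have "h x (axis i 1) v = h x (axis i 1) (\<Sum>j\<in>UNIV. (v $ j) *\<^sub>R axis j 1)"
      using basis_expansion[of v] by (simp add: scalar_mult_eq_scaleR)
    then show ?thesis
      by (simp add: H_def matrix_vector_mult_def b_sum b_lin mult.commute)
  qed
  show ?thesis
  proof (rule smooth_on_linear_system[OF V])
    show "smooth_on V (\<lambda>x. H x $ i $ j)" for i j
      by (simp add: H_def smooth_h)
    show "smooth_on V (\<lambda>x. \<chi> i. \<phi> x (axis i 1))"
      by (rule smooth_on_vec[OF V]) (simp add: \<phi>)
    fix x assume x: "x \<in> V"
    interpret positive_form "h x" by (rule positive_form_h[OF x])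
    show "H x *v z x = (\<chi> i. \<phi> x (axis i 1))"
      by (simp add: vec_eq_iff Hv[OF x] z[OF x, symmetric] b_commute[of _ "z x"])
    have "v = 0" if "H x *v v = 0" for v
    proof (rule ccontr)
      assume "v \<noteq> 0"
      have "h x v v = h x v (\<Sum>j\<in>UNIV. (v $ j) *\<^sub>R axis j 1)"
        using basis_expansion[of v] by (simp add: scalar_mult_eq_scaleR)
      also have "\<dots> = (\<Sum>j\<in>UNIV. v $ j * (H x *v v) $ j)"
        by (simp add: b_sum b_lin Hv[OF x] b_commute[of v])
      finally show False using that b_pos[OF \<open>v \<noteq> 0\<close>] by simp
    qed
    then have "inj ((*v) (H x))"
      by (subst linear_injective_0) (auto simp: matrix_vector_mul_linear)
    then show "det (H x) \<noteq> 0"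
      using det_nz_iff_inj[of "(*v) (H x)"] by (simp add: matrix_vector_mul_linear)
  qed
qed

lemma smooth_K: "smooth_on V (\<lambda>x. K x u v)"
  by (rule smooth_on_riesz[OF smooth_C3 diff_tensor_C3])

lemma linear_K: "x \<in> V \<Longrightarrow> linear (K x u)"
  using bilinear_K[of x] by (simp add: bilinear_def)

text \<open>The trace of \<open>K x u\<close> composed with \<open>K x v\<close>, computed in the
  standard basis. It is defined without choosing an axis and is therefore smooth.\<close>

definition trace_form where "trace_form x u v = (\<Sum>b\<in>Basis. K x u (K x v b) \<bullet> b)"

lemma smooth_trace_form: "smooth_on V (\<lambda>x. trace_form x u v)"
  unfolding trace_form_def
  by (intro smooth_on_sum smooth_on_inner smooth_on_const V smooth_on_linear_field[OF V linear_K smooth_K] smooth_K)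

context
  fixes x X1 r assumes x: "x \<in> V" and X1: "h x X1 X1 = 1"
    and C3: "\<And>u v w. C3 x u v w = axis_cubic (real CARD('n)) r (h x) X1 u v w"
begin

interpretation positive_form "h x" by (rule positive_form_h[OF x])

lemma K_axis: "K x u v = ((real CARD('n) + 2) * r * h x X1 u * h x X1 v - r * h x u v) *\<^sub>R X1
    - (r * h x X1 u) *\<^sub>R v - (r * h x X1 v) *\<^sub>R u"
  by (rule b_nondegenerate)
     (simp add: diff_tensor_C3[OF x] C3 axis_cubic_def b_lin algebra_simps)

text \<open>Expanding \<open>K x v b\<close> reduces everything to traces of rank one operators and
  of \<open>K x u\<close>, which is trace-free. The eigenvalues relative to \<open>h\<close> are
  n(n-1)r^2 on the axis and 2r^2 on its complement; they differ because (n-2)(n+1) is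
  nonzero.\<close>

lemma trace_form_axis:
  "trace_form x u v = r\<^sup>2 * ((real CARD('n) - 2) * (real CARD('n) + 1) * h x X1 u * h x X1 v + 2 * h x u v)"
proof -
  define n where "n = real CARD('n)"
  have DIM: "DIM(real^'n) = CARD('n)" by simp
  note tr = trace_rank_one[OF b_linear]
  have tr': "(\<Sum>b\<in>Basis. z \<bullet> b * h x y b) = h x y z" for y z
    using tr[of y z] by (simp add: mult.commute)
  have KX: "K x u X1 = ((n - 0) * r * h x X1 u) *\<^sub>R X1 - r *\<^sub>R u - (r * h x X1 u) *\<^sub>R X1 + (r * h x X1 u) *\<^sub>R X1" for u
    by (simp add: K_axis X1 b_commute[of u X1] n_def algebra_simps)
  have trK: "(\<Sum>b\<in>Basis. K x u b \<bullet> b) = 0" for u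
  proof -
    have "(\<Sum>b\<in>Basis. K x u b \<bullet> b) = (\<Sum>b\<in>Basis. (n + 2) * r * h x X1 u * (h x X1 b * (X1 \<bullet> b))
       - r * (h x u b * (X1 \<bullet> b)) - r * h x X1 u - r * (h x X1 b * (u \<bullet> b)))"
      by (rule sum.cong) (simp_all add: K_axis n_def inner_diff_left algebra_simps)
    also have "\<dots> = (n + 2) * r * h x X1 u * (\<Sum>b\<in>Basis. h x X1 b * (X1 \<bullet> b))
       - r * (\<Sum>b\<in>Basis. h x u b * (X1 \<bullet> b)) - n * (r * h x X1 u) - r * (\<Sum>b\<in>Basis. h x X1 b * (u \<bullet> b))"
      by (simp add: sum_subtractf sum_distrib_left n_def)
    finally show ?thesis
      by (simp add: tr X1 b_commute[of u X1]) (simp add: algebra_simps)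
  qed
  have "trace_form x u v = (\<Sum>b\<in>Basis. (n + 2) * r * h x X1 v * (h x X1 b * (K x u X1 \<bullet> b))
       - r * (h x v b * (K x u X1 \<bullet> b)) - r * h x X1 v * (K x u b \<bullet> b) - r * (h x X1 b * (K x u v \<bullet> b)))"
    unfolding trace_form_def
    by (rule sum.cong)
       (simp_all add: K_axis[of v] linear_add[OF linear_K[OF x]] linear_diff[OF linear_K[OF x]] linear_cmul[OF linear_K[OF x]] inner_diff_left n_def algebra_simps)
  also have "\<dots> = (n + 2) * r * h x X1 v * (\<Sum>b\<in>Basis. h x X1 b * (K x u X1 \<bullet> b))
       - r * (\<Sum>b\<in>Basis. h x v b * (K x u X1 \<bullet> b)) - r * h x X1 v * (\<Sum>b\<in>Basis. K x u b \<bullet> b)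
       - r * (\<Sum>b\<in>Basis. h x X1 b * (K x u v \<bullet> b))"
    by (simp add: sum_subtractf sum_distrib_left)
  also have "\<dots> = (n + 2) * r * h x X1 v * h x X1 (K x u X1) - r * h x v (K x u X1) - r * h x X1 (K x u v)"
    by (simp add: tr trK)
  also have "\<dots> = r\<^sup>2 * ((n - 2) * (n + 1) * h x X1 u * h x X1 v + 2 * h x u v)"
    unfolding KX K_axis[of u v]
    by (simp add: b_lin X1 b_commute[of v] b_commute[of u X1] n_def power2_eq_square algebra_simps)
  finally show ?thesis by (simp add: n_def)
qed

end

lemma positive_form_left: "x \<in> V \<Longrightarrow> linear (\<lambda>u. h x u v)"
  using linear_h[of x v] h_sym[of x _ v] by simp

text \<open>The axis is only given pointwise and up to sign.  It spans the simple eigenspace of the trace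
  form \<open>tr (K\<^sub>u K\<^sub>v)\<close>, so the projection of a fixed vector \<open>Y x0\<close> to it is smooth.\<close>

lemma ex_smooth_axis:
  assumes x0: "x0 \<in> V"
  obtains e X r where "e > 0" "ball x0 e \<subseteq> V" "smooth_on (ball x0 e) X" "smooth_on (ball x0 e) r"
    "\<And>x. x \<in> ball x0 e \<Longrightarrow> h x (X x) (X x) = 1" "\<And>x. x \<in> ball x0 e \<Longrightarrow> r x \<noteq> 0"
    "\<And>x u v w. x \<in> ball x0 e \<Longrightarrow> C3 x u v w = axis_cubic (real CARD('n)) (r x) (h x) (X x) u v w"
proof -
  define n where "n = real CARD('n)"
  have n: "n \<ge> 3" using dim by (simp add: n_def)
  have "\<exists>X1 r. h x X1 X1 = 1 \<and> r \<noteq> 0 \<and> (\<forall>u v w. C3 x u v w = axis_cubic n r (h x) X1 u v w)"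
    if x: "x \<in> V" for x
  proof -
    obtain X1 where X1: "symmetry_axis f \<xi> x X1" using symmetry[OF x] by blast
    obtain r where "r \<noteq> 0" "\<And>u v w. C3 x u v w = axis_cubic (real CARD('n)) r (h x) X1 u v w"
      by (rule cubic_form_axis[OF x X1]) (rule that)
    then show ?thesis unfolding n_def using axis_unit[OF X1] by blast
  qed
  then obtain Y s where Y: "\<And>x. x \<in> V \<Longrightarrow> h x (Y x) (Y x) = 1" and s: "\<And>x. x \<in> V \<Longrightarrow> s x \<noteq> 0"
    and C: "\<And>x u v w. x \<in> V \<Longrightarrow> C3 x u v w = axis_cubic n (s x) (h x) (Y x) u v w"
    by metis
  note C' = C[unfolded n_def]
  define T where "T u x = (s x)\<^sup>2 *\<^sub>R (((n - 2) * (n + 1) * h x (Y x) u) *\<^sub>R Y x + 2 *\<^sub>R u)" for u x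
  have T: "smooth_on V (T u)" for u
  proof (rule smooth_on_riesz[OF smooth_trace_form])
    fix x w assume x: "x \<in> V"
    interpret positive_form "h x" by (rule positive_form_h[OF x])
    show "h x (T u x) w = trace_form x u w"
      by (simp add: trace_form_axis[OF x Y[OF x] C'[OF x]] T_def b_lin n_def algebra_simps)
  qed
  \<comment> \<open>The denominator is the factor of \<open>(s x)\<^sup>2\<close> in the trace of
    the operator \<open>T\<close>; so \<open>\<rho>\<close> is the square of \<open>s\<close>,
    smooth even if the pointwise choice of signs in \<open>s\<close> jumps.\<close>
  define \<rho> where "\<rho> x = (\<Sum>b\<in>Basis. T b x \<bullet> b) / ((n + 2) * (n - 1))" for x
  have \<rho>: "smooth_on V \<rho>"
    unfolding \<rho>_def using n
    by (intro smooth_on_divide smooth_on_sum smooth_on_inner smooth_on_const T V) auto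
  have \<rho>_eq: "\<rho> x = (s x)\<^sup>2" if x: "x \<in> V" for x
  proof -
    interpret positive_form "h x" by (rule positive_form_h[OF x])
    have "(\<Sum>b\<in>Basis. T b x \<bullet> b) = (\<Sum>b\<in>Basis. (s x)\<^sup>2 * ((n - 2) * (n + 1)) * (h x (Y x) b * (Y x \<bullet> b)) + 2 * (s x)\<^sup>2)"
      by (rule sum.cong) (simp_all add: T_def inner_add_left algebra_simps)
    also have "\<dots> = (s x)\<^sup>2 * ((n - 2) * (n + 1)) * (\<Sum>b\<in>Basis. h x (Y x) b * (Y x \<bullet> b)) + n * (2 * (s x)\<^sup>2)"
      by (simp add: sum.distrib sum_distrib_left n_def)
    also have "\<dots> = (s x)\<^sup>2 * ((n + 2) * (n - 1))"
      by (simp add: trace_rank_one[OF b_linear] Y[OF x]) (simp add: algebra_simps)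
    finally show ?thesis using n by (simp add: \<rho>_def)
  qed
  \<comment> \<open>Solves the formula for \<open>T (Y x0) x\<close> for the projection of the fixed
    vector \<open>Y x0\<close> to the axis at \<open>x\<close>.\<close>
  define Z where "Z x = (1 / ((n - 2) * (n + 1))) *\<^sub>R ((1 / \<rho> x) *\<^sub>R T (Y x0) x - 2 *\<^sub>R Y x0)" for x
  have Z: "smooth_on V Z"
    unfolding Z_def using \<rho>_eq s
    by (intro smooth_on_scaleR smooth_on_diff smooth_on_divide smooth_on_const T \<rho> V) auto
  have Z_eq: "Z x = h x (Y x) (Y x0) *\<^sub>R Y x" if x: "x \<in> V" for x
    using n s[OF x] by (simp add: Z_def \<rho>_eq[OF x] T_def)
  have hZ: "smooth_on V (\<lambda>x. h x (Z x) (Z x))"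
    by (rule smooth_on_linear_field[OF V linear_h _ Z], assumption)
       (rule smooth_on_linear_field[OF V positive_form_left smooth_h Z])
  have hZ_eq: "h x (Z x) (Z x) = (h x (Y x) (Y x0))\<^sup>2" if x: "x \<in> V" for x
  proof -
    interpret positive_form "h x" by (rule positive_form_h[OF x])
    show ?thesis by (simp add: Z_eq[OF x] b_lin Y[OF x] power2_eq_square)
  qed
  obtain e where e: "e > 0" "ball x0 e \<subseteq> V" "\<And>x. x \<in> ball x0 e \<Longrightarrow> h x (Z x) (Z x) > 0"
    by (rule ball_pos[OF V x0 smooth_on_continuous_on[OF hZ]]) (auto simp: hZ_eq[OF x0] Y[OF x0])
  define B where "B = ball x0 e"
  have B: "open B" "B \<subseteq> V" and BV: "\<And>x. x \<in> B \<Longrightarrow> x \<in> V" using e by (auto simp: B_def)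
  have pos: "h x (Z x) (Z x) > 0" if "x \<in> B" for x using e(3) that by (simp add: B_def)
  define X where "X x = (1 / sqrt (h x (Z x) (Z x))) *\<^sub>R Z x" for x
  have sq: "sqrt (h x (Z x) (Z x)) \<noteq> 0" if "x \<in> B" for x using pos[OF that] by simp
  have smX: "smooth_on B X"
    unfolding X_def[abs_def]
    by (intro smooth_on_scaleR smooth_on_divide smooth_on_const smooth_on_sqrt B
        smooth_on_subset[OF hZ] smooth_on_subset[OF Z] pos sq)
  \<comment> \<open>Normalizing \<open>Z\<close> changes the chosen axis by this sign, and
    \<open>r\<close> acquires the same sign; \<open>axis_cubic\<close> is unchanged when both are
    reversed.\<close>
  define \<delta> where "\<delta> x = sgn (h x (Y x) (Y x0))" for x
  have X_eq: "X x = \<delta> x *\<^sub>R Y x" and \<delta>: "\<delta> x * \<delta> x = 1" if x: "x \<in> B" for x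
  proof -
    have "h x (Y x) (Y x0) \<noteq> 0" using pos[OF x] hZ_eq[OF BV[OF x]] by auto
    moreover have "sqrt (h x (Z x) (Z x)) = \<bar>h x (Y x) (Y x0)\<bar>"
      by (simp only: hZ_eq[OF BV[OF x]] real_sqrt_abs)
    then have "X x = (1 / \<bar>h x (Y x) (Y x0)\<bar>) *\<^sub>R (h x (Y x) (Y x0) *\<^sub>R Y x)"
      by (simp only: X_def Z_eq[OF BV[OF x]])
    ultimately show "X x = \<delta> x *\<^sub>R Y x" "\<delta> x * \<delta> x = 1"
      by (simp_all add: \<delta>_def sgn_if abs_if)
  qed
  define r where "r x = h x (K x (X x) (X x)) (X x) / (n - 1)" for x
  have smKX: "smooth_on B (\<lambda>x. K x (X x) (X x))"
  proof (rule smooth_on_linear_field[OF B(1) _ _ smX, where B = "\<lambda>x. K x (X x)"])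
    show "linear (K x (X x))" if "x \<in> B" for x using linear_K[OF BV[OF that]] .
    have "smooth_on B (\<lambda>x. K x v (X x))" for v
      by (rule smooth_on_linear_field[OF B(1) linear_K[OF BV] smooth_on_subset[OF smooth_K B(2)] smX])
    then show "smooth_on B (\<lambda>x. K x (X x) v)" for v
    proof (rule smooth_on_cong[OF B(1), rotated])
      fix x assume x: "x \<in> B"
      interpret positive_form "h x" by (rule positive_form_h[OF BV[OF x]])
      show "K x v (X x) = K x (X x) v"
        by (rule b_nondegenerate) (simp add: diff_tensor_C3[OF BV[OF x]] C3_commute(1)[OF BV[OF x], of v])
    qed
  qed
  have smr: "smooth_on B r"
    unfolding r_def[abs_def] using n
    by (intro smooth_on_divide smooth_on_const B smooth_on_linear_field[OF B(1) linear_h[OF BV] _ smX]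
        smooth_on_linear_field[OF B(1) positive_form_left[OF BV] smooth_on_subset[OF smooth_h B(2)] smKX]) auto
  have r_eq: "r x = \<delta> x * s x" if x: "x \<in> B" for x
  proof -
    interpret positive_form "h x" by (rule positive_form_h[OF BV[OF x]])
    have "C3 x (X x) (X x) (X x) = (\<delta> x * \<delta> x) * (\<delta> x * (n - 1) * s x)"
      by (simp add: C[OF BV[OF x]] X_eq[OF x] axis_cubic_def b_lin Y[OF BV[OF x]] algebra_simps)
    then show ?thesis
      using n by (simp add: r_def diff_tensor_C3[OF BV[OF x]] \<delta>[OF x])
  qed
  have "C3 x u v w = axis_cubic n (r x) (h x) (X x) u v w" if x: "x \<in> B" for x u v w
  proof -
    interpret positive_form "h x" by (rule positive_form_h[OF BV[OF x]])
    have "axis_cubic n (r x) (h x) (X x) u v w = (\<delta> x * \<delta> x) * ((\<delta> x * \<delta> x) *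
        ((n + 2) * s x * h x (Y x) u * h x (Y x) v * h x (Y x) w))
        - (\<delta> x * \<delta> x) * (s x * (h x (Y x) u * h x v w + h x (Y x) v * h x u w + h x (Y x) w * h x u v))"
      by (simp add: X_eq[OF x] r_eq[OF x] axis_cubic_def b_lin algebra_simps)
    then show ?thesis
      by (simp add: \<delta>[OF x] C[OF BV[OF x]] axis_cubic_def)
  qed
  moreover have "h x (X x) (X x) = 1" if x: "x \<in> B" for x
  proof -
    interpret positive_form "h x" by (rule positive_form_h[OF BV[OF x]])
    show ?thesis by (simp add: X_eq[OF x] b_lin Y[OF BV[OF x]] \<delta>[OF x])
  qed
  moreover have "r x \<noteq> 0" if x: "x \<in> B" for x
    using r_eq[OF x] s[OF BV[OF x]] \<delta>[OF x] by auto
  ultimately show ?thesis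
    using that[of e X r] e(1,2) smX smr unfolding B_def n_def by blast
qed

text \<open>The derivative of \<open>\<xi>\<close> is \<open>- l\<close> times that of
  \<open>f\<close>, so \<open>f + \<xi> / l\<close> is constant. It is the centre \<open>c0\<close>,
  and \<open>- \<xi> / l\<close> is the position vector from it; replacing \<open>\<xi>\<close> by
  this vector multiplies transversal components by \<open>- l\<close>.\<close>

lemma ex_axial_affine_sphere:
  assumes x0: "x0 \<in> V"
  obtains e X r c0 where "e > 0" "ball x0 e \<subseteq> V"
    "axial_affine_sphere (ball x0 e) (\<lambda>x. (- 1 / l) *\<^sub>R \<xi> x) G h (tan_part f \<xi>)
       (\<lambda>x y. - l * trans_part f \<xi> x y) X r l (real CARD('n))"
    "\<And>x. x \<in> ball x0 e \<Longrightarrow> f x = c0 + (- 1 / l) *\<^sub>R \<xi> x"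
proof -
  obtain e X r where e: "e > 0" "ball x0 e \<subseteq> V" and sm: "smooth_on (ball x0 e) X" "smooth_on (ball x0 e) r"
    and X: "\<And>x. x \<in> ball x0 e \<Longrightarrow> h x (X x) (X x) = 1" and r: "\<And>x. x \<in> ball x0 e \<Longrightarrow> r x \<noteq> 0"
    and C: "\<And>x u v w. x \<in> ball x0 e \<Longrightarrow> C3 x u v w = axis_cubic (real CARD('n)) (r x) (h x) (X x) u v w"
    by (rule ex_smooth_axis[OF x0]) (rule that)
  define B where "B = ball x0 e"
  note sm = sm[folded B_def] and X = X[folded B_def] and r = r[folded B_def] and C = C[folded B_def]
  have B: "open B" "convex B" "B \<subseteq> V" "x0 \<in> B" and BV: "\<And>x. x \<in> B \<Longrightarrow> x \<in> V" using e by (auto simp: B_def)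
  define g where "g x = (- 1 / l) *\<^sub>R \<xi> x" for x
  have smg: "smooth_on V g"
    unfolding g_def[abs_def] by (intro smooth_on_scaleR smooth_on_const smooth_\<xi> V)
  have dg: "fder g x = fder f x" if x: "x \<in> V" for x
    using fder_eq[OF has_derivative_scaleR_right[OF smooth_on_has_derivative[OF smooth_\<xi> x], of "- 1 / l"]] l_nz
    by (simp add: g_def[abs_def] fder_\<xi>[OF x] fun_eq_iff)
  have "axial_affine_sphere B g G h (tan_part f \<xi>) (\<lambda>x y. - l * trans_part f \<xi> x y) X r l (real CARD('n))"
  proof (rule axial_affine_sphere.intro)
    show "open B" "convex B" by (fact B)+
    show "3 \<le> real CARD('n)" using dim by simp
    show "smooth_on B g" "smooth_on B (\<lambda>x. h x u v)" "smooth_on B (\<lambda>x. G x u v)"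
      "smooth_on B (\<lambda>x. tan_part f \<xi> x y)" for u v y
      using smooth_parts[OF smooth_on_const, of y]
      by (auto intro: smooth_on_subset[OF _ B(3)] smg smooth_h smooth_G)
    show "smooth_on B (\<lambda>x. - l * trans_part f \<xi> x y)" for y
      by (intro smooth_on_mult smooth_on_const smooth_on_subset[OF smooth_parts(2)[OF smooth_on_const] B(3)] B)
    show "smooth_on B X" "smooth_on B r" by (fact sm)+
    show "fder (\<lambda>y. fder g y v) x u = fder g x (G x u v) - (l * h x u v) *\<^sub>R g x" if x: "x \<in> B" for x u v
    proof -
      have "fder (\<lambda>y. fder g y v) x = fder (\<lambda>y. fder f y v) x"
        by (rule fder_cong[OF V BV[OF x]]) (simp add: dg)
      then show ?thesis
        using gauss[OF BV[OF x], of u v] l_nz by (simp add: flat_deriv_def dg[OF BV[OF x]] g_def)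
    qed
    show "v = 0 \<and> a = 0" if x: "x \<in> B" and 0: "fder g x v + a *\<^sub>R g x = 0" for x v a
      using transversal[OF BV[OF x], of v "- a / l"] 0 l_nz by (simp add: dg[OF BV[OF x]] g_def)
    show "y = fder g x (tan_part f \<xi> x y) + (- l * trans_part f \<xi> x y) *\<^sub>R g x" if x: "x \<in> B" for x y
      using parts[OF BV[OF x], of y] l_nz by (simp add: dg[OF BV[OF x]] g_def)
    show "fder (\<lambda>y. h y u v) x w = h x (G x w u) v + h x u (G x w v)
        - 2 * axis_cubic (real CARD('n)) (r x) (h x) (X x) w u v" if x: "x \<in> B" for x u v w
      using C[OF x, of w u v] by (simp add: C3_def)
    show "linear (h x u)" if "x \<in> B" for x u by (rule linear_h[OF BV[OF that]])
    show "linear (G x u)" if "x \<in> B" for x u by (rule linear_G[OF BV[OF that]])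
    show "h x u v = h x v u" if "x \<in> B" for x u v by (rule h_sym[OF BV[OF that]])
    show "G x u v = G x v u" if "x \<in> B" for x u v by (rule G_sym[OF BV[OF that]])
    show "0 < h x v v" if "x \<in> B" "v \<noteq> 0" for x v by (rule positive[OF BV[OF that(1)] that(2)])
  qed (simp_all add: X r l_nz)
  moreover obtain c0 where "\<And>x. x \<in> B \<Longrightarrow> f x = c0 + (- 1 / l) *\<^sub>R \<xi> x"
  proof -
    have "((\<lambda>x. f x - g x) has_derivative (\<lambda>u. 0)) (at x within B)" if x: "x \<in> B" for x
      using has_derivative_diff[OF smooth_on_has_derivative[OF smooth_f BV[OF x]] smooth_on_has_derivative[OF smg BV[OF x]]]
      by (simp add: dg[OF BV[OF x]] has_derivative_at_withinI)
    from has_derivative_zero_constant[OF B(2) this]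
    obtain c0 where c0: "\<forall>x\<in>B. f x - g x = c0" ..
    show ?thesis
    proof (rule that)
      show "f x = c0 + (- 1 / l) *\<^sub>R \<xi> x" if "x \<in> B" for x
        using bspec[OF c0 that] unfolding g_def by (simp only: diff_eq_eq)
    qed
  qed
  ultimately show ?thesis
    using that[of e X r c0] e unfolding B_def g_def[abs_def] by blast
qed

end

section \<open>From coordinates to the manifold\<close>

text \<open>The new transition maps are the old ones composed with \<open>\<kappa>\<close> in one
  direction and with its inverse \<open>(\<sigma>, \<eta>)\<close>, smooth on all of
  \<open>B\<close>, in the other.\<close>

lemma adapted_chart_local_parametrization:
  fixes \<psi> :: "'a::euclidean_space \<Rightarrow> 'm" and \<eta> :: "'a \<Rightarrow> 'c::euclidean_space"
    and A :: "('b::euclidean_space set \<times> ('b \<Rightarrow> 'm)) set"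
  assumes loc: "local_parametrization M A V \<psi>"
    and compat: "\<And>V' \<psi>'. (V', \<psi>') \<in> A \<Longrightarrow> open V' \<and> openin M (\<psi>' ` V') \<and>
      homeomorphic_map (top_of_set V') (subtopology M (\<psi>' ` V')) \<psi>'"
    and ch: "adapted_chart B x0 \<sigma> \<eta> I W \<kappa>" and B: "open B" "B \<subseteq> V"
  shows "local_parametrization M A (I \<times> W) (\<psi> \<circ> \<kappa>)"
proof -
  define S where "S = \<kappa> ` (I \<times> W)"
  define \<tau> where "\<tau> = (\<lambda>x. (\<sigma> x, \<eta> x))"
  have IW: "open (I \<times> W)" and S: "open S" "S \<subseteq> B" and sm\<kappa>: "smooth_on (I \<times> W) \<kappa>"
    and sm\<tau>: "smooth_on B \<tau>" and hom: "homeomorphism (I \<times> W) S \<kappa> \<tau>"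
    using ch by (auto simp: adapted_chart_def S_def \<tau>_def open_Times)
  have V: "open V" and opV: "openin M (\<psi> ` V)"
    and homV: "homeomorphic_map (top_of_set V) (subtopology M (\<psi> ` V)) \<psi>"
    and trans: "\<And>V' \<psi>'. (V', \<psi>') \<in> A \<Longrightarrow> smooth_on (V \<inter> \<psi> -` (\<psi>' ` V')) (inv_into V' \<psi>' \<circ> \<psi>)"
      "\<And>V' \<psi>'. (V', \<psi>') \<in> A \<Longrightarrow> smooth_on (V' \<inter> \<psi>' -` (\<psi> ` V)) (inv_into V \<psi> \<circ> \<psi>')"
    using loc by (auto simp: local_parametrization_def)
  have SV: "S \<subseteq> V" using S B by auto
  have inj: "inj_on \<psi> V"
    using homeomorphic_imp_injective_map[OF homV] by simp
  have preimage: "open (V' \<inter> \<psi>' -` T)"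
    if V': "open V'" and h: "homeomorphic_map (top_of_set V') (subtopology M (\<psi>' ` V')) \<psi>'"
      and T: "openin M T" for V' :: "'d::topological_space set" and \<psi>' T
  proof -
    have "continuous_map (top_of_set V') M \<psi>'"
      using homeomorphic_imp_continuous_map[OF h] continuous_map_in_subtopology by blast
    then have "openin (top_of_set V') {x \<in> V'. \<psi>' x \<in> T}"
      using openin_continuous_map_preimage[OF _ T] by fastforce
    then have "open {x \<in> V'. \<psi>' x \<in> T}"
      using V' openin_open_eq by blast
    then show ?thesis by (simp add: vimage_def Int_def)
  qed
  have opS: "openin M (\<psi> ` S)"
  proof -
    have "openin (top_of_set V) S" using S SV V openin_open_eq by blast
    then have "openin (subtopology M (\<psi> ` V)) (\<psi> ` S)"
      using homeomorphic_imp_open_map[OF homV] by (auto simp: open_map_def)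
    then show ?thesis using openin_open_subtopology[OF opV] by blast
  qed
  have "homeomorphic_map (top_of_set (I \<times> W)) (top_of_set S) \<kappa>"
    using hom unfolding homeomorphic_map_maps homeomorphic_maps_def homeomorphism_def
    by (intro exI[of _ \<tau>]) (auto simp: continuous_map_subtopology_eu)
  moreover have "homeomorphic_map (subtopology (top_of_set V) S) (subtopology (subtopology M (\<psi> ` V)) (\<psi> ` S)) \<psi>"
  proof (rule homeomorphic_map_subtopologies[OF homV])
    show "\<psi> ` (topspace (top_of_set V) \<inter> S) = topspace (subtopology M (\<psi> ` V)) \<inter> \<psi> ` S"
      using SV openin_subset[OF opV] by auto
  qed
  then have "homeomorphic_map (top_of_set S) (subtopology M (\<psi> ` S)) \<psi>"
    using SV by (simp add: subtopology_subtopology Int_absorb1 image_mono)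
  ultimately have "homeomorphic_map (top_of_set (I \<times> W)) (subtopology M (\<psi> ` S)) (\<psi> \<circ> \<kappa>)"
    by (rule homeomorphic_map_compose)
  moreover have im: "(\<psi> \<circ> \<kappa>) ` (I \<times> W) = \<psi> ` S"
    by (auto simp: S_def)
  moreover have "smooth_on ((I \<times> W) \<inter> (\<psi> \<circ> \<kappa>) -` (\<psi>' ` V')) (inv_into V' \<psi>' \<circ> (\<psi> \<circ> \<kappa>)) \<and>
      smooth_on (V' \<inter> \<psi>' -` ((\<psi> \<circ> \<kappa>) ` (I \<times> W))) (inv_into (I \<times> W) (\<psi> \<circ> \<kappa>) \<circ> \<psi>')"
    if A: "(V', \<psi>') \<in> A" for V' \<psi>'
  proof
    have V': "open V'" and opV': "openin M (\<psi>' ` V')"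
      and h': "homeomorphic_map (top_of_set V') (subtopology M (\<psi>' ` V')) \<psi>'"
      using compat[OF A] by auto
    have o1: "open (V \<inter> \<psi> -` (\<psi>' ` V'))" by (rule preimage[OF V homV opV'])
    have eq: "(I \<times> W) \<inter> (\<psi> \<circ> \<kappa>) -` (\<psi>' ` V') = (I \<times> W) \<inter> \<kappa> -` (V \<inter> \<psi> -` (\<psi>' ` V'))"
      using SV by (auto simp: S_def)
    have o2: "open ((I \<times> W) \<inter> \<kappa> -` (V \<inter> \<psi> -` (\<psi>' ` V')))"
      using continuous_on_open_vimage[OF IW] smooth_on_continuous_on[OF sm\<kappa>] o1
      by (metis Int_commute)
    have "smooth_on ((I \<times> W) \<inter> \<kappa> -` (V \<inter> \<psi> -` (\<psi>' ` V'))) (\<lambda>z. (inv_into V' \<psi>' \<circ> \<psi>) (\<kappa> z))"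
      by (rule smooth_on_comp[OF o2 o1 _ smooth_on_subset[OF sm\<kappa>] trans(1)[OF A]]) auto
    then show "smooth_on ((I \<times> W) \<inter> (\<psi> \<circ> \<kappa>) -` (\<psi>' ` V')) (inv_into V' \<psi>' \<circ> (\<psi> \<circ> \<kappa>))"
      unfolding eq by (simp add: o_def)
    have o3: "open (V' \<inter> \<psi>' -` (\<psi> ` S))" by (rule preimage[OF V' h' opS])
    have sub: "V' \<inter> \<psi>' -` (\<psi> ` S) \<subseteq> V' \<inter> \<psi>' -` (\<psi> ` V)" using SV by auto
    have inv: "(inv_into V \<psi> \<circ> \<psi>') y \<in> S" if "y \<in> V' \<inter> \<psi>' -` (\<psi> ` S)" for y
      using that SV inj by (auto simp: inv_into_f_f subset_iff)
    have c1: "smooth_on (V' \<inter> \<psi>' -` (\<psi> ` S)) (\<lambda>y. \<tau> ((inv_into V \<psi> \<circ> \<psi>') y))"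
      by (rule smooth_on_comp[OF o3 B(1) _ smooth_on_subset[OF trans(2)[OF A] sub] sm\<tau>])
         (use inv S in blast)
    have c2: "\<tau> ((inv_into V \<psi> \<circ> \<psi>') y) = (inv_into (I \<times> W) (\<psi> \<circ> \<kappa>) \<circ> \<psi>') y"
      if y: "y \<in> V' \<inter> \<psi>' -` (\<psi> ` S)" for y
    proof -
      obtain z where z: "z \<in> I \<times> W" "\<psi>' y = \<psi> (\<kappa> z)" using y by (auto simp: S_def)
      have "inj_on (\<psi> \<circ> \<kappa>) (I \<times> W)"
        using hom SV inj by (intro comp_inj_on) (auto simp: homeomorphism_def S_def intro: inj_on_inverseI inj_on_subset)
      then have "inv_into (I \<times> W) (\<psi> \<circ> \<kappa>) (\<psi>' y) = z"
        using z by (metis comp_apply inv_into_f_f)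
      moreover have "\<kappa> z \<in> V" using z SV by (auto simp: S_def)
      then have "inv_into V \<psi> (\<psi>' y) = \<kappa> z" using z inj by simp
      ultimately show ?thesis
        using z hom by (cases z) (simp add: homeomorphism_def)
    qed
    from smooth_on_cong[OF o3 c2 c1] show "smooth_on (V' \<inter> \<psi>' -` ((\<psi> \<circ> \<kappa>) ` (I \<times> W))) (inv_into (I \<times> W) (\<psi> \<circ> \<kappa>) \<circ> \<psi>')"
      unfolding im .
  qed
  ultimately show ?thesis
    unfolding local_parametrization_def im using IW opS by auto
qed

lemma affine_transformation_inverse:
  fixes L :: "real^'n \<Rightarrow> real^'n"
  assumes "linear L" "inj L"
  obtains \<Phi> where "affine_transformation \<Phi>" "\<And>y. \<Phi> (L y) = c + y"
proof -
  obtain L' where L': "linear L'" "L' \<circ> L = id"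
    using linear_injective_left_inverse[OF assms] by blast
  have "L \<circ> L' = id"
    using linear_inverse_left[OF assms(1) L'(1)] L'(2) by blast
  then have "inj L'" by (metis inj_on_id inj_on_imageI2)
  then have "invertible (matrix L')"
    using det_nz_iff_inj[OF L'(1)] invertible_det_nz by blast
  then have "affine_transformation (\<lambda>y. matrix L' *v y + c)"
    by (auto simp: affine_transformation_def)
  moreover have "matrix L' *v L y + c = c + y" for y
    using matrix_works[OF L'(1)[folded linear_matrix_vector_mul_eq]] L'(2) by (simp add: pointfree_idE)
  ultimately show ?thesis by (rule that)
qed

lemma blaschke_normal_form:
  fixes V :: "(real^('k::finite) option) set"
  assumes "blaschke_chart V f \<xi> l" and x0: "x0 \<in> V"
  obtains B \<sigma> \<eta> I and W :: "(real^'k) set" and \<kappa> \<Phi> g where "open B" "B \<subseteq> V" "adapted_chart B x0 \<sigma> \<eta> I W \<kappa>"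
    "affine_transformation \<Phi>" "\<And>z. z \<in> I \<times> W \<Longrightarrow> f (\<kappa> z) = \<Phi> (g z)"
    "elliptic_model CARD('k option) I W g \<or> parabolic_model CARD('k option) I W g"
proof -
  interpret blaschke_chart V f \<xi> l by fact
  obtain e X r c0 where e: "ball x0 e \<subseteq> V" "e > 0"
    and ax: "axial_affine_sphere (ball x0 e) (\<lambda>x. (- 1 / l) *\<^sub>R \<xi> x) G h (tan_part f \<xi>)
       (\<lambda>x y. - l * trans_part f \<xi> x y) X r l (real CARD('k option))"
    and fc: "\<And>x. x \<in> ball x0 e \<Longrightarrow> f x = c0 + (- 1 / l) *\<^sub>R \<xi> x"
    by (rule ex_axial_affine_sphere[OF x0]) (rule that)
  interpret S: axial_affine_sphere_in_space "ball x0 e" "\<lambda>x. (- 1 / l) *\<^sub>R \<xi> x" G h "tan_part f \<xi>"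
    "\<lambda>x y. - l * trans_part f \<xi> x y" X r l "real CARD('k option)"
    by (intro axial_affine_sphere_in_space.intro ax)
  have mem: "x0 \<in> ball x0 e" using e by simp
  obtain B \<sigma> \<eta> I and W :: "(real^'k) set" and \<kappa> L where B: "open B" "B \<subseteq> ball x0 e"
    and ch: "adapted_chart B x0 \<sigma> \<eta> I W \<kappa>" and L: "linear L" "inj L"
    and model: "elliptic_model CARD('k option) I W (\<lambda>z. L ((- 1 / l) *\<^sub>R \<xi> (\<kappa> z))) \<or>
      parabolic_model CARD('k option) I W (\<lambda>z. L ((- 1 / l) *\<^sub>R \<xi> (\<kappa> z)))"
  proof (cases "S.kk x0 = 0")
    case True
    show ?thesis
      by (rule S.parabolic_normal_form[OF mem True]) (rule that, assumption+, rule disjI2)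
  next
    case False
    show ?thesis
      by (rule S.elliptic_normal_form[OF mem False]) (rule that, assumption+, rule disjI1)
  qed
  obtain \<Phi> where \<Phi>: "affine_transformation \<Phi>" "\<And>y. \<Phi> (L y) = c0 + y"
    by (rule affine_transformation_inverse[OF L]) (rule that)
  have "f (\<kappa> z) = \<Phi> (L ((- 1 / l) *\<^sub>R \<xi> (\<kappa> z)))" if "z \<in> I \<times> W" for z
    using adapted_chart_inverse(3)[OF ch, of "fst z" "snd z"] that B(2) by (auto simp: \<Phi>(2) fc)
  then show ?thesis
    using that[of B \<sigma> \<eta> I W \<kappa> \<Phi> "\<lambda>z. L ((- 1 / l) *\<^sub>R \<xi> (\<kappa> z))"] B e ch \<Phi>(1) model by blast
qed

theorem theorem4p2:
  fixes M :: "'m topology"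
    and A :: "((real^('k::finite) option) set \<times> (real^'k option \<Rightarrow> 'm)) set"
    and F \<xi> :: "'m \<Rightarrow> real^'k option option"
    and n :: nat
  assumes n: "n = CARD('k option)" "n \<ge> 3"
    and manifold: "smooth_manifold M A"
    and immersed: "immersed_hypersurface A F"
    and normal: "affine_normal A F \<xi>"
    and convex: "strictly_locally_convex A F \<xi>"
    and sphere: "proper_affine_sphere A F \<xi>"
    and symmetry: "pointwise_SO_symmetry A F \<xi>"
    and r_nonzero: "symmetry_coeff_nonvanishing A F \<xi>"
    and p: "p \<in> topspace M"
  shows "\<exists>(I :: real set) (W :: (real^'k) set) \<kappa> \<Phi>.
     is_interval I \<and> open I \<and> open W \<and>
     local_parametrization M A (I \<times> W) \<kappa> \<and> p \<in> \<kappa> ` (I \<times> W) \<and>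
     affine_transformation \<Phi> \<and>
     ((\<exists>\<epsilon> \<phi> \<gamma>1 \<gamma>2 c.
         (\<epsilon> = 1 \<or> \<epsilon> = -1) \<and> quadric_immersion \<epsilon> W \<phi> \<and>
         centro_affine_curve I \<gamma>1 \<gamma>2 \<and> c \<noteq> 0 \<and>
         (\<forall>t\<in>I. c * (deriv \<gamma>2 t * \<gamma>1 t - deriv \<gamma>1 t * \<gamma>2 t) ^ (n + 2) * \<gamma>1 t ^ (n - 1) =
            deriv \<gamma>2 t ^ (n - 1) *
              (deriv (deriv \<gamma>1) t * deriv \<gamma>2 t - deriv (deriv \<gamma>2) t * deriv \<gamma>1 t)) \<and>
         (\<forall>t\<in>I. \<forall>u\<in>W. F (\<kappa> (t, u)) = \<Phi> (vsnoc (\<gamma>1 t *\<^sub>R \<phi> u) (\<gamma>2 t))))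
      \<or>
      (\<exists>\<gamma>1 \<gamma>2 c.
         centro_affine_curve I \<gamma>1 \<gamma>2 \<and> c \<noteq> 0 \<and>
         (\<forall>t\<in>I. c * (deriv \<gamma>1 t * \<gamma>2 t - deriv \<gamma>2 t * \<gamma>1 t) ^ (n + 2) * \<gamma>1 t ^ (n - 1) =
            deriv \<gamma>1 t ^ (n - 1) *
              (deriv (deriv \<gamma>2) t * deriv \<gamma>1 t - deriv (deriv \<gamma>1) t * deriv \<gamma>2 t)) \<and>
         (\<forall>t\<in>I. \<forall>u\<in>W. F (\<kappa> (t, u)) =
            \<Phi> (vsnoc (vsnoc (\<gamma>1 t *\<^sub>R u) (\<gamma>1 t * ((norm u)\<^sup>2 / 2) + \<gamma>2 t)) (\<gamma>1 t)))))"
proof -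
  obtain l where l: "l \<noteq> 0"
    "\<And>V \<psi> x v. (V, \<psi>) \<in> A \<Longrightarrow> x \<in> V \<Longrightarrow> shape_op (F \<circ> \<psi>) (\<xi> \<circ> \<psi>) x v = l *\<^sub>R v"
    using sphere unfolding proper_affine_sphere_def by fast
  have "p \<in> (\<Union>(V, \<psi>)\<in>A. \<psi> ` V)"
    using manifold p by (simp add: smooth_manifold_def)
  then obtain V \<psi> x0 where A: "(V, \<psi>) \<in> A" and x0: "x0 \<in> V" "p = \<psi> x0" by auto
  have loc: "local_parametrization M A V' \<psi>'" if "(V', \<psi>') \<in> A" for V' \<psi>'
    using manifold that by (auto simp: smooth_manifold_def)
  have "blaschke_chart V (F \<circ> \<psi>) (\<xi> \<circ> \<psi>) l"
  proof
    show "open V" using loc[OF A] by (simp add: local_parametrization_def)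
    show "immersion_on V (F \<circ> \<psi>)" using immersed A by (auto simp: immersed_hypersurface_def)
    show "affine_normal_on V (F \<circ> \<psi>) (\<xi> \<circ> \<psi>)" using normal A by (auto simp: affine_normal_def)
    show "0 < aff_form (F \<circ> \<psi>) (\<xi> \<circ> \<psi>) x v v" if "x \<in> V" "v \<noteq> 0" for x v
      using convex A that by (auto simp: strictly_locally_convex_def)
    show "\<exists>X1. symmetry_axis (F \<circ> \<psi>) (\<xi> \<circ> \<psi>) x X1" if "x \<in> V" for x
      using symmetry A that by (auto simp: pointwise_SO_symmetry_def)
    show "r \<noteq> 0" if "x \<in> V" "symmetry_axis (F \<circ> \<psi>) (\<xi> \<circ> \<psi>) x X1"
      "symmetry_coeff (F \<circ> \<psi>) (\<xi> \<circ> \<psi>) x X1 r" for x X1 r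
      using r_nonzero A that unfolding symmetry_coeff_nonvanishing_def by fast
    show "3 \<le> CARD('k option)" using n by simp
  qed (use l A in auto)
  then obtain B \<sigma> \<eta> I and W :: "(real^'k) set" and \<kappa> \<Phi> g where B: "open B" "B \<subseteq> V"
    and ch: "adapted_chart B x0 \<sigma> \<eta> I W \<kappa>" and \<Phi>: "affine_transformation \<Phi>"
    and F: "\<And>z. z \<in> I \<times> W \<Longrightarrow> (F \<circ> \<psi>) (\<kappa> z) = \<Phi> (g z)"
    and model: "elliptic_model CARD('k option) I W g \<or> parabolic_model CARD('k option) I W g"
    by (rule blaschke_normal_form[OF _ x0(1)]) (rule that)
  have par: "local_parametrization M A (I \<times> W) (\<psi> \<circ> \<kappa>)"
    by (rule adapted_chart_local_parametrization[OF loc[OF A] _ ch B])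
       (use loc in \<open>auto simp: local_parametrization_def\<close>)
  have I: "is_interval I" "open I" "open W" and "x0 \<in> \<kappa> ` (I \<times> W)"
    using ch by (auto simp: adapted_chart_def)
  then have p': "p \<in> (\<psi> \<circ> \<kappa>) ` (I \<times> W)" using x0(2) by auto
  have F': "\<forall>t\<in>I. \<forall>u\<in>W. F ((\<psi> \<circ> \<kappa>) (t, u)) = \<Phi> (e t u)"
    if "\<forall>t\<in>I. \<forall>u\<in>W. g (t, u) = e t u" for e
    using F that by (metis SigmaI comp_apply)
  show ?thesis
  proof (intro exI conjI)
    show "is_interval I" "open I" "open W" "local_parametrization M A (I \<times> W) (\<psi> \<circ> \<kappa>)"
      "p \<in> (\<psi> \<circ> \<kappa>) ` (I \<times> W)" "affine_transformation \<Phi>"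
      by fact+
  \<comment> \<open>The two models are the alternatives of the conclusion written for
    \<open>g\<close>; only the last conjunct of each has to be changed, by
    \<open>F'\<close>.\<close>
  qed (insert model[folded n(1)], unfold elliptic_model_def parabolic_model_def,
      elim disj_forward ex_forward conj_forward, (assumption | rule F')+)
qed

end
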